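(* For $\beta\ge 0$, consider the homogeneous ferromagnetic Ising model on $\mathbb Z^2$ at inverse temperature $\beta$, with plus and minus phases $\mu_\beta^+$ and $\mu_\beta^-$ and critical value $\beta^c$. For $\varepsilon\in(0,1)$ let $\mathbb P^{+}_{\beta,\varepsilon}$ (respectively $\mathbb P^{-}_{\beta,\varepsilon}$) be the image of $\mu_\beta^+\otimes\nu_\varepsilon$ (respectively $\mu_\beta^-\otimes\nu_\varepsilon$) under the map $S\times S\ni(x^1,x^2)\mapsto x\in S$, $x_i=x^1_i\wedge x^2_i$ for all $i\in\mathbb Z^2$. The following two statements hold. 1. For all sufficiently large $\beta>\frac12\ln 3$ (i.e. there is $\beta_0\ge\frac12\ln3$ such that for all $\beta>\beta_0$) and all $\varepsilon\in(0,1)$ with $\varepsilon<\frac13-e^{-2\beta}$, $$\mathbb P^{+}_{\beta,\varepsilon}\Big(\bigcap_{i\in\mathbb Z^2}\{|C_i(X)|<\infty\}\Big)=1.$$ 2. For all $\beta>\beta^c$ and all $\varepsilon\in(0,1)$, $$\mathbb P^{-}_{\beta,\varepsilon}\Big(\bigcup_{i\in\mathbb Z^2}\{|C_i(X)|=\infty\}\Big)=1.$$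
   Context: Let $A=\{-1,1\}$ and $S=A^{\mathbb Z^2}$, with product $\sigma$-algebra $\mathcal S$. For $x\in S$ and $F\subset\mathbb Z^2$, $x_F=(x_i)_{i\in F}$. $X_i(x)=x_i$ are the coordinate projections and $X=(X_i)_{i\in\mathbb Z^2}$. $\|i\|_1=|i_1|+|i_2|$; $i,j\in\mathbb Z^2$ are $L^1$-neighbors if $\|i-j\|_1=1$. $\nu_\varepsilon=\prod_{i\in\mathbb Z^2}(\varepsilon\delta_{-1}+(1-\varepsilon)\delta_{+1})$ is the Bernoulli product measure on $(S,\mathcal S)$. Ising model: for finite $\Lambda\subset\mathbb Z^2$, $x,y\in S$, $\beta\ge0$, $$p_{\Lambda,\beta}(x_\Lambda\mid y_{\Lambda^c})=\frac1{Z^y_{\Lambda,\beta}}\exp\Big(\beta\Big[\tfrac12\sum_{i\in\Lambda}\sum_{j\in\Lambda,\|i-j\|_1=1}x_ix_j+\sum_{i\in\Lambda}\sum_{j\in\Lambda^c,\|i-j\|_1=1}x_iy_j\Big]\Big),$$ with $Z^y_{\Lambda,\beta}$ the normalizing constant (sum over $x_\Lambda\in A^\Lambda$). $\mu_\beta^+$ and $\mu_\beta^-$ are the limits as $\Lambda\to\mathbb Z^2$ of these finite-volume measures with external configuration $y_j=+1$ for all $j\in\Lambda^c$, respectively $y_j=-1$ for all $j\in\Lambda^c$. $\beta^c$ is the critical value of the model: for all $\beta>\beta^c$ the set of random fields consistent with the specification contains the two distinct extremal measures $\mu_\beta^-$ and $\mu_\beta^+$ (phase transition). For $F\subset\mathbb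 Z^2$, $\partial F=\{j\in F:\exists k\in\mathbb Z^2\setminus F,\ \|j-k\|_1=1\}$ and $\mathring F=F\setminus\partial F$. A self-avoiding path is a finite sequence $(i_1,\dots,i_n)$ of sites such that $i_j,i_k$ are $L^1$-neighbors if and only if $|j-k|=1$. $F$ is $L^1$-connected if any two distinct points of $F$ are the first and last points of a self-avoiding path of sites in $F$. Context supports: for $i\in\mathbb Z^2$ and $x\in S$, $$C_i(x)=\Big(\bigcap\{F\subset\mathbb Z^2: i\in\mathring F,\ F\ L^1\text{-connected},\ x_{\partial F}\equiv+1\}\Big)\setminus\{i\}$$ if at least one finite set $F$ satisfies these conditions, and $C_i(x)=\mathbb Z^2\setminus\{i\}$ otherwise. $|C_i(X)|$ denotes cardinality. *)

theory Defs
  imports "HOL-Probability.Probability"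
begin

type_synonym site = "int \<times> int"
type_synonym config = "site \<Rightarrow> int"

definition spins :: "int set" where
  "spins = {-1, 1}"

definition config_space :: "config measure" where
  "config_space = (\<Pi>\<^sub>M i\<in>UNIV. count_space spins)"

definition neighbors :: "site \<Rightarrow> site \<Rightarrow> bool" where
  "neighbors i j \<longleftrightarrow> \<bar>fst i - fst j\<bar> + \<bar>snd i - snd j\<bar> = 1"

definition bernoulli_field :: "real \<Rightarrow> config measure" where
  "bernoulli_field \<epsilon> =
     (\<Pi>\<^sub>M i\<in>UNIV. point_measure spins (\<lambda>a. ennreal (if a = -1 then \<epsilon> else 1 - \<epsilon>)))"

definition boltzmann_weight :: "real \<Rightarrow> site set \<Rightarrow> config \<Rightarrow> config \<Rightarrow> real" where
  "boltzmann_weight \<beta> \<Lambda> y x =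
     exp (\<beta> * (1 / 2 * (\<Sum>i\<in>\<Lambda>. \<Sum>j\<in>{j \<in> \<Lambda>. neighbors i j}. real_of_int (x i * x j))
              + (\<Sum>i\<in>\<Lambda>. \<Sum>j\<in>{j \<in> - \<Lambda>. neighbors i j}. real_of_int (x i * y j))))"

definition ising_spec :: "real \<Rightarrow> site set \<Rightarrow> config \<Rightarrow> config \<Rightarrow> real" where
  "ising_spec \<beta> \<Lambda> y x =
     boltzmann_weight \<beta> \<Lambda> y x / (\<Sum>z \<in> \<Lambda> \<rightarrow>\<^sub>E spins. boltzmann_weight \<beta> \<Lambda> y z)"

text \<open>The finite-volume measure lives on the full configuration space: the configuration
  is frozen to be \<^term>\<open>y\<close> outside \<^term>\<open>\<Lambda>\<close>.\<close>

definition ising_kernel :: "real \<Rightarrow> site set \<Rightarrow> config \<Rightarrow> config measure" where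
  "ising_kernel \<beta> \<Lambda> y =
     distr (point_measure (\<Lambda> \<rightarrow>\<^sub>E spins) (\<lambda>x. ennreal (ising_spec \<beta> \<Lambda> y x)))
       config_space (\<lambda>x. override_on y x \<Lambda>)"

text \<open>\<^term>\<open>\<mu>\<close> is the limit, as \<^term>\<open>\<Lambda>\<close> increases to the whole lattice along the net of all
  finite sets, of the finite-volume measures with constant external configuration \<^term>\<open>s\<close>.
  Since single spins take finitely many values, convergence of the probabilities of all
  cylinder events is weak convergence for the product topology; it determines \<^term>\<open>\<mu>\<close>.\<close>

definition ising_limit :: "real \<Rightarrow> int \<Rightarrow> config measure \<Rightarrow> bool" where
  "ising_limit \<beta> s \<mu> \<longleftrightarrow>
     prob_space \<mu> \<and> sets \<mu> = sets config_space \<and>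
     (\<forall>F a. finite F \<longrightarrow>
        ((\<lambda>\<Lambda>. measure (ising_kernel \<beta> \<Lambda> (\<lambda>_. s)) {x \<in> space config_space. \<forall>i\<in>F. x i = a i})
          \<longlongrightarrow> measure \<mu> {x \<in> space config_space. \<forall>i\<in>F. x i = a i})
        (finite_subsets_at_top UNIV))"

abbreviation plus_phase :: "real \<Rightarrow> config measure \<Rightarrow> bool" where
  "plus_phase \<beta> \<equiv> ising_limit \<beta> 1"

abbreviation minus_phase :: "real \<Rightarrow> config measure \<Rightarrow> bool" where
  "minus_phase \<beta> \<equiv> ising_limit \<beta> (-1)"

text \<open>Consistency with the specification is expressed by the DLR equations.\<close>

definition gibbs_measures :: "real \<Rightarrow> config measure set" where
  "gibbs_measures \<beta> =
     {\<mu>. prob_space \<mu> \<and> sets \<mu> = sets config_space \<and>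
         (\<forall>\<Lambda> E. finite \<Lambda> \<longrightarrow> E \<in> sets config_space \<longrightarrow>
            emeasure \<mu> E = (\<integral>\<^sup>+ y. emeasure (ising_kernel \<beta> \<Lambda> y) E \<partial>\<mu>))}"

definition extremal_gibbs :: "real \<Rightarrow> config measure \<Rightarrow> bool" where
  "extremal_gibbs \<beta> \<mu> \<longleftrightarrow>
     \<mu> \<in> gibbs_measures \<beta> \<and>
     (\<forall>\<mu>\<^sub>1 \<in> gibbs_measures \<beta>. \<forall>\<mu>\<^sub>2 \<in> gibbs_measures \<beta>. \<forall>t::real. 0 < t \<longrightarrow> t < 1 \<longrightarrow>
        (\<forall>E \<in> sets config_space. measure \<mu> E = t * measure \<mu>\<^sub>1 E + (1 - t) * measure \<mu>\<^sub>2 E) \<longrightarrow>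
        \<mu>\<^sub>1 = \<mu> \<and> \<mu>\<^sub>2 = \<mu>)"

definition phase_transition :: "real \<Rightarrow> bool" where
  "phase_transition \<beta> \<longleftrightarrow>
     (\<exists>\<mu>m \<mu>p. minus_phase \<beta> \<mu>m \<and> plus_phase \<beta> \<mu>p \<and> \<mu>m \<noteq> \<mu>p \<and>
        extremal_gibbs \<beta> \<mu>m \<and> extremal_gibbs \<beta> \<mu>p)"

text \<open>The least threshold above which the plus and minus phases exist as distinct extremal Gibbs
  measures. It is extended-real valued, so the infimum presupposes no finiteness.\<close>

definition critical_beta :: ereal where
  "critical_beta = Inf {b. 0 \<le> b \<and> (\<forall>\<beta>::real. b < ereal \<beta> \<longrightarrow> phase_transition \<beta>)}"

definition noisy_field :: "config measure \<Rightarrow> real \<Rightarrow> config measure" where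
  "noisy_field \<mu> \<epsilon> =
     distr (\<mu> \<Otimes>\<^sub>M bernoulli_field \<epsilon>) config_space (\<lambda>(x1, x2) i. min (x1 i) (x2 i))"

definition inner_boundary :: "site set \<Rightarrow> site set" where
  "inner_boundary F = {j \<in> F. \<exists>k. k \<notin> F \<and> neighbors j k}"

definition lattice_interior :: "site set \<Rightarrow> site set" where
  "lattice_interior F = F - inner_boundary F"

definition self_avoiding_path :: "site list \<Rightarrow> bool" where
  "self_avoiding_path p \<longleftrightarrow> p \<noteq> [] \<and>
     (\<forall>j < length p. \<forall>k < length p. neighbors (p ! j) (p ! k) \<longleftrightarrow> \<bar>int j - int k\<bar> = 1)"

definition lattice_connected :: "site set \<Rightarrow> bool" where
  "lattice_connected F \<longleftrightarrow>
     (\<forall>i\<in>F. \<forall>j\<in>F. i \<noteq> j \<longrightarrow>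
        (\<exists>p. self_avoiding_path p \<and> set p \<subseteq> F \<and> hd p = i \<and> last p = j))"

definition enclosing_sets :: "site \<Rightarrow> config \<Rightarrow> site set set" where
  "enclosing_sets i x =
     {F. i \<in> lattice_interior F \<and> lattice_connected F \<and> (\<forall>j \<in> inner_boundary F. x j = 1)}"

definition context_support :: "site \<Rightarrow> config \<Rightarrow> site set" where
  "context_support i x =
     (if \<exists>F \<in> enclosing_sets i x. finite F then \<Inter> (enclosing_sets i x) - {i} else UNIV - {i})"

end

theory Submission
  imports Defs
begin

text \<open>
  A context support is finite iff its site is enclosed: it lies in a finite set all of whose outer
  neighbours carry plus spins.

  Minus phase. The event that every site is enclosed is a tail event, so by extremality it has
  probability 0 or 1. If it had probability 1, one could condition on the largest subset of a big box
  that is surrounded by plus spins; inside, the DLR equations give plus boundary conditions, so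
  monotonicity in the boundary condition makes \<open>\<mu>\<^sup>-\<close> dominate \<open>\<mu>\<^sup>+\<close>. As the reverse domination always
  holds, the phases would coincide. Passing from \<open>X\<^sup>1\<close> to the minimum only removes plus spins.

  Plus phase. An infinite cluster of minus spins of \<open>X\<close> contains paths of any length that visit
  distinct sites with \<open>X\<^sup>2 = -1\<close> and cross distinct islands of minus spins of \<open>X\<^sup>1\<close>. A non-backtracking
  step costs \<open>3\<epsilon>\<close>; crossing an island is a jump across a Peierls contour, of total cost
  \<open>O(e\<^sup>-\<^sup>4\<^sup>\<beta>)\<close>, which is absorbed by the margin \<open>3e\<^sup>-\<^sup>2\<^sup>\<beta>\<close> for large \<open>\<beta>\<close>. So the union bound over paths
  with \<open>k\<close> rounds decays geometrically.
\<close>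

section \<open>Enclosed sites and lattice clusters\<close>

text \<open>The minimum of Ising spins and noise is neither Gibbs nor independent, so its minus
  paths admit no direct product bound. Each path is charged to two separate resources: noise sites,
  which must be pairwise distinct so that independence gives powers of \<epsilon>, and contours of
  the Ising spins, whose cuts must be edge-disjoint for Peierls flips to be iterated. Shortest paths
  in a graph where crossing a whole island is a single step supply both properties. Jumps are of
  second order in exp(-2\<beta>) because every cut has at least two edges. In the minus phase, the
  phases are given only as limits of cylinder probabilities. All comparisons are made on the events
  \<open>plus_on B\<close>: they are increasing and local and form a generating pi-system, so
  inequalities on them in both directions already identify the measures. Besides monotonicity in the
  boundary condition, the argument needs finite-volume plus measures to dominate their limit, which
  is positive association. Both come from the four functions theorem.\<close>

declare split_paired_All [simp del] split_paired_Ex [simp del]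

lemma neighbors_sym: "neighbors i j \<longleftrightarrow> neighbors j i"
  by (auto simp: neighbors_def)

lemma neighbors_irrefl [simp]: "\<not> neighbors i i"
  by (auto simp: neighbors_def)

lemma neighbors_eq:
  "{j. neighbors i j} =
     {(fst i + 1, snd i), (fst i - 1, snd i), (fst i, snd i + 1), (fst i, snd i - 1)}"
  by (auto simp: neighbors_def prod_eq_iff; presburger)

lemma finite_neighbors [simp]: "finite {j. neighbors i j}"
  by (simp add: neighbors_eq)

lemma card_neighbors: "card {j. neighbors i j} = 4"
  by (simp add: neighbors_eq)

text \<open>A repeated vertex or a chord leading ahead by more than one step could be used to
  shorten the path. Absence of forward chords yields self-avoiding paths for connectedness and,
  later, paths that cross every island at most once.\<close>

lemma shortest_path:
  assumes "(s, t) \<in> R\<^sup>*"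
  obtains n f where "f 0 = s" "f n = t" "\<And>i. i < n \<Longrightarrow> (f i, f (Suc i)) \<in> R"
    "\<And>i j. i \<le> n \<Longrightarrow> j \<le> n \<Longrightarrow> (f i, f j) \<in> R \<Longrightarrow> j \<le> Suc i"
    "inj_on f {..n}" "\<And>m. (s, t) \<in> R ^^ m \<Longrightarrow> n \<le> m"
proof -
  define n where "n = (LEAST m. (s, t) \<in> R ^^ m)"
  have ex: "\<exists>m. (s, t) \<in> R ^^ m" using assms by (simp add: rtrancl_power)
  have n: "(s, t) \<in> R ^^ n" unfolding n_def using ex by (rule LeastI_ex)
  have least: "n \<le> m" if "(s, t) \<in> R ^^ m" for m
    unfolding n_def using that by (rule Least_le)
  obtain f where f: "f 0 = s" "f n = t" "\<And>i. i < n \<Longrightarrow> (f i, f (Suc i)) \<in> R"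
    using n by (auto simp: relpow_fun_conv)
  have seg: "(f i, f (i + k)) \<in> R ^^ k" if "i + k \<le> n" for i k
    using that
  proof (induction k)
    case (Suc k)
    then show ?case using f(3)[of "i + k"] by auto
  qed simp
  have pre: "(s, f i) \<in> R ^^ i" if "i \<le> n" for i using seg[of 0 i] that f(1) by simp
  have post: "(f i, t) \<in> R ^^ (n - i)" if "i \<le> n" for i using seg[of i "n - i"] that f(2) by simp
  show thesis
  proof (rule that[of f n, OF f(1,2)])
    show "(f i, f (Suc i)) \<in> R" if "i < n" for i using f(3) that .
  next
    fix i j assume ij: "i \<le> n" "j \<le> n" "(f i, f j) \<in> R"
    have "(s, t) \<in> R ^^ (Suc i + (n - j))"
      unfolding relpow_add using relcompI[OF relpow_Suc_I[OF pre[OF ij(1)] ij(3)] post[OF ij(2)]]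
      by simp
    from least[OF this] show "j \<le> Suc i" using ij by simp
  next
    have False if ij: "i < j" "j \<le> n" "f i = f j" for i j
    proof -
      have "(s, t) \<in> R ^^ (i + (n - j))"
        unfolding relpow_add using pre[of i] post[of j] ij by auto
      from least[OF this] show False using ij by simp
    qed
    then show "inj_on f {..n}"
      by (intro inj_onI) (metis atMost_iff linorder_neqE_nat)
  next
    show "n \<le> m" if "(s, t) \<in> R ^^ m" for m using least that .
  qed
qed

text \<open>Note that \<^term>\<open>outer_boundary\<close> lies outside of the set, whereas the boundary in the
  definition of the context supports lies inside.\<close>

definition outer_boundary :: "site set \<Rightarrow> site set" where
  "outer_boundary L = {j. j \<notin> L \<and> (\<exists>i\<in>L. neighbors i j)}"

text \<open>Formulated through outer boundaries and without connectedness, so that enclosing sets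
  are closed under union; the hull and the enlargements of enclosing sets below rest on
  this.\<close>

definition enclosed :: "site \<Rightarrow> config \<Rightarrow> bool" where
  "enclosed i x \<longleftrightarrow> (\<exists>L. finite L \<and> i \<in> L \<and> (\<forall>j\<in>outer_boundary L. x j = 1))"

lemma finite_outer_boundary [simp]: "finite L \<Longrightarrow> finite (outer_boundary L)"
  by (rule finite_subset[of _ "\<Union>i\<in>L. {j. neighbors i j}"]) (auto simp: outer_boundary_def)

lemma outer_boundary_Union: "outer_boundary (\<Union>\<L>) \<subseteq> (\<Union>L\<in>\<L>. outer_boundary L)"
  by (auto simp: outer_boundary_def)

lemma enclosedE_finite:
  assumes "\<And>i. i \<in> B \<Longrightarrow> enclosed i x" "finite B"
  obtains L where "finite L" "B \<subseteq> L" "\<And>j. j \<in> outer_boundary L \<Longrightarrow> x j = 1"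
proof -
  obtain f where f: "\<And>i. i \<in> B \<Longrightarrow> finite (f i) \<and> i \<in> f i \<and> (\<forall>j\<in>outer_boundary (f i). x j = 1)"
    using assms(1) unfolding enclosed_def by metis
  show thesis
  proof (rule that[of "\<Union>(f ` B)"])
    show "x j = 1" if "j \<in> outer_boundary (\<Union>(f ` B))" for j
      using that outer_boundary_Union[of "f ` B"] f by auto
  qed (use f assms(2) in auto)
qed

definition adjacency :: "site set \<Rightarrow> (site \<times> site) set" where
  "adjacency A = {(a, b). a \<in> A \<and> b \<in> A \<and> neighbors a b}"

lemma sym_adjacency: "sym (adjacency A)"
  by (auto simp: adjacency_def sym_def neighbors_sym)

text \<open>For \<open>i\<close> outside \<open>A\<close> this is the singleton of \<open>i\<close>,
  which is why containment in \<open>A\<close> asks for \<open>i \<in> A\<close>.\<close>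

definition cluster :: "site set \<Rightarrow> site \<Rightarrow> site set" where
  "cluster A i = {j. (i, j) \<in> (adjacency A)\<^sup>*}"

lemma cluster_self [simp]: "i \<in> cluster A i"
  by (simp add: cluster_def)

lemma cluster_subset: "i \<in> A \<Longrightarrow> cluster A i \<subseteq> A"
proof
  fix j assume "i \<in> A" "j \<in> cluster A i"
  then have "(i, j) \<in> (adjacency A)\<^sup>*" by (simp add: cluster_def)
  then show "j \<in> A" by (induction rule: rtrancl_induct) (use \<open>i \<in> A\<close> in \<open>auto simp: adjacency_def\<close>)
qed

lemma cluster_step: "j \<in> cluster A i \<Longrightarrow> i \<in> A \<Longrightarrow> neighbors j k \<Longrightarrow> k \<in> A \<Longrightarrow> k \<in> cluster A i"
  using subsetD[OF cluster_subset, of i A j] rtrancl_into_rtrancl[of i j "adjacency A" k]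
  unfolding cluster_def by (auto simp: adjacency_def)

lemma cluster_sym: "j \<in> cluster A i \<Longrightarrow> i \<in> cluster A j"
  unfolding cluster_def using sym_rtrancl[OF sym_adjacency] by (auto dest: symD)

lemma cluster_trans: "j \<in> cluster A i \<Longrightarrow> k \<in> cluster A j \<Longrightarrow> k \<in> cluster A i"
  unfolding cluster_def by auto

lemma cluster_eq: "j \<in> cluster A i \<Longrightarrow> cluster A j = cluster A i"
  by (meson cluster_sym cluster_trans subsetI subset_antisym)

lemma cluster_connected:
  assumes "j \<in> cluster A i" "k \<in> cluster A i"
  shows "(j, k) \<in> (adjacency (cluster A i))\<^sup>*"
proof -
  have *: "(i, k) \<in> (adjacency (cluster A i))\<^sup>*" if "(i, k) \<in> (adjacency A)\<^sup>*" for k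
    using that
  proof (induction rule: rtrancl_induct)
    case (step y z)
    have "y \<in> cluster A i" "z \<in> cluster A i"
      using step by (auto simp: cluster_def)
    then have "(y, z) \<in> adjacency (cluster A i)" using step(2) by (auto simp: adjacency_def)
    then show ?case using step.IH by simp
  qed simp
  have "(j, i) \<in> (adjacency (cluster A i))\<^sup>*"
    using *[of j] assms(1) sym_rtrancl[OF sym_adjacency] by (auto simp: cluster_def dest: symD)
  then show ?thesis using *[of k] assms(2) by (auto simp: cluster_def)
qed

text \<open>A shortest path has no forward chord. Symmetry of \<open>neighbors\<close> excludes
  backward chords as well, and this is the equivalence demanded of a self-avoiding path.\<close>

lemma lattice_connectedI:
  assumes "\<And>i j. i \<in> F \<Longrightarrow> j \<in> F \<Longrightarrow> (i, j) \<in> (adjacency F)\<^sup>*"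
  shows "lattice_connected F"
  unfolding lattice_connected_def
proof (intro ballI impI)
  fix i j assume ij: "i \<in> F" "j \<in> F" "i \<noteq> j"
  obtain n f where f: "f 0 = i" "f n = j" "\<And>k. k < n \<Longrightarrow> (f k, f (Suc k)) \<in> adjacency F"
    "\<And>k l. k \<le> n \<Longrightarrow> l \<le> n \<Longrightarrow> (f k, f l) \<in> adjacency F \<Longrightarrow> l \<le> Suc k"
    using shortest_path[OF assms[OF ij(1,2)]] by metis
  have F: "f k \<in> F" if "k \<le> n" for k
    using that f(1) f(3)[of "k - 1"] ij(1) by (cases k) (auto simp: adjacency_def)
  have nb: "neighbors (f k) (f l) \<longleftrightarrow> \<bar>int k - int l\<bar> = 1" if "k \<le> n" "l \<le> n" for k l
  proof
    assume "neighbors (f k) (f l)"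
    then have "(f k, f l) \<in> adjacency F" "(f l, f k) \<in> adjacency F" "k \<noteq> l"
      using F that by (auto simp: adjacency_def neighbors_sym)
    then show "\<bar>int k - int l\<bar> = 1" using f(4)[of k l] f(4)[of l k] that by auto
  next
    assume "\<bar>int k - int l\<bar> = 1"
    then have "l = Suc k \<or> k = Suc l" by linarith
    then show "neighbors (f k) (f l)"
      using f(3)[of k] f(3)[of l] that by (auto simp: adjacency_def neighbors_sym)
  qed
  let ?p = "map f [0..<Suc n]"
  show "\<exists>p. self_avoiding_path p \<and> set p \<subseteq> F \<and> hd p = i \<and> last p = j"
  proof (intro exI[of _ ?p] conjI)
    show "self_avoiding_path ?p"
      unfolding self_avoiding_path_def using nb by (auto simp del: upt_Suc)
    show "hd ?p = i" using f(1) by (simp add: hd_map del: upt_Suc)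
    show "last ?p = j" using f(2) by simp
    show "set ?p \<subseteq> F" using F by auto
  qed
qed

text \<open>From \<open>F\<close> one passes to its interior, whose outer boundary consists of inner
  boundary points of \<open>F\<close>. Conversely, the cluster \<open>K\<close> of \<open>i\<close>
  in the enclosing set has a plus outer boundary, and adding that boundary gives a connected
  \<open>F\<close> with \<open>i\<close> in its interior.\<close>

lemma exists_enclosing_iff: "(\<exists>F\<in>enclosing_sets i x. finite F) \<longleftrightarrow> enclosed i x"
proof
  assume "\<exists>F\<in>enclosing_sets i x. finite F"
  then obtain F where F: "finite F" "i \<in> lattice_interior F" "\<forall>j\<in>inner_boundary F. x j = 1"
    by (auto simp: enclosing_sets_def)
  have "outer_boundary (lattice_interior F) \<subseteq> inner_boundary F"
    unfolding outer_boundary_def lattice_interior_def inner_boundary_def by blast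
  then show "enclosed i x"
    unfolding enclosed_def using F
    by (intro exI[of _ "lattice_interior F"]) (simp add: lattice_interior_def subset_iff)
next
  assume "enclosed i x"
  then obtain L where L: "finite L" "i \<in> L" "\<forall>j\<in>outer_boundary L. x j = 1"
    by (auto simp: enclosed_def)
  define K where "K = cluster L i"
  define F where "F = K \<union> outer_boundary K"
  have KL: "K \<subseteq> L" using cluster_subset L(2) by (simp add: K_def)
  then have finK: "finite K" using L(1) finite_subset by blast
  have K1: "x j = 1" if "j \<in> outer_boundary K" for j
  proof -
    have "j \<in> outer_boundary L"
    proof -
      obtain b where b: "j \<notin> K" "b \<in> K" "neighbors b j"
        using \<open>j \<in> outer_boundary K\<close> by (auto simp: outer_boundary_def)
      then have "j \<notin> L" using cluster_step[of b L i j] L(2) K_def by blast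
      then show ?thesis using b KL by (auto simp: outer_boundary_def)
    qed
    then show ?thesis using L(3) by blast
  qed
  have conn: "(a, b) \<in> (adjacency F)\<^sup>*" if "a \<in> K" "b \<in> K" for a b
  proof -
    have "adjacency K \<subseteq> adjacency F" by (auto simp: adjacency_def F_def)
    then show ?thesis
      using cluster_connected[of a L i b] that subsetD[OF rtrancl_mono[of "adjacency K" "adjacency F"]]
      unfolding K_def by blast
  qed
  have to_K: "\<exists>b\<in>K. (a, b) \<in> (adjacency F)\<^sup>*" if aF: "a \<in> F" for a
  proof (cases "a \<in> K")
    case False
    then obtain b where "b \<in> K" "neighbors b a"
      using aF unfolding F_def outer_boundary_def by blast
    then have "(a, b) \<in> adjacency F" using that by (auto simp: adjacency_def F_def neighbors_sym)
    then show ?thesis using \<open>b \<in> K\<close> by blast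
  qed blast
  have "lattice_connected F"
  proof (rule lattice_connectedI)
    fix a b assume "a \<in> F" "b \<in> F"
    obtain a' b' where ab: "a' \<in> K" "b' \<in> K" "(a, a') \<in> (adjacency F)\<^sup>*" "(b, b') \<in> (adjacency F)\<^sup>*"
      using to_K[OF \<open>a \<in> F\<close>] to_K[OF \<open>b \<in> F\<close>] by blast
    from ab(4) have "(b', b) \<in> (adjacency F)\<^sup>*"
      using symD[OF sym_rtrancl[OF sym_adjacency]] by blast
    then show "(a, b) \<in> (adjacency F)\<^sup>*" using rtrancl_trans[OF ab(3) rtrancl_trans[OF conn[OF ab(1,2)]]] by blast
  qed
  moreover have "inner_boundary F \<subseteq> outer_boundary K"
    unfolding inner_boundary_def F_def outer_boundary_def by blast
  moreover have "i \<in> lattice_interior F"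
    using cluster_self[of i L]
    unfolding lattice_interior_def inner_boundary_def F_def outer_boundary_def K_def by blast
  ultimately have "F \<in> enclosing_sets i x"
    using K1 unfolding enclosing_sets_def by blast
  then show "\<exists>F\<in>enclosing_sets i x. finite F"
    using finK by (intro bexI[of _ F]) (simp_all add: F_def)
qed

lemma infinite_sites: "infinite (UNIV - {i :: site})"
  by (simp add: finite_prod)

text \<open>When \<open>i\<close> is enclosed, a single finite enclosing set bounds the
  intersection; otherwise the definition returns its default, the punctured lattice, which is
  infinite.\<close>

lemma finite_context_support_iff: "finite (context_support i x) \<longleftrightarrow> enclosed i x"
proof (cases "enclosed i x")
  case True
  then obtain F where F: "F \<in> enclosing_sets i x" "finite F" using exists_enclosing_iff by blast
  then have "\<Inter> (enclosing_sets i x) - {i} \<subseteq> F" by blast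
  then have "finite (\<Inter> (enclosing_sets i x) - {i})" using F(2) finite_subset by blast
  then show ?thesis
    using True exists_enclosing_iff[of i x] by (simp add: context_support_def)
next
  case False
  then show ?thesis
    using infinite_sites[of i] by (simp add: context_support_def exists_enclosing_iff)
qed

section \<open>Local events and their measurability\<close>

lemma space_config_space: "space config_space = {x. \<forall>i. x i = -1 \<or> x i = 1}"
  by (simp add: config_space_def space_PiM spins_def PiE_def Pi_def)

lemma spin_cases: "x \<in> space config_space \<Longrightarrow> x i = -1 \<or> x i = 1"
  by (auto simp: space_config_space)

lemma measurable_spin [measurable]: "(\<lambda>x. x i) \<in> measurable config_space (count_space spins)"
  unfolding config_space_def by measurable

lemma sets_spin_event: "{x \<in> space config_space. x i = a} \<in> sets config_space"
proof -
  have "{x \<in> space config_space. x i = a} = (\<lambda>x. x i) -` ({a} \<inter> spins) \<inter> space config_space"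
    by (auto simp: space_config_space spins_def)
  then show ?thesis using measurable_sets[OF measurable_spin[of i], of "{a} \<inter> spins"] by simp
qed

lemma sets_cylinder:
  assumes "finite F" shows "{x \<in> space config_space. \<forall>i\<in>F. x i = a i} \<in> sets config_space"
  using assms by (intro sets.sets_Collect_finite_All sets_spin_event)

definition local_on :: "site set \<Rightarrow> (config \<Rightarrow> 'b) \<Rightarrow> bool" where
  "local_on F Q \<longleftrightarrow> (\<forall>x\<in>space config_space. \<forall>y\<in>space config_space.
     (\<forall>i\<in>F. x i = y i) \<longrightarrow> Q x = Q y)"

text \<open>Coding spins by the set of plus sites turns sums over configurations into sums over a
  power set, where pointwise minimum and maximum become intersection and union.\<close>

definition pattern :: "site set \<Rightarrow> config" where
  "pattern A i = (if i \<in> A then 1 else -1)"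

lemma pattern_space [simp]: "pattern A \<in> space config_space"
  by (auto simp: space_config_space pattern_def)

text \<open>Together with \<open>disjoint_patterns\<close> this reduces a local event to finitely
  many disjoint cylinders, the only events for which convergence to a phase is given.\<close>

lemma local_event_decompose:
  assumes "local_on F Q"
  shows "{x \<in> space config_space. Q x} =
    (\<Union>A\<in>{A\<in>Pow F. Q (pattern A)}. {x \<in> space config_space. \<forall>i\<in>F. x i = pattern A i})"
proof -
  have *: "\<exists>A\<in>Pow F. \<forall>i\<in>F. x i = pattern A i" if "x \<in> space config_space" for x
    using spin_cases[OF that] by (intro bexI[of _ "{i\<in>F. x i = 1}"]) (auto simp: pattern_def)
  have **: "Q x = Q (pattern A)" if "x \<in> space config_space" "\<forall>i\<in>F. x i = pattern A i" for x A
    using assms[unfolded local_on_def, rule_format, OF that(1) pattern_space[of A]] that(2) by blast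
  show ?thesis
    using * ** by (intro equalityI subsetI) (simp, blast)+
qed

lemma disjoint_patterns:
  "disjoint_family_on (\<lambda>A. {x \<in> space config_space. \<forall>i\<in>F. x i = pattern A i}) {A\<in>Pow F. Q A}"
proof -
  have "A = B" if "A \<subseteq> F" "B \<subseteq> F" "\<forall>i\<in>F. x i = pattern A i" "\<forall>i\<in>F. x i = pattern B i" for A B and x :: config
  proof -
    have "i \<in> A \<longleftrightarrow> i \<in> B" if "i \<in> F" for i
    proof -
      have "pattern A i = pattern B i" using \<open>\<forall>i\<in>F. x i = pattern A i\<close> \<open>\<forall>i\<in>F. x i = pattern B i\<close> that by metis
      then show ?thesis by (auto simp: pattern_def split: if_splits)
    qed
    then show ?thesis using that by blast
  qed
  then show ?thesis unfolding disjoint_family_on_def by blast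
qed

lemma sets_local:
  assumes "finite F" "local_on F Q" shows "{x \<in> space config_space. Q x} \<in> sets config_space"
  unfolding local_event_decompose[OF assms(2)]
  using assms(1) by (intro sets.finite_UN) (auto intro: sets_cylinder)

lemma local_on_comp: "local_on F f \<Longrightarrow> local_on F (\<lambda>x. g (f x))"
  unfolding local_on_def by metis

lemma measurable_local:
  fixes f :: "config \<Rightarrow> 'b :: topological_space"
  assumes "finite F" "local_on F f" shows "f \<in> borel_measurable config_space"
proof (rule measurableI)
  fix A assume "A \<in> sets (borel :: 'b measure)"
  have "f -` A \<inter> space config_space = {x \<in> space config_space. f x \<in> A}" by auto
  also have "\<dots> \<in> sets config_space"
    by (rule sets_local[OF assms(1) local_on_comp[OF assms(2)]])
  finally show "f -` A \<inter> space config_space \<in> sets config_space" .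
qed simp

text \<open>There are only countably many finite candidates \<open>L\<close>, and each contributes a
  cylinder event.\<close>

lemma sets_enclosed: "{x \<in> space config_space. enclosed i x} \<in> sets config_space"
proof -
  have "{x \<in> space config_space. enclosed i x} =
    (\<Union>L\<in>{L. finite L \<and> i \<in> L}. {x \<in> space config_space. \<forall>j\<in>outer_boundary L. x j = 1})"
    by (auto simp: enclosed_def)
  also have "\<dots> \<in> sets config_space"
    by (intro sets.countable_UN' countable_subset[OF _ countable_Collect_finite])
       (auto intro!: sets_cylinder)
  finally show ?thesis .
qed

section \<open>Finite-volume Gibbs kernels\<close>

definition conf :: "site set \<Rightarrow> config \<Rightarrow> site set \<Rightarrow> config" where
  "conf \<Lambda> y A i = (if i \<in> \<Lambda> then pattern A i else y i)"

definition incident :: "site set \<Rightarrow> (site \<times> site) set" where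
  "incident \<Lambda> = {(i, j). neighbors i j \<and> (i \<in> \<Lambda> \<or> j \<in> \<Lambda>)}"

text \<open>Summing over ordered pairs counts each bond twice, hence the factor 1/2.\<close>

definition energy :: "site set \<Rightarrow> config \<Rightarrow> real" where
  "energy \<Lambda> z = (\<Sum>(i, j)\<in>incident \<Lambda>. real_of_int (z i * z j)) / 2"

definition weight :: "real \<Rightarrow> site set \<Rightarrow> config \<Rightarrow> real" where
  "weight \<beta> \<Lambda> z = exp (\<beta> * energy \<Lambda> z)"

text \<open>A finite sum that makes sense for every set \<open>S\<close>, so that combinatorial
  inequalities can be proved on it directly; \<open>emeasure_ising_kernel\<close> ties it to the
  kernel.\<close>

definition kernel_prob :: "real \<Rightarrow> site set \<Rightarrow> config \<Rightarrow> config set \<Rightarrow> real" where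
  "kernel_prob \<beta> \<Lambda> y S =
     (\<Sum>A\<in>Pow \<Lambda>. weight \<beta> \<Lambda> (conf \<Lambda> y A) * indicator S (conf \<Lambda> y A)) /
     (\<Sum>A\<in>Pow \<Lambda>. weight \<beta> \<Lambda> (conf \<Lambda> y A))"

lemma conf_space [simp]: "y \<in> space config_space \<Longrightarrow> conf \<Lambda> y A \<in> space config_space"
  by (simp add: space_config_space conf_def pattern_def)

lemma weight_pos [simp]: "weight \<beta> \<Lambda> z > 0"
  by (simp add: weight_def)

lemma weight_nonneg [simp]: "weight \<beta> \<Lambda> z \<ge> 0"
  by (simp add: weight_def)

lemma finite_incident [simp]: "finite \<Lambda> \<Longrightarrow> finite (incident \<Lambda>)"
  by (rule finite_subset[of _ "(\<Union>i\<in>\<Lambda>. {i} \<times> {j. neighbors i j}) \<union> (\<Union>j\<in>\<Lambda>. {i. neighbors j i} \<times> {j})"])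
     (auto simp: incident_def neighbors_sym)

text \<open>Bonds inside \<Lambda> are already summed in both orders with the factor 1/2, while
  bonds across the boundary occur once with full weight. Adding the reversals of the latter and
  halving puts both kinds on the same footing.\<close>

lemma boltzmann_weight_eq:
  assumes "finite \<Lambda>" "\<And>i. i \<in> \<Lambda> \<Longrightarrow> x i = z i" "\<And>i. i \<notin> \<Lambda> \<Longrightarrow> y i = z i"
  shows "boltzmann_weight \<beta> \<Lambda> y x = weight \<beta> \<Lambda> z"
proof -
  define f where "f = (\<lambda>(i, j). real_of_int (z i * z j))"
  define I1 where "I1 = (SIGMA i:\<Lambda>. {j \<in> \<Lambda>. neighbors i j})"
  define I2 where "I2 = (SIGMA i:\<Lambda>. {j \<in> - \<Lambda>. neighbors i j})"
  have fin: "finite {j \<in> - \<Lambda>. neighbors i j}" for i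
    by (rule finite_subset[OF _ finite_neighbors[of i]]) auto
  have finI: "finite I1" "finite I2" using assms(1) fin by (auto simp: I1_def I2_def)
  have s1: "(\<Sum>i\<in>\<Lambda>. \<Sum>j\<in>{j \<in> \<Lambda>. neighbors i j}. real_of_int (x i * x j)) = sum f I1"
    unfolding I1_def f_def using assms by (subst sum.Sigma[symmetric]) (auto intro!: sum.cong)
  have s2: "(\<Sum>i\<in>\<Lambda>. \<Sum>j\<in>{j \<in> - \<Lambda>. neighbors i j}. real_of_int (x i * y j)) = sum f I2"
    unfolding I2_def f_def using assms fin by (subst sum.Sigma[symmetric]) (auto intro!: sum.cong)
  have "incident \<Lambda> = (I1 \<union> I2) \<union> prod.swap ` I2"
    by (auto simp: incident_def I1_def I2_def neighbors_sym image_iff)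
  moreover have "(I1 \<union> I2) \<inter> prod.swap ` I2 = {}" "I1 \<inter> I2 = {}"
    by (auto simp: I1_def I2_def)
  ultimately have "sum f (incident \<Lambda>) = sum f I1 + sum f I2 + sum f (prod.swap ` I2)"
    using finI by (simp add: sum.union_disjoint)
  also have "sum f (prod.swap ` I2) = sum f I2"
    by (subst sum.reindex) (auto simp: f_def mult.commute intro!: sum.cong)
  finally have "energy \<Lambda> z = 1 / 2 * sum f I1 + sum f I2"
    by (simp add: energy_def f_def)
  then show ?thesis
    unfolding boltzmann_weight_def weight_def s1 s2 by simp
qed

lemma override_on_restrict_pattern: "override_on y (restrict (pattern A) \<Lambda>) \<Lambda> = conf \<Lambda> y A"
  by (auto simp: override_on_def conf_def)

lemma bij_betw_pattern: "bij_betw (\<lambda>A. restrict (pattern A) \<Lambda>) (Pow \<Lambda>) (\<Lambda> \<rightarrow>\<^sub>E spins)"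
proof (rule bij_betwI[where g = "\<lambda>x. {i\<in>\<Lambda>. x i = 1}"])
  show "restrict (pattern {i \<in> \<Lambda>. x i = 1}) \<Lambda> = x" if "x \<in> \<Lambda> \<rightarrow>\<^sub>E spins" for x
  proof
    fix i show "restrict (pattern {i \<in> \<Lambda>. x i = 1}) \<Lambda> i = x i"
      using PiE_mem[OF that, of i] PiE_arb[OF that, of i] by (auto simp: pattern_def spins_def)
  qed
qed (auto simp: pattern_def spins_def)

lemma emeasure_ising_kernel:
  assumes "finite \<Lambda>" "y \<in> space config_space" "S \<in> sets config_space"
  shows "emeasure (ising_kernel \<beta> \<Lambda> y) S = ennreal (kernel_prob \<beta> \<Lambda> y S)"
proof -
  let ?P = "point_measure (\<Lambda> \<rightarrow>\<^sub>E spins) (\<lambda>x. ennreal (ising_spec \<beta> \<Lambda> y x))"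
  let ?f = "\<lambda>x. override_on y x \<Lambda>"
  have finP: "finite (\<Lambda> \<rightarrow>\<^sub>E spins)" using assms(1) by (intro finite_PiE) (auto simp: spins_def)
  have spec: "ising_spec \<beta> \<Lambda> y (restrict (pattern A) \<Lambda>) = weight \<beta> \<Lambda> (conf \<Lambda> y A) /
      (\<Sum>A\<in>Pow \<Lambda>. weight \<beta> \<Lambda> (conf \<Lambda> y A))" for A
  proof -
    have *: "boltzmann_weight \<beta> \<Lambda> y (restrict (pattern A) \<Lambda>) = weight \<beta> \<Lambda> (conf \<Lambda> y A)" for A
      by (rule boltzmann_weight_eq[OF assms(1)]) (auto simp: conf_def)
    show ?thesis
      unfolding ising_spec_def sum.reindex_bij_betw[OF bij_betw_pattern, symmetric] * by simp
  qed
  have space: "?f x \<in> space config_space" if "x \<in> \<Lambda> \<rightarrow>\<^sub>E spins" for x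
  proof -
    from that obtain A where "x = restrict (pattern A) \<Lambda>"
      using bij_betw_imp_surj_on[OF bij_betw_pattern, of \<Lambda>] by blast
    then show ?thesis using override_on_restrict_pattern assms(2) by simp
  qed
  have meas: "?f \<in> measurable ?P config_space"
    by (auto intro!: measurableI space simp: sets_point_measure space_point_measure)
  have "emeasure (ising_kernel \<beta> \<Lambda> y) S = emeasure ?P (?f -` S \<inter> (\<Lambda> \<rightarrow>\<^sub>E spins))"
    unfolding ising_kernel_def by (subst emeasure_distr[OF meas assms(3)]) (simp add: space_point_measure)
  also have "\<dots> = (\<Sum>x\<in>?f -` S \<inter> (\<Lambda> \<rightarrow>\<^sub>E spins). ennreal (ising_spec \<beta> \<Lambda> y x))"
    by (rule emeasure_point_measure_finite[OF finP]) auto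
  also have "\<dots> = (\<Sum>x\<in>\<Lambda> \<rightarrow>\<^sub>E spins. ennreal (ising_spec \<beta> \<Lambda> y x) * indicator S (?f x))"
    using finP by (intro sum.mono_neutral_cong_left) (auto simp: indicator_def)
  also have "\<dots> = (\<Sum>A\<in>Pow \<Lambda>. ennreal (ising_spec \<beta> \<Lambda> y (restrict (pattern A) \<Lambda>)) * indicator S (conf \<Lambda> y A))"
    by (subst sum.reindex_bij_betw[OF bij_betw_pattern, symmetric]) (simp add: override_on_restrict_pattern)
  also have "\<dots> = (\<Sum>A\<in>Pow \<Lambda>. ennreal (weight \<beta> \<Lambda> (conf \<Lambda> y A) /
      (\<Sum>A\<in>Pow \<Lambda>. weight \<beta> \<Lambda> (conf \<Lambda> y A)) * indicator S (conf \<Lambda> y A)))"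
    unfolding spec by (intro sum.cong refl) (auto simp: indicator_def)
  also have "\<dots> = ennreal (kernel_prob \<beta> \<Lambda> y S)"
    unfolding kernel_prob_def sum_divide_distrib
    by (subst sum_ennreal) (auto intro!: divide_nonneg_nonneg sum_nonneg)
  finally show ?thesis .
qed

lemma kernel_prob_nonneg: "kernel_prob \<beta> \<Lambda> y S \<ge> 0"
  unfolding kernel_prob_def by (intro divide_nonneg_nonneg sum_nonneg) auto

lemma partition_function_pos: "finite \<Lambda> \<Longrightarrow> (\<Sum>A\<in>Pow \<Lambda>. weight \<beta> \<Lambda> (conf \<Lambda> y A)) > 0"
  by (intro sum_pos) auto

lemma measure_ising_kernel:
  assumes "finite \<Lambda>" "y \<in> space config_space" "S \<in> sets config_space"
  shows "measure (ising_kernel \<beta> \<Lambda> y) S = kernel_prob \<beta> \<Lambda> y S"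
  using emeasure_ising_kernel[OF assms] kernel_prob_nonneg by (simp add: measure_def)

lemma sets_ising_kernel [simp]: "sets (ising_kernel \<beta> \<Lambda> y) = sets config_space"
  by (simp add: ising_kernel_def)

lemma space_ising_kernel [simp]: "space (ising_kernel \<beta> \<Lambda> y) = space config_space"
  by (simp add: ising_kernel_def)

lemma finite_measure_ising_kernel:
  "finite \<Lambda> \<Longrightarrow> y \<in> space config_space \<Longrightarrow> finite_measure (ising_kernel \<beta> \<Lambda> y)"
  by (intro finite_measureI) (simp add: emeasure_ising_kernel)

lemma eventually_finite_subsets:
  "finite F \<Longrightarrow> eventually (\<lambda>\<Lambda>. finite \<Lambda> \<and> F \<subseteq> \<Lambda>) (finite_subsets_at_top UNIV)"
  by (auto simp: eventually_finite_subsets_at_top)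

lemma const_space: "s = 1 \<or> s = -1 \<Longrightarrow> (\<lambda>_. s) \<in> space config_space"
  by (auto simp: space_config_space)

lemma ising_limit_local:
  assumes lim: "ising_limit \<beta> s \<mu>" and s: "s = 1 \<or> s = -1" and F: "finite F" "local_on F Q"
  shows "((\<lambda>\<Lambda>. kernel_prob \<beta> \<Lambda> (\<lambda>_. s) {x \<in> space config_space. Q x}) \<longlongrightarrow>
    measure \<mu> {x \<in> space config_space. Q x}) (finite_subsets_at_top UNIV)"
proof -
  interpret prob_space \<mu> using lim by (simp add: ising_limit_def)
  have sets [simp]: "sets \<mu> = sets config_space" using lim by (simp add: ising_limit_def)
  let ?C = "\<lambda>A. {x \<in> space config_space. \<forall>i\<in>F. x i = pattern A i}"
  let ?I = "{A\<in>Pow F. Q (pattern A)}"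
  have split: "measure M {x \<in> space config_space. Q x} = (\<Sum>A\<in>?I. measure M (?C A))"
    if "finite_measure M" "sets M = sets config_space" for M
    unfolding local_event_decompose[OF F(2)]
    using F(1) that sets_cylinder disjoint_patterns
    by (intro finite_measure.finite_measure_finite_Union) auto
  have "((\<lambda>\<Lambda>. \<Sum>A\<in>?I. measure (ising_kernel \<beta> \<Lambda> (\<lambda>_. s)) (?C A)) \<longlongrightarrow> (\<Sum>A\<in>?I. measure \<mu> (?C A)))
      (finite_subsets_at_top UNIV)"
    using lim F(1) by (intro tendsto_sum) (simp add: ising_limit_def)
  then have "((\<lambda>\<Lambda>. \<Sum>A\<in>?I. measure (ising_kernel \<beta> \<Lambda> (\<lambda>_. s)) (?C A)) \<longlongrightarrow>
      measure \<mu> {x \<in> space config_space. Q x}) (finite_subsets_at_top UNIV)"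
    using split[of \<mu>] finite_measure_axioms by simp
  moreover have "\<forall>\<^sub>F \<Lambda> in finite_subsets_at_top UNIV.
      (\<Sum>A\<in>?I. measure (ising_kernel \<beta> \<Lambda> (\<lambda>_. s)) (?C A)) =
      kernel_prob \<beta> \<Lambda> (\<lambda>_. s) {x \<in> space config_space. Q x}"
    using eventually_finite_subsets[of "{}", simplified]
  proof eventually_elim
    case (elim \<Lambda>)
    have "measure (ising_kernel \<beta> \<Lambda> (\<lambda>_. s)) {x \<in> space config_space. Q x} =
        kernel_prob \<beta> \<Lambda> (\<lambda>_. s) {x \<in> space config_space. Q x}"
      using elim const_space[OF s] sets_local[OF F] by (intro measure_ising_kernel)
    then show ?case
      using split[of "ising_kernel \<beta> \<Lambda> (\<lambda>_. s)"] finite_measure_ising_kernel[OF elim const_space[OF s]]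
      by simp
  qed
  ultimately show ?thesis by (rule Lim_transform_eventually)
qed

section \<open>Monotonicity and the minus phase\<close>

text \<open>The case of a one-point ground set. Here (X - u)(X - v) is nonnegative and uv \<le> XY,
  hence X(u + v) \<le> X(X + Y).\<close>

lemma four_numbers:
  fixes a0 a1 b0 b1 c0 c1 d0 d1 :: real
  assumes nn: "a0 \<ge> 0" "a1 \<ge> 0" "b0 \<ge> 0" "b1 \<ge> 0" "c0 \<ge> 0" "c1 \<ge> 0" "d0 \<ge> 0" "d1 \<ge> 0"
    and le: "a0 * b0 \<le> c0 * d0" "a0 * b1 \<le> c1 * d0" "a1 * b0 \<le> c1 * d0" "a1 * b1 \<le> c1 * d1"
  shows "(a0 + a1) * (b0 + b1) \<le> (c0 + c1) * (d0 + d1)"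
proof -
  define u v X Y where "u = a0 * b1" and "v = a1 * b0" and "X = c1 * d0" and "Y = c0 * d1"
  have nn': "u \<ge> 0" "v \<ge> 0" "Y \<ge> 0" "X \<ge> 0" using nn by (simp_all add: u_def v_def X_def Y_def)
  have uX: "u \<le> X" "v \<le> X" using le by (simp_all add: u_def v_def X_def)
  have "u + v \<le> X + Y"
  proof (cases "X = 0")
    case False
    then have "X > 0" using nn' by simp
    have "u * v = (a0 * b0) * (a1 * b1)" by (simp add: u_def v_def)
    also have "\<dots> \<le> (c0 * d0) * (c1 * d1)" by (rule mult_mono) (use le nn in auto)
    also have "\<dots> = X * Y" by (simp add: X_def Y_def)
    finally have "u * v \<le> X * Y" .
    moreover have "0 \<le> (X - u) * (X - v)" using uX by simp
    ultimately have "X * (u + v) \<le> X * (X + Y)" by (simp add: algebra_simps)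
    then show ?thesis using \<open>X > 0\<close> by simp
  qed (use uX nn' in auto)
  then show ?thesis using le by (simp add: u_def v_def X_def Y_def algebra_simps)
qed

lemma sum_Pow_insert:
  assumes "x \<notin> S" "finite S"
  shows "sum f (Pow (insert x S)) = (\<Sum>A\<in>Pow S. f A + f (insert x A))"
proof -
  have "sum f (Pow (insert x S)) = sum f (Pow S) + sum f (insert x ` Pow S)"
    unfolding Pow_insert using assms by (intro sum.union_disjoint) auto
  also have "sum f (insert x ` Pow S) = (\<Sum>A\<in>Pow S. f (insert x A))"
    using assms by (subst sum.reindex) (auto simp: inj_on_def)
  finally show ?thesis by (simp add: sum.distrib)
qed

text \<open>The Ahlswede-Daykin inequality, by induction on the ground set: summing out one element
  \<open>x\<close> leaves four functions on the subsets of \<open>S\<close>, and the four-number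
  inequality says that the hypothesis survives.\<close>

lemma four_functions:
  fixes \<alpha> \<beta> \<gamma> \<delta> :: "'a set \<Rightarrow> real"
  assumes "finite S"
    and "\<And>A. \<alpha> A \<ge> 0" "\<And>A. \<beta> A \<ge> 0" "\<And>A. \<gamma> A \<ge> 0" "\<And>A. \<delta> A \<ge> 0"
    and "\<And>A B. A \<subseteq> S \<Longrightarrow> B \<subseteq> S \<Longrightarrow> \<alpha> A * \<beta> B \<le> \<gamma> (A \<union> B) * \<delta> (A \<inter> B)"
  shows "sum \<alpha> (Pow S) * sum \<beta> (Pow S) \<le> sum \<gamma> (Pow S) * sum \<delta> (Pow S)"
  using assms
proof (induction S arbitrary: \<alpha> \<beta> \<gamma> \<delta> rule: finite_induct)
  case (insert x S)
  show ?case
    unfolding sum_Pow_insert[OF insert.hyps(2,1)]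
  proof (rule insert.IH)
    fix A B assume AB: "A \<subseteq> S" "B \<subseteq> S"
    then have x: "x \<notin> A" "x \<notin> B" using insert.hyps by auto
    note le = insert.prems(5)
    show "(\<alpha> A + \<alpha> (insert x A)) * (\<beta> B + \<beta> (insert x B)) \<le>
        (\<gamma> (A \<union> B) + \<gamma> (insert x (A \<union> B))) * (\<delta> (A \<inter> B) + \<delta> (insert x (A \<inter> B)))"
      using le[of A B] le[of A "insert x B"] le[of "insert x A" B] le[of "insert x A" "insert x B"] AB x
      by (intro four_numbers insert.prems) (auto simp: insert_absorb)
  qed (use insert.prems in auto)
qed simp

text \<open>The two sides agree unless a, c and b, d are ordered in opposite directions, and then
  they differ by the product of the gaps. This is the ferromagnetic input.\<close>

lemma product_supermodular:
  fixes a b c d :: int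
  shows "a * b + c * d \<le> min a c * min b d + max a c * max b d"
proof -
  have "0 \<le> (a - c) * (d - b)" if "c \<le> a" "b \<le> d" using that by simp
  moreover have "0 \<le> (c - a) * (b - d)" if "a \<le> c" "d \<le> b" using that by simp
  ultimately show ?thesis by (auto simp: min_def max_def algebra_simps)
qed

lemma energy_supermodular:
  "energy \<Lambda> z + energy \<Lambda> z' \<le>
     energy \<Lambda> (\<lambda>i. min (z i) (z' i)) + energy \<Lambda> (\<lambda>i. max (z i) (z' i))"
proof -
  have "(\<Sum>(i, j)\<in>incident \<Lambda>. real_of_int (z i * z j)) + (\<Sum>(i, j)\<in>incident \<Lambda>. real_of_int (z' i * z' j)) \<le>
    (\<Sum>(i, j)\<in>incident \<Lambda>. real_of_int (min (z i) (z' i) * min (z j) (z' j))) +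
    (\<Sum>(i, j)\<in>incident \<Lambda>. real_of_int (max (z i) (z' i) * max (z j) (z' j)))"
    unfolding sum.distrib[symmetric]
    by (rule sum_mono) (simp add: case_prod_beta flip: of_int_add of_int_mult of_int_min of_int_max, rule product_supermodular)
  then show ?thesis unfolding energy_def by linarith
qed

text \<open>This is the FKG lattice condition; the sign of \<beta> enters here.\<close>

lemma weight_supermodular:
  assumes "\<beta> \<ge> 0"
  shows "weight \<beta> \<Lambda> z * weight \<beta> \<Lambda> z' \<le>
     weight \<beta> \<Lambda> (\<lambda>i. max (z i) (z' i)) * weight \<beta> \<Lambda> (\<lambda>i. min (z i) (z' i))"
  using mult_left_mono[OF energy_supermodular assms]
  by (simp add: weight_def algebra_simps flip: exp_add)

definition increasing_event :: "config set \<Rightarrow> bool" where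
  "increasing_event S \<longleftrightarrow> (\<forall>x\<in>S. \<forall>z\<in>space config_space. (\<forall>i. x i \<le> z i) \<longrightarrow> z \<in> S)"

lemma conf_lattice:
  assumes "\<And>i. y i \<le> y' i"
  shows "(\<lambda>i. min (conf \<Lambda> y A i) (conf \<Lambda> y' B i)) = conf \<Lambda> y (A \<inter> B)"
    "(\<lambda>i. max (conf \<Lambda> y A i) (conf \<Lambda> y' B i)) = conf \<Lambda> y' (A \<union> B)"
  using assms by (auto simp: conf_def pattern_def min_def max_def fun_eq_iff order.antisym)

lemma indicator_increasing:
  assumes "increasing_event S" "\<And>i. x i \<le> z i" "z \<in> space config_space"
  shows "(indicator S x :: real) \<le> indicator S z"
  using assms by (auto simp: increasing_event_def indicator_def)

text \<open>Holley's inequality. After clearing the two partition functions it is the four functions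
  theorem, where the larger boundary condition goes with unions and the smaller one with
  intersections.\<close>

lemma kernel_prob_mono:
  assumes "finite \<Lambda>" "\<beta> \<ge> 0" "increasing_event S"
    and y: "\<And>i. y i \<le> y' i" "y' \<in> space config_space"
  shows "kernel_prob \<beta> \<Lambda> y S \<le> kernel_prob \<beta> \<Lambda> y' S"
proof -
  let ?w = "\<lambda>y A. weight \<beta> \<Lambda> (conf \<Lambda> y A)"
  have "(\<Sum>A\<in>Pow \<Lambda>. ?w y A * indicator S (conf \<Lambda> y A)) * (\<Sum>A\<in>Pow \<Lambda>. ?w y' A) \<le>
    (\<Sum>A\<in>Pow \<Lambda>. ?w y' A * indicator S (conf \<Lambda> y' A)) * (\<Sum>A\<in>Pow \<Lambda>. ?w y A)"
  proof (rule four_functions[OF assms(1)])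
    fix A B
    have w: "?w y A * ?w y' B \<le> ?w y' (A \<union> B) * ?w y (A \<inter> B)"
      using weight_supermodular[OF assms(2), of \<Lambda> "conf \<Lambda> y A" "conf \<Lambda> y' B"] conf_lattice[OF y(1)] by simp
    have i: "(indicator S (conf \<Lambda> y A) :: real) \<le> indicator S (conf \<Lambda> y' (A \<union> B))"
      by (rule indicator_increasing[OF assms(3)]) (use y in \<open>auto simp: conf_def pattern_def\<close>)
    from mult_mono[OF i w]
    show "?w y A * indicator S (conf \<Lambda> y A) * ?w y' B \<le>
        ?w y' (A \<union> B) * indicator S (conf \<Lambda> y' (A \<union> B)) * ?w y (A \<inter> B)"
      by (simp add: mult_ac)
  qed auto
  then show ?thesis
    unfolding kernel_prob_def
    using partition_function_pos[OF assms(1), of \<beta> y] partition_function_pos[OF assms(1), of \<beta> y']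
    by (simp add: divide_simps mult_ac)
qed

text \<open>Enlarging the volume amounts to releasing the plus condition on the added sites, so this is
  positive association of the larger system.\<close>

lemma kernel_prob_antimono_domain:
  assumes fin: "finite \<Lambda>'" and sub: "\<Lambda> \<subseteq> \<Lambda>'" and "\<beta> \<ge> 0" "increasing_event S"
  shows "kernel_prob \<beta> \<Lambda>' (\<lambda>_. 1) S \<le> kernel_prob \<beta> \<Lambda> (\<lambda>_. 1) S"
proof -
  let ?c = "\<lambda>\<Lambda>. conf \<Lambda> (\<lambda>_. 1)"
  let ?w = "\<lambda>A. weight \<beta> \<Lambda>' (?c \<Lambda>' A)"
  let ?D = "\<Lambda>' - \<Lambda>"
  let ?R = "{A\<in>Pow \<Lambda>'. ?D \<subseteq> A}"
  have "(\<Sum>A\<in>Pow \<Lambda>'. ?w A * indicator S (?c \<Lambda>' A)) * (\<Sum>A\<in>Pow \<Lambda>'. ?w A * of_bool (?D \<subseteq> A)) \<le>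
    (\<Sum>A\<in>Pow \<Lambda>'. ?w A * indicator S (?c \<Lambda>' A) * of_bool (?D \<subseteq> A)) * (\<Sum>A\<in>Pow \<Lambda>'. ?w A)"
  proof (rule four_functions[OF fin])
    fix A B
    have w: "?w A * ?w B \<le> ?w (A \<union> B) * ?w (A \<inter> B)"
      using weight_supermodular[OF assms(3), of \<Lambda>' "?c \<Lambda>' A" "?c \<Lambda>' B"]
        conf_lattice[of "\<lambda>_. 1" "\<lambda>_. 1"] by simp
    have i: "(indicator S (?c \<Lambda>' A) :: real) \<le> indicator S (?c \<Lambda>' (A \<union> B))"
      by (rule indicator_increasing[OF assms(4)]) (auto simp: conf_def pattern_def space_config_space)
    have "(indicator S (?c \<Lambda>' A) :: real) * of_bool (?D \<subseteq> B) \<le>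
        indicator S (?c \<Lambda>' (A \<union> B)) * of_bool (?D \<subseteq> A \<union> B)"
      using i by auto
    from mult_mono[OF this w]
    show "?w A * indicator S (?c \<Lambda>' A) * (?w B * of_bool (?D \<subseteq> B)) \<le>
        ?w (A \<union> B) * indicator S (?c \<Lambda>' (A \<union> B)) * of_bool (?D \<subseteq> A \<union> B) * ?w (A \<inter> B)"
      by (simp add: mult_ac)
  qed auto
  moreover have "(\<Sum>A\<in>Pow \<Lambda>'. ?w A * of_bool (?D \<subseteq> A)) = sum ?w ?R"
    using fin by (intro sum.mono_neutral_cong_right) auto
  moreover have "(\<Sum>A\<in>Pow \<Lambda>'. ?w A * indicator S (?c \<Lambda>' A) * of_bool (?D \<subseteq> A)) =
      (\<Sum>A\<in>?R. ?w A * indicator S (?c \<Lambda>' A))"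
    using fin by (intro sum.mono_neutral_cong_right) auto
  ultimately have le: "(\<Sum>A\<in>Pow \<Lambda>'. ?w A * indicator S (?c \<Lambda>' A)) * sum ?w ?R \<le>
      (\<Sum>A\<in>?R. ?w A * indicator S (?c \<Lambda>' A)) * sum ?w (Pow \<Lambda>')"
    by simp
  have bij: "bij_betw (\<lambda>A. A \<union> ?D) (Pow \<Lambda>) ?R"
    using sub by (intro bij_betwI[where g = "\<lambda>A. A \<inter> \<Lambda>"]) auto
  have conf: "?c \<Lambda>' (A \<union> ?D) = ?c \<Lambda> A" if "A \<subseteq> \<Lambda>" for A
    using that sub by (auto simp: conf_def pattern_def fun_eq_iff)
  \<comment> \<open>Bonds of the larger volume that miss \<Lambda> join two plus spins and
    contribute a constant, which cancels in the ratio; the division by 2 accounts for ordered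
    pairs.\<close>
  define e where "e = real (card (incident \<Lambda>' - incident \<Lambda>)) / 2"
  have energy: "energy \<Lambda>' (?c \<Lambda> A) = energy \<Lambda> (?c \<Lambda> A) + e" for A
  proof -
    let ?f = "\<lambda>(i, j). real_of_int (?c \<Lambda> A i * ?c \<Lambda> A j)"
    have "incident \<Lambda> \<subseteq> incident \<Lambda>'" using sub by (auto simp: incident_def)
    then have "sum ?f (incident \<Lambda>') = sum ?f (incident \<Lambda>) + sum ?f (incident \<Lambda>' - incident \<Lambda>)"
      using fin by (simp add: sum.subset_diff)
    also have "sum ?f (incident \<Lambda>' - incident \<Lambda>) = (\<Sum>_\<in>incident \<Lambda>' - incident \<Lambda>. 1)"
      by (intro sum.cong refl) (auto simp: incident_def conf_def split: if_splits)
    finally show ?thesis by (simp add: energy_def e_def add_divide_distrib)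
  qed
  have w: "weight \<beta> \<Lambda>' (?c \<Lambda> A) = exp (\<beta> * e) * weight \<beta> \<Lambda> (?c \<Lambda> A)" for A
    by (simp add: weight_def energy algebra_simps flip: exp_add)
  have R1: "sum ?w ?R = exp (\<beta> * e) * (\<Sum>A\<in>Pow \<Lambda>. weight \<beta> \<Lambda> (?c \<Lambda> A))"
    unfolding sum.reindex_bij_betw[OF bij, symmetric] sum_distrib_left
    by (intro sum.cong) (auto simp: conf w)
  have R2: "(\<Sum>A\<in>?R. ?w A * indicator S (?c \<Lambda>' A)) =
      exp (\<beta> * e) * (\<Sum>A\<in>Pow \<Lambda>. weight \<beta> \<Lambda> (?c \<Lambda> A) * indicator S (?c \<Lambda> A))"
    unfolding sum.reindex_bij_betw[OF bij, symmetric] sum_distrib_left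
    by (intro sum.cong) (auto simp: conf w)
  from le show ?thesis
    unfolding kernel_prob_def R1 R2
    using partition_function_pos[OF fin, of \<beta> "\<lambda>_. 1"]
      partition_function_pos[OF finite_subset[OF sub fin], of \<beta> "\<lambda>_. 1"]
    by (simp add: divide_simps mult_ac)
qed

text \<open>Increasing cylinder events, stable under intersection; domination between phases is
  tested on them alone.\<close>

definition plus_on :: "site set \<Rightarrow> config set" where
  "plus_on B = {x \<in> space config_space. \<forall>i\<in>B. x i = 1}"

lemma sets_plus_on [simp]: "finite B \<Longrightarrow> plus_on B \<in> sets config_space"
  unfolding plus_on_def by (rule sets_cylinder)

lemma increasing_plus_on: "increasing_event (plus_on B)"
  unfolding increasing_event_def plus_on_def
proof (intro ballI impI CollectI conjI)
  fix x z i assume "x \<in> {x \<in> space config_space. \<forall>i\<in>B. x i = 1}" "z \<in> space config_space"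
    "\<forall>i. x i \<le> z i" "i \<in> B"
  then have "x i = 1" "x i \<le> z i" by blast+
  then show "z i = 1" using spin_cases[OF \<open>z \<in> space config_space\<close>, of i] by auto
qed

lemma local_plus_on: "local_on B (\<lambda>x. \<forall>i\<in>B. x i = 1)"
  by (auto simp: local_on_def)

lemma ising_limit_plus_on:
  assumes "ising_limit \<beta> s \<mu>" "s = 1 \<or> s = -1" "finite B"
  shows "((\<lambda>\<Lambda>. kernel_prob \<beta> \<Lambda> (\<lambda>_. s) (plus_on B)) \<longlongrightarrow> measure \<mu> (plus_on B))
    (finite_subsets_at_top UNIV)"
  unfolding plus_on_def by (rule ising_limit_local[OF assms local_plus_on])

text \<open>Finite-volume plus probabilities decrease as the volume grows, so their limit lies below
  each of them.\<close>

lemma plus_phase_le_kernel: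
  assumes "plus_phase \<beta> \<mu>" "finite B" "finite \<Lambda>" "\<beta> \<ge> 0"
  shows "measure \<mu> (plus_on B) \<le> kernel_prob \<beta> \<Lambda> (\<lambda>_. 1) (plus_on B)"
proof (rule tendsto_upperbound[OF ising_limit_plus_on[OF assms(1) _ assms(2)]])
  show "\<forall>\<^sub>F \<Lambda>' in finite_subsets_at_top UNIV.
      kernel_prob \<beta> \<Lambda>' (\<lambda>_. 1) (plus_on B) \<le> kernel_prob \<beta> \<Lambda> (\<lambda>_. 1) (plus_on B)"
    using eventually_finite_subsets[OF assms(3)]
    by eventually_elim (intro kernel_prob_antimono_domain assms increasing_plus_on; simp)
qed auto

lemma minus_phase_le_plus_phase:
  assumes "minus_phase \<beta> \<mu>" "plus_phase \<beta> \<nu>" "finite B" "\<beta> \<ge> 0"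
  shows "measure \<mu> (plus_on B) \<le> measure \<nu> (plus_on B)"
proof (rule tendsto_le[OF _ ising_limit_plus_on[OF assms(2) _ assms(3)] ising_limit_plus_on[OF assms(1) _ assms(3)]])
  show "\<forall>\<^sub>F \<Lambda> in finite_subsets_at_top UNIV.
      kernel_prob \<beta> \<Lambda> (\<lambda>_. - 1) (plus_on B) \<le> kernel_prob \<beta> \<Lambda> (\<lambda>_. 1) (plus_on B)"
    using eventually_finite_subsets[OF finite.emptyI]
    by (rule eventually_mono) (auto intro!: kernel_prob_mono assms increasing_plus_on const_space)
qed auto

text \<open>The events \<open>plus_on B\<close> form a pi-system, and complements of the single-site
  ones supply the minus spin, so they generate the product sigma-algebra.\<close>

lemma config_measure_eqI:
  assumes \<mu>: "prob_space \<mu>" "sets \<mu> = sets config_space"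
    and \<nu>: "prob_space \<nu>" "sets \<nu> = sets config_space"
    and eq: "\<And>B. finite B \<Longrightarrow> measure \<mu> (plus_on B) = measure \<nu> (plus_on B)"
  shows "\<mu> = \<nu>"
proof (rule measure_eqI_generator_eq[where E = "plus_on ` Collect finite" and A = "\<lambda>_. space config_space"])
  let ?G = "sigma_sets (space config_space) (plus_on ` Collect finite)"
  show "Int_stable (plus_on ` Collect finite)"
  proof (rule Int_stableI_image)
    show "\<exists>k\<in>Collect finite. plus_on B \<inter> plus_on C = plus_on k"
      if "B \<in> Collect finite" "C \<in> Collect finite" for B C
      using that by (intro bexI[of _ "B \<union> C"]) (auto simp: plus_on_def)
  qed
  have "sets config_space = ?G"
  proof
    interpret sigma_algebra "space config_space" ?G
      by (rule sigma_algebra_sigma_sets) (auto simp: plus_on_def)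
    have plus: "plus_on {i} \<in> ?G" for i by (intro sigma_sets.Basic) auto
    have *: "{f \<in> space config_space. f i \<in> A} \<in> ?G" for i A
    proof -
      have "{f \<in> space config_space. f i \<in> A} =
        (if 1 \<in> A then plus_on {i} else {}) \<union> (if -1 \<in> A then space config_space - plus_on {i} else {})"
        using spin_cases[of _ i] by (auto simp: plus_on_def; metis)
      also have "\<dots> \<in> ?G" using plus by auto
      finally show ?thesis .
    qed
    have "sets config_space = sigma_sets (space config_space)
        {{f \<in> space config_space. f i \<in> A} | i A. i \<in> UNIV \<and> A \<in> sets (count_space spins)}"
      unfolding config_space_def by (subst sets_PiM_single) (simp add: space_PiM)
    also have "\<dots> \<subseteq> ?G" using * by (intro sigma_sets_mono) auto
    finally show "sets config_space \<subseteq> ?G" .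
    show "?G \<subseteq> sets config_space"
      by (intro sets.sigma_sets_subset) auto
  qed
  then show "sets \<mu> = ?G" "sets \<nu> = ?G" using \<mu> \<nu> by auto
  show "emeasure \<mu> X = emeasure \<nu> X" if "X \<in> plus_on ` Collect finite" for X
    using that eq \<mu>(1) \<nu>(1)
    by (auto simp: finite_measure.emeasure_eq_measure prob_space.finite_measure)
  show "emeasure \<mu> (space config_space) \<noteq> \<infinity>"
    using \<mu>(1) by (simp add: finite_measure.emeasure_eq_measure prob_space.finite_measure)
  show "range (\<lambda>_. space config_space) \<subseteq> plus_on ` Collect finite"
    by (auto simp: plus_on_def intro!: image_eqI[of _ _ "{}"])
qed (auto simp: plus_on_def)


section \<open>The plus hull and the DLR equations\<close>

definition lattice_box :: "nat \<Rightarrow> site set" where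
  "lattice_box n = {- int n..int n} \<times> {- int n..int n}"

lemma finite_box [simp]: "finite (lattice_box n)"
  by (simp add: lattice_box_def)

lemma box_mono: "m \<le> n \<Longrightarrow> lattice_box m \<subseteq> lattice_box n"
  by (auto simp: lattice_box_def)

lemma finite_subset_box:
  assumes "finite L" obtains n where "L \<subseteq> lattice_box n"
proof -
  have "\<exists>n. L \<subseteq> lattice_box n" using assms
  proof (induction L rule: finite_induct)
    case (insert i L)
    then obtain n where n: "L \<subseteq> lattice_box n" by blast
    define m where "m = max n (nat (max \<bar>fst i\<bar> \<bar>snd i\<bar>))"
    have "i \<in> lattice_box m" by (cases i) (auto simp: lattice_box_def m_def)
    moreover have "L \<subseteq> lattice_box m" using n box_mono[of n m] by (auto simp: m_def)
    ultimately show ?case by blast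
  qed simp
  then show thesis using that by blast
qed

text \<open>By maximality, the event that this set equals \<^term>\<open>L\<close> is determined outside \<^term>\<open>L\<close>, as for a
  stopping time, so that the DLR equation for \<^term>\<open>L\<close> applies on it.\<close>

definition plus_hull :: "site set \<Rightarrow> config \<Rightarrow> site set" where
  "plus_hull V x = \<Union>{L. L \<subseteq> V \<and> (\<forall>j\<in>outer_boundary L. x j = 1)}"

lemma plus_hull_subset: "plus_hull V x \<subseteq> V"
  by (auto simp: plus_hull_def)

lemma plus_hull_boundary: "j \<in> outer_boundary (plus_hull V x) \<Longrightarrow> x j = 1"
  unfolding plus_hull_def using outer_boundary_Union by blast

lemma plus_hull_greatest:
  "L \<subseteq> V \<Longrightarrow> (\<And>j. j \<in> outer_boundary L \<Longrightarrow> x j = 1) \<Longrightarrow> L \<subseteq> plus_hull V x"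
  unfolding plus_hull_def by blast

lemma plus_hull_mono: "V \<subseteq> W \<Longrightarrow> plus_hull V x \<subseteq> plus_hull W x"
  unfolding plus_hull_def by blast

text \<open>The hull of \<open>x\<close> keeps its plus outer boundary in \<open>x'\<close>, which
  gives one inclusion. Hence the outer boundary of the new hull avoids the old hull, the only place
  where the configurations can differ, and maximality in \<open>x\<close> gives the other
  inclusion.\<close>

lemma plus_hull_cong_outside:
  assumes "\<And>j. j \<notin> plus_hull V x \<Longrightarrow> x j = x' j"
  shows "plus_hull V x' = plus_hull V x"
proof -
  have out: "j \<notin> L" if "j \<in> outer_boundary L" for j L
    using that unfolding outer_boundary_def by blast
  have le: "plus_hull V x \<subseteq> plus_hull V x'"
  proof (rule plus_hull_greatest[OF plus_hull_subset])
    fix j assume j: "j \<in> outer_boundary (plus_hull V x)"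
    show "x' j = 1" using plus_hull_boundary[OF j] assms[OF out[OF j]] by simp
  qed
  have "plus_hull V x' \<subseteq> plus_hull V x"
  proof (rule plus_hull_greatest[OF plus_hull_subset])
    fix j assume j: "j \<in> outer_boundary (plus_hull V x')"
    then have "j \<notin> plus_hull V x" using out le by blast
    then show "x j = 1" using plus_hull_boundary[OF j] assms by simp
  qed
  with le show ?thesis by blast
qed

lemma local_plus_hull: "local_on (V \<union> outer_boundary V) (plus_hull V)"
  unfolding local_on_def
proof (intro ballI impI)
  fix x y :: config assume eq: "\<forall>i\<in>V \<union> outer_boundary V. x i = y i"
  have "outer_boundary L \<subseteq> V \<union> outer_boundary V" if "L \<subseteq> V" for L
    using that by (auto simp: outer_boundary_def)
  then have "L \<subseteq> V \<and> (\<forall>j\<in>outer_boundary L. x j = 1) \<longleftrightarrow> L \<subseteq> V \<and> (\<forall>j\<in>outer_boundary L. y j = 1)" for L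
    using eq by (metis subsetD)
  then show "plus_hull V x = plus_hull V y" by (simp add: plus_hull_def)
qed

lemma sets_plus_hull:
  assumes "finite V" shows "{x \<in> space config_space. Q (plus_hull V x)} \<in> sets config_space"
  by (rule sets_local[OF _ local_on_comp[OF local_plus_hull]]) (use assms in simp)

lemma enclosed_iff_plus_hull: "enclosed i x \<longleftrightarrow> (\<exists>n. i \<in> plus_hull (lattice_box n) x)"
proof
  assume "enclosed i x"
  then obtain L where L: "finite L" "i \<in> L" "\<And>j. j \<in> outer_boundary L \<Longrightarrow> x j = 1"
    by (auto simp: enclosed_def)
  obtain n where "L \<subseteq> lattice_box n" using finite_subset_box[OF L(1)] by blast
  then show "\<exists>n. i \<in> plus_hull (lattice_box n) x" using plus_hull_greatest[of L "lattice_box n" x] L by blast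
next
  assume "\<exists>n. i \<in> plus_hull (lattice_box n) x"
  then obtain n where "i \<in> plus_hull (lattice_box n) x" by blast
  then show "enclosed i x"
    unfolding enclosed_def using finite_subset[OF plus_hull_subset finite_box, of n x] plus_hull_boundary
    by blast
qed

lemma energy_cong:
  assumes "\<And>i. i \<in> \<Lambda> \<union> outer_boundary \<Lambda> \<Longrightarrow> z i = z' i"
  shows "energy \<Lambda> z = energy \<Lambda> z'"
proof -
  have "z i * z j = z' i * z' j" if "(i, j) \<in> incident \<Lambda>" for i j
  proof -
    have "i \<in> \<Lambda> \<union> outer_boundary \<Lambda>" "j \<in> \<Lambda> \<union> outer_boundary \<Lambda>"
      using that neighbors_sym unfolding incident_def outer_boundary_def by blast+
    then show ?thesis using assms by simp
  qed
  then have "(\<Sum>(i, j)\<in>incident \<Lambda>. real_of_int (z i * z j)) = (\<Sum>(i, j)\<in>incident \<Lambda>. real_of_int (z' i * z' j))"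
    by (intro sum.cong) (auto simp del: of_int_mult)
  then show ?thesis by (simp only: energy_def)
qed

text \<open>Resampling inside \<open>L\<close> cannot change whether the hull equals
  \<open>L\<close>, and on that event all spins just outside \<open>L\<close> are plus. So the
  weights are those of plus boundary conditions.\<close>

lemma kernel_prob_plus_hull:
  assumes "B \<subseteq> L" "finite L" "y \<in> space config_space"
  shows "kernel_prob \<beta> L y (plus_on B \<inter> {x \<in> space config_space. plus_hull V x = L}) =
    kernel_prob \<beta> L (\<lambda>_. 1) (plus_on B) * indicator {x. plus_hull V x = L} y"
proof -
  have hull: "plus_hull V (conf L y A) = L \<longleftrightarrow> plus_hull V y = L" for A
  proof
    assume "plus_hull V (conf L y A) = L"
    then show "plus_hull V y = L" using plus_hull_cong_outside[of V "conf L y A" y] by (simp add: conf_def)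
  next
    assume "plus_hull V y = L"
    then show "plus_hull V (conf L y A) = L" using plus_hull_cong_outside[of V y "conf L y A"] by (simp add: conf_def)
  qed
  show ?thesis
  proof (cases "plus_hull V y = L")
    case False
    then show ?thesis by (simp add: kernel_prob_def hull indicator_def)
  next
    case True
    have "y j = 1" if "j \<in> outer_boundary L" for j using plus_hull_boundary[of j V y] True that by simp
    then have w: "weight \<beta> L (conf L y A) = weight \<beta> L (conf L (\<lambda>_. 1) A)" for A
      unfolding weight_def by (subst energy_cong[of _ _ "conf L (\<lambda>_. 1) A"]) (auto simp: conf_def)
    have "conf L y A \<in> plus_on B \<longleftrightarrow> conf L (\<lambda>_. 1) A \<in> plus_on B" for A
      using assms const_space[of 1] by (auto simp: plus_on_def conf_def subset_iff)
    then have "(indicator (plus_on B \<inter> {x \<in> space config_space. plus_hull V x = L}) (conf L y A) :: real) =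
        indicator (plus_on B) (conf L (\<lambda>_. 1) A)" for A
      using True assms(3) by (simp add: indicator_def hull)
    then show ?thesis using True w by (simp add: kernel_prob_def)
  qed
qed

text \<open>The hull event is split according to the value \<open>L\<close> of the hull. On each
  piece the DLR equation for \<open>L\<close> gives \<open>plus_on B\<close> a conditional
  probability of at least \<open>p\<close>; the pieces are disjoint, so the bounds add up.\<close>

lemma gibbs_plus_on_ge:
  assumes \<mu>: "\<mu> \<in> gibbs_measures \<beta>" and V: "finite V" and p: "p \<ge> 0"
    and le: "\<And>L. finite L \<Longrightarrow> p \<le> kernel_prob \<beta> L (\<lambda>_. 1) (plus_on B)"
  shows "ennreal p * emeasure \<mu> {x \<in> space config_space. B \<subseteq> plus_hull V x} \<le> emeasure \<mu> (plus_on B)"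
proof (cases "B \<subseteq> V")
  case True
  then have finB: "finite B" using V finite_subset by blast
  have sets [simp]: "sets \<mu> = sets config_space" using \<mu> by (simp add: gibbs_measures_def)
  have space [simp]: "space \<mu> = space config_space" using sets_eq_imp_space_eq[OF sets] .
  let ?H = "\<lambda>L. {x \<in> space config_space. plus_hull V x = L}"
  let ?I = "{L\<in>Pow V. B \<subseteq> L}"
  have finI: "finite ?I" using V by simp
  have disj: "disjoint_family_on (\<lambda>L. S \<inter> ?H L) ?I" for S by (auto simp: disjoint_family_on_def)
  have H: "?H L \<in> sets config_space" for L using sets_plus_hull[OF V, of "\<lambda>K. K = L"] .
  have "{x \<in> space config_space. B \<subseteq> plus_hull V x} = (\<Union>L\<in>?I. space config_space \<inter> ?H L)"
    using plus_hull_subset[of V] by auto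
  then have "emeasure \<mu> {x \<in> space config_space. B \<subseteq> plus_hull V x} = (\<Sum>L\<in>?I. emeasure \<mu> (space config_space \<inter> ?H L))"
    using finI disj[of "space config_space"] H by (simp only:) (intro sum_emeasure[symmetric]; force)
  then have "ennreal p * emeasure \<mu> {x \<in> space config_space. B \<subseteq> plus_hull V x} =
      (\<Sum>L\<in>?I. ennreal p * emeasure \<mu> (?H L))"
    by (simp add: sum_distrib_left Int_absorb1 subset_iff)
  also have "\<dots> \<le> (\<Sum>L\<in>?I. emeasure \<mu> (plus_on B \<inter> ?H L))"
  proof (rule sum_mono)
    fix L assume L: "L \<in> ?I"
    then have finL: "finite L" using V finite_subset by blast
    have E: "plus_on B \<inter> ?H L \<in> sets config_space" using H finB by auto
    have "ennreal p * emeasure \<mu> (?H L) = (\<integral>\<^sup>+ y. ennreal p * indicator (?H L) y \<partial>\<mu>)"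
      using H by (simp add: nn_integral_cmult_indicator)
    also have "\<dots> \<le> (\<integral>\<^sup>+ y. emeasure (ising_kernel \<beta> L y) (plus_on B \<inter> ?H L) \<partial>\<mu>)"
    proof (rule nn_integral_mono)
      fix y assume y: "y \<in> space \<mu>"
      have "emeasure (ising_kernel \<beta> L y) (plus_on B \<inter> ?H L) =
          ennreal (kernel_prob \<beta> L (\<lambda>_. 1) (plus_on B) * indicator {x. plus_hull V x = L} y)"
        using L y finL E by (subst emeasure_ising_kernel) (auto simp: kernel_prob_plus_hull)
      moreover have "ennreal p * indicator (?H L) y \<le>
          ennreal (kernel_prob \<beta> L (\<lambda>_. 1) (plus_on B) * indicator {x. plus_hull V x = L} y)"
        using le[OF finL] by (auto simp: indicator_def intro: ennreal_leI)
      ultimately show "ennreal p * indicator (?H L) y \<le> emeasure (ising_kernel \<beta> L y) (plus_on B \<inter> ?H L)"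
        by simp
    qed
    also have "\<dots> = emeasure \<mu> (plus_on B \<inter> ?H L)"
      using \<mu> finL E by (simp add: gibbs_measures_def)
    finally show "ennreal p * emeasure \<mu> (?H L) \<le> emeasure \<mu> (plus_on B \<inter> ?H L)" .
  qed
  also have "\<dots> = emeasure \<mu> (\<Union>L\<in>?I. plus_on B \<inter> ?H L)"
    using finI disj H finB by (intro sum_emeasure) auto
  also have "\<dots> \<le> emeasure \<mu> (plus_on B)"
    using finB by (intro emeasure_mono) auto
  finally show ?thesis .
next
  case False
  then have "{x \<in> space config_space. B \<subseteq> plus_hull V x} = {}" using plus_hull_subset[of V] by blast
  then show ?thesis by (simp only: emeasure_empty) simp
qed

definition all_enclosed :: "config set" where
  "all_enclosed = {x \<in> space config_space. \<forall>i. enclosed i x}"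

lemma sets_all_enclosed [measurable]: "all_enclosed \<in> sets config_space"
  unfolding all_enclosed_def by (intro sets.sets_Collect_countable_All sets_enclosed)

text \<open>On \<open>all_enclosed\<close> a finite \<open>B\<close> has one finite enclosing set,
  so the hulls of growing boxes eventually contain \<open>B\<close>, and continuity from below
  applies. Later \<open>p\<close> is the probability of \<open>plus_on B\<close> in the plus
  phase.\<close>

lemma gibbs_all_enclosed_ge:
  assumes \<mu>: "\<mu> \<in> gibbs_measures \<beta>" and one: "emeasure \<mu> all_enclosed = 1" and B: "finite B" and p: "p \<ge> 0"
    and le: "\<And>L. finite L \<Longrightarrow> p \<le> kernel_prob \<beta> L (\<lambda>_. 1) (plus_on B)"
  shows "p \<le> measure \<mu> (plus_on B)"
proof -
  interpret prob_space \<mu> using \<mu> by (simp add: gibbs_measures_def)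
  have sets [simp]: "sets \<mu> = sets config_space" using \<mu> by (simp add: gibbs_measures_def)
  let ?E = "\<lambda>n. {x \<in> space config_space. B \<subseteq> plus_hull (lattice_box n) x}"
  have E: "range ?E \<subseteq> sets \<mu>" using sets_plus_hull[OF finite_box, of "\<lambda>L. B \<subseteq> L"] by auto
  have inc: "incseq ?E"
    using plus_hull_mono[OF box_mono] by (fastforce simp: incseq_def)
  have "all_enclosed \<subseteq> (\<Union>n. ?E n)"
  proof
    fix x assume x: "x \<in> all_enclosed"
    then obtain L where L: "finite L" "B \<subseteq> L" "\<And>j. j \<in> outer_boundary L \<Longrightarrow> x j = 1"
      using enclosedE_finite[of B x] B by (auto simp: all_enclosed_def)
    obtain n where "L \<subseteq> lattice_box n" using finite_subset_box[OF L(1)] by blast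
    then have "L \<subseteq> plus_hull (lattice_box n) x" using L(3) by (intro plus_hull_greatest)
    then show "x \<in> (\<Union>n. ?E n)" using L(2) x by (auto simp: all_enclosed_def)
  qed
  then have "1 \<le> emeasure \<mu> (\<Union>n. ?E n)"
    unfolding one[symmetric] using E by (intro emeasure_mono sets.countable_UN) auto
  also have "\<dots> = (SUP n. emeasure \<mu> (?E n))"
    using SUP_emeasure_incseq[OF E inc] by simp
  finally have "ennreal p \<le> ennreal p * (SUP n. emeasure \<mu> (?E n))"
    using mult_left_mono[of 1 _ "ennreal p"] by simp
  also have "\<dots> = (SUP n. ennreal p * emeasure \<mu> (?E n))" by (simp add: SUP_mult_left_ennreal)
  also have "\<dots> \<le> emeasure \<mu> (plus_on B)"
    using gibbs_plus_on_ge[OF \<mu> finite_box p le] by (intro SUP_least)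
  finally show ?thesis by (simp add: emeasure_eq_measure)
qed

text \<open>An enclosing set can be enlarged to contain all of \<Lambda>; its outer boundary then
  avoids the altered sites.\<close>

lemma all_enclosed_conf:
  assumes "y \<in> space config_space" "finite \<Lambda>"
  shows "conf \<Lambda> y A \<in> all_enclosed \<longleftrightarrow> y \<in> all_enclosed"
proof -
  have *: "\<forall>i. enclosed i z'" if enc: "\<forall>i. enclosed i z" and eq: "\<And>i. i \<notin> \<Lambda> \<Longrightarrow> z i = z' i" for z z'
  proof
    fix i
    obtain L where L: "finite L" "insert i \<Lambda> \<subseteq> L" "\<And>j. j \<in> outer_boundary L \<Longrightarrow> z j = 1"
      using enclosedE_finite[of "insert i \<Lambda>" z] enc assms(2) by blast
    have "z' j = 1" if "j \<in> outer_boundary L" for j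
    proof -
      have "j \<notin> \<Lambda>" using that L(2) by (auto simp: outer_boundary_def)
      then show ?thesis using L(3)[OF that] eq by metis
    qed
    then show "enclosed i z'" unfolding enclosed_def using L by blast
  qed
  show ?thesis
    using *[of y "conf \<Lambda> y A"] *[of "conf \<Lambda> y A" y] assms(1)
    by (simp add: all_enclosed_def conf_def) (metis)
qed

lemma measurable_conf [measurable]: "(\<lambda>y. conf \<Lambda> y A) \<in> measurable config_space config_space"
  unfolding config_space_def
proof (rule measurable_PiM_single')
  fix i :: site
  show "(\<lambda>y. conf \<Lambda> y A i) \<in> measurable (\<Pi>\<^sub>M i\<in>UNIV. count_space spins) (count_space spins)"
    by (cases "i \<in> \<Lambda>") (auto simp: conf_def pattern_def spins_def)
qed (auto simp: space_PiM conf_def pattern_def spins_def PiE_def Pi_def)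

lemma measurable_kernel_prob:
  assumes "finite \<Lambda>" "E \<in> sets config_space"
  shows "(\<lambda>y. kernel_prob \<beta> \<Lambda> y E) \<in> borel_measurable config_space"
proof -
  have w: "(\<lambda>y. weight \<beta> \<Lambda> (conf \<Lambda> y A)) \<in> borel_measurable config_space" for A
  proof (rule measurable_local)
    show "local_on (\<Lambda> \<union> outer_boundary \<Lambda>) (\<lambda>y. weight \<beta> \<Lambda> (conf \<Lambda> y A))"
      unfolding local_on_def weight_def
      by (intro ballI impI arg_cong[of _ _ "\<lambda>e. exp (\<beta> * e)"] energy_cong) (auto simp: conf_def)
  qed (use assms in auto)
  have "(\<lambda>y. indicator E (conf \<Lambda> y A) :: real) \<in> borel_measurable config_space" for A
    using assms(2) by measurable
  then show ?thesis unfolding kernel_prob_def using w by measurable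
qed

text \<open>The kernels change only finitely many spins and thus neither enter nor leave
  \<open>U\<close>. So the indicator of \<open>U\<close> factors out of the DLR equation, and
  conditioning preserves it.\<close>

lemma gibbs_conditioned:
  assumes \<mu>: "\<mu> \<in> gibbs_measures \<beta>" and U: "U \<in> sets config_space" "emeasure \<mu> U \<noteq> 0"
    and tail: "\<And>y \<Lambda> A. y \<in> space config_space \<Longrightarrow> finite \<Lambda> \<Longrightarrow> conf \<Lambda> y A \<in> U \<longleftrightarrow> y \<in> U"
  shows "uniform_measure \<mu> U \<in> gibbs_measures \<beta>"
proof -
  interpret prob_space \<mu> using \<mu> by (simp add: gibbs_measures_def)
  have sets [simp]: "sets \<mu> = sets config_space" using \<mu> by (simp add: gibbs_measures_def)
  have space [simp]: "space \<mu> = space config_space" using sets_eq_imp_space_eq[OF sets] .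
  have "emeasure (uniform_measure \<mu> U) E = (\<integral>\<^sup>+ y. emeasure (ising_kernel \<beta> \<Lambda> y) E \<partial>uniform_measure \<mu> U)"
    if \<Lambda>: "finite \<Lambda>" and E: "E \<in> sets config_space" for \<Lambda> E
  proof -
    have meas: "(\<lambda>y. emeasure (ising_kernel \<beta> \<Lambda> y) E) \<in> borel_measurable \<mu>"
      using measurable_kernel_prob[OF \<Lambda> E] emeasure_ising_kernel[OF \<Lambda> _ E]
      by (subst measurable_cong[where g = "\<lambda>y. ennreal (kernel_prob \<beta> \<Lambda> y E)"]) (auto cong: measurable_cong_sets)
    have "emeasure (ising_kernel \<beta> \<Lambda> y) (U \<inter> E) = emeasure (ising_kernel \<beta> \<Lambda> y) E * indicator U y"
      if "y \<in> space \<mu>" for y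
    proof -
      have "(indicator (U \<inter> E) (conf \<Lambda> y A) :: real) = indicator E (conf \<Lambda> y A) * indicator U y" for A
        using tail[of y \<Lambda> A] that \<Lambda> by (auto simp: indicator_def)
      then have "kernel_prob \<beta> \<Lambda> y (U \<inter> E) = kernel_prob \<beta> \<Lambda> y E * indicator U y"
        by (simp add: kernel_prob_def sum_distrib_left sum_divide_distrib mult_ac)
      then show ?thesis using that \<Lambda> E U by (auto simp: emeasure_ising_kernel indicator_def)
    qed
    then have "(\<integral>\<^sup>+ y. emeasure (ising_kernel \<beta> \<Lambda> y) E * indicator U y \<partial>\<mu>) =
        (\<integral>\<^sup>+ y. emeasure (ising_kernel \<beta> \<Lambda> y) (U \<inter> E) \<partial>\<mu>)"
      by (intro nn_integral_cong) simp
    also have "\<dots> = emeasure \<mu> (U \<inter> E)"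
      using \<mu> \<Lambda> E U by (simp add: gibbs_measures_def)
    finally show ?thesis
      using U E meas by (simp add: nn_integral_uniform_measure)
  qed
  moreover have "prob_space (uniform_measure \<mu> U)"
    using U by (intro prob_space_uniform_measure) auto
  ultimately show ?thesis by (simp add: gibbs_measures_def)
qed

text \<open>Were the probability strictly between 0 and 1, conditioning on the event and on its
  complement would decompose \<mu> into two Gibbs measures. Extremality makes both equal to \<mu>,
  although one of them gives the event full mass.\<close>

lemma extremal_all_enclosed:
  assumes ext: "extremal_gibbs \<beta> \<mu>" and pos: "emeasure \<mu> all_enclosed \<noteq> 0"
  shows "emeasure \<mu> all_enclosed = 1"
proof (rule ccontr)
  assume ne: "emeasure \<mu> all_enclosed \<noteq> 1"
  have \<mu>: "\<mu> \<in> gibbs_measures \<beta>" using ext by (simp add: extremal_gibbs_def)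
  interpret prob_space \<mu> using \<mu> by (simp add: gibbs_measures_def)
  have sets [simp]: "sets \<mu> = sets config_space" using \<mu> by (simp add: gibbs_measures_def)
  have space [simp]: "space \<mu> = space config_space" using sets_eq_imp_space_eq[OF sets] .
  define U W t where "U = all_enclosed" and "W = space config_space - U" and "t = measure \<mu> U"
  have U: "U \<in> sets config_space" and W: "W \<in> sets config_space" by (auto simp: U_def W_def)
  have t1: "t \<noteq> 0" "t \<noteq> 1" using pos ne by (auto simp: t_def U_def emeasure_eq_measure)
  moreover have "0 \<le> t" "t \<le> 1" by (auto simp: t_def)
  ultimately have t: "0 < t" "t < 1" by simp_all
  have mW: "measure \<mu> W = 1 - t" using prob_compl[of U] U by (simp add: W_def t_def)
  have "uniform_measure \<mu> U \<in> gibbs_measures \<beta>"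
    using pos U by (intro gibbs_conditioned[OF \<mu>]) (auto simp: U_def all_enclosed_conf)
  moreover have "uniform_measure \<mu> W \<in> gibbs_measures \<beta>"
    using W mW t by (intro gibbs_conditioned[OF \<mu>])
      (auto simp: emeasure_eq_measure W_def U_def all_enclosed_conf)
  moreover have "measure \<mu> E = t * measure (uniform_measure \<mu> U) E + (1 - t) * measure (uniform_measure \<mu> W) E"
    if E: "E \<in> sets config_space" for E
  proof -
    have "measure (uniform_measure \<mu> U) E = measure \<mu> (U \<inter> E) / t"
      using U E t by (subst measure_uniform_measure) (auto simp: emeasure_eq_measure t_def)
    moreover have "measure (uniform_measure \<mu> W) E = measure \<mu> (W \<inter> E) / (1 - t)"
      using W E t mW by (subst measure_uniform_measure) (auto simp: emeasure_eq_measure)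
    moreover have "measure \<mu> E = measure \<mu> (U \<inter> E) + measure \<mu> (W \<inter> E)"
    proof -
      have "E = (U \<inter> E) \<union> (W \<inter> E)" using sets.sets_into_space[OF E] by (auto simp: W_def)
      then have "measure \<mu> E = measure \<mu> ((U \<inter> E) \<union> (W \<inter> E))" by simp
      also have "\<dots> = measure \<mu> (U \<inter> E) + measure \<mu> (W \<inter> E)"
        using U W E by (intro finite_measure_Union) (auto simp: W_def)
      finally show ?thesis .
    qed
    ultimately show ?thesis using t by simp
  qed
  ultimately have "uniform_measure \<mu> U = \<mu>"
    using ext t unfolding extremal_gibbs_def by blast
  then have "measure \<mu> U = measure (uniform_measure \<mu> U) U" by simp
  also have "\<dots> = 1"
    using U t by (subst measure_uniform_measure) (auto simp: emeasure_eq_measure t_def)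
  finally show False using t by (simp add: t_def)
qed

lemma minus_phase_all_enclosed:
  assumes crit: "ereal \<beta> > critical_beta" and minus: "minus_phase \<beta> \<mu>"
  shows "emeasure \<mu> all_enclosed = 0"
proof (rule ccontr)
  assume pos: "emeasure \<mu> all_enclosed \<noteq> 0"
  \<comment> \<open>The infimum lies strictly below \<beta>, so some admissible threshold does too,
    and the phase transition holds at \<beta> itself.\<close>
  obtain b where b: "0 \<le> b" "b < ereal \<beta>" "phase_transition \<beta>"
    using crit unfolding critical_beta_def Inf_less_iff by blast
  have \<beta>: "\<beta> \<ge> 0" using b(1,2) by (metis ereal_less_eq(5) less_imp_le order_trans)
  obtain \<mu>m \<mu>p where ph: "minus_phase \<beta> \<mu>m" "plus_phase \<beta> \<mu>p" "\<mu>m \<noteq> \<mu>p" "extremal_gibbs \<beta> \<mu>m"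
    using b(3) unfolding phase_transition_def by blast
  have lim: "prob_space \<nu> \<and> sets \<nu> = sets config_space" if "ising_limit \<beta> s \<nu>" for s \<nu>
    using that by (simp add: ising_limit_def)
  \<comment> \<open>The given \<mu> is known only as a limit. Uniqueness of limits identifies it
    with the extremal Gibbs measure, which supplies the DLR equations and the zero-one law.\<close>
  have "\<mu> = \<mu>m"
  proof (rule config_measure_eqI)
    show "measure \<mu> (plus_on B) = measure \<mu>m (plus_on B)" if "finite B" for B
      using tendsto_unique[OF _ ising_limit_plus_on[OF minus _ that] ising_limit_plus_on[OF ph(1) _ that]]
      by simp
  qed (use lim minus ph in auto)
  then have ext: "extremal_gibbs \<beta> \<mu>" using ph(4) by simp
  have "\<mu> = \<mu>p"
  proof (rule config_measure_eqI)
    fix B :: "site set" assume B: "finite B"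
    show "measure \<mu> (plus_on B) = measure \<mu>p (plus_on B)"
    proof (rule antisym)
      show "measure \<mu> (plus_on B) \<le> measure \<mu>p (plus_on B)"
        by (rule minus_phase_le_plus_phase[OF minus ph(2) B \<beta>])
      show "measure \<mu>p (plus_on B) \<le> measure \<mu> (plus_on B)"
      proof (rule gibbs_all_enclosed_ge[OF _ extremal_all_enclosed[OF ext pos] B])
        show "\<mu> \<in> gibbs_measures \<beta>" using ext by (simp add: extremal_gibbs_def)
      qed (use plus_phase_le_kernel[OF ph(2) B _ \<beta>] in auto)
    qed
  qed (use lim minus ph in auto)
  then show False using ph(3) \<open>\<mu> = \<mu>m\<close> by simp
qed

section \<open>Contours\<close>

text \<open>Edges are oriented outwards, so an edge of one cut may occur reversed in another; such
  coincidences have to be excluded separately.\<close>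

definition edge_cut :: "site set \<Rightarrow> (site \<times> site) set" where
  "edge_cut I = {(i, j). i \<in> I \<and> j \<notin> I \<and> neighbors i j}"

text \<open>A coarse substitute for adjacency of dual edges: edges with endpoints in a common unit
  square are linked whatever their orientation, and an edge has at most 81 = 3^4 linked
  partners.\<close>

definition linked :: "site \<times> site \<Rightarrow> site \<times> site \<Rightarrow> bool" where
  "linked e e' \<longleftrightarrow>
     \<bar>fst (fst e) - fst (fst e')\<bar> \<le> 1 \<and> \<bar>snd (fst e) - snd (fst e')\<bar> \<le> 1 \<and>
     \<bar>fst (snd e) - fst (snd e')\<bar> \<le> 1 \<and> \<bar>snd (snd e) - snd (snd e')\<bar> \<le> 1"

definition link_rel :: "(site \<times> site) set \<Rightarrow> ((site \<times> site) \<times> (site \<times> site)) set" where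
  "link_rel C = {(e, e'). e \<in> C \<and> e' \<in> C \<and> linked e e'}"

definition contour :: "site set \<Rightarrow> bool" where
  "contour I \<longleftrightarrow> finite I \<and> (\<forall>e\<in>edge_cut I. \<forall>e'\<in>edge_cut I. (e, e') \<in> (link_rel (edge_cut I))\<^sup>*)"

lemma linked_sym: "linked e e' \<longleftrightarrow> linked e' e"
  by (auto simp: linked_def abs_minus_commute)

lemma finite_cut [simp]: "finite I \<Longrightarrow> finite (edge_cut I)"
  by (rule finite_subset[of _ "\<Union>i\<in>I. {i} \<times> {j. neighbors i j}"]) (auto simp: edge_cut_def)

section \<open>Discrete potentials and the existence of contours\<close>

lemma int_const:
  fixes f :: "int \<Rightarrow> 'a"
  assumes "\<And>b. f (b + 1) = f b" shows "f a = f b"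
proof -
  have "f a = f 0" for a
  proof (induction a rule: int_induct[where k = 0])
    case (step1 i) then show ?case using assms[of i] by simp
  next
    case (step2 i) then show ?case using assms[of "i - 1"] by simp
  qed simp
  then show ?thesis by metis
qed

text \<open>A Poincare lemma with finite support. Summing \<open>g\<close> along rows from the left
  gives the horizontal differences by construction; curl-freeness carries the vertical ones from
  column to column.\<close>

lemma finite_potential:
  fixes g :: "site \<Rightarrow> site \<Rightarrow> int"
  assumes anti: "\<And>i j. g j i = - g i j"
    and curl: "\<And>a b. g (a, b) (a + 1, b) + g (a + 1, b) (a + 1, b + 1) =
      g (a, b) (a, b + 1) + g (a, b + 1) (a + 1, b + 1)"
    and supp: "\<And>i j. g i j \<noteq> 0 \<Longrightarrow> i \<in> lattice_box N \<and> j \<in> lattice_box N"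
  obtains h where "\<And>i j. neighbors i j \<Longrightarrow> h j - h i = g i j" "\<And>i. h i \<noteq> 0 \<Longrightarrow> i \<in> lattice_box N"
proof -
  define h where "h = (\<lambda>(a, b). \<Sum>c\<in>{- int N..<a}. g (c, b) (c + 1, b))"
  have g0: "g i j = 0" if "i \<notin> lattice_box N \<or> j \<notin> lattice_box N" for i j using supp that by blast
  have hor: "h (a + 1, b) - h (a, b) = g (a, b) (a + 1, b)" for a b
  proof (cases "- int N \<le> a")
    case True
    then have "{- int N..<a + 1} = insert a {- int N..<a}" by auto
    then show ?thesis by (simp add: h_def)
  next
    case False
    then show ?thesis using g0[of "(a, b)"] by (simp add: h_def lattice_box_def)
  qed
  have ver: "h (a, b + 1) - h (a, b) = g (a, b) (a, b + 1)" for a b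
  proof (cases "- int N \<le> a")
    case False
    then show ?thesis using g0[of "(a, b)"] by (simp add: h_def lattice_box_def)
  next
    case True
    have shift: "h (a + 1, b + 1) - h (a + 1, b) - g (a + 1, b) (a + 1, b + 1) =
        h (a, b + 1) - h (a, b) - g (a, b) (a, b + 1)" for a
      using hor[of a b] hor[of a "b + 1"] curl[of a b] by simp
    \<comment> \<open>The defect of the vertical difference is the same in all columns, and in the
      column just left of the box all its terms vanish.\<close>
    have "h (a, b + 1) - h (a, b) - g (a, b) (a, b + 1) =
        h (- int N - 1, b + 1) - h (- int N - 1, b) - g (- int N - 1, b) (- int N - 1, b + 1)"
      by (rule int_const[of "\<lambda>a. h (a, b + 1) - h (a, b) - g (a, b) (a, b + 1)"]) (rule shift)
    also have "\<dots> = 0" using g0[of "(- int N - 1, b)"] by (simp add: h_def lattice_box_def)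
    finally show ?thesis by simp
  qed
  show thesis
  proof (rule that[of h])
    fix i j assume "neighbors i j"
    then have "j \<in> {(fst i + 1, snd i), (fst i - 1, snd i), (fst i, snd i + 1), (fst i, snd i - 1)}"
      using neighbors_eq by blast
    then consider "j = (fst i + 1, snd i)" | "i = (fst j + 1, snd j)" | "j = (fst i, snd i + 1)"
      | "i = (fst j, snd j + 1)" by (auto simp: prod_eq_iff)
    then show "h j - h i = g i j"
    proof cases
      case 1 then show ?thesis using hor[of "fst i" "snd i"] by simp
    next
      case 2 then show ?thesis using hor[of "fst j" "snd j"] anti[of i j] by simp
    next
      case 3 then show ?thesis using ver[of "fst i" "snd i"] by simp
    next
      case 4 then show ?thesis using ver[of "fst j" "snd j"] anti[of i j] by simp
    qed
  next
    have zero: "h (a, b) = 0" if "(a, b) \<notin> lattice_box N" for a b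
    proof (cases "int N < b \<or> b < - int N \<or> a < - int N")
      case True
      then show ?thesis
      proof (cases "a < - int N")
        case False
        then have "\<forall>c. g (c, b) (c + 1, b) = 0" using True g0 by (auto simp: lattice_box_def)
        then show ?thesis by (simp add: h_def)
      qed (simp add: h_def)
    next
      case False
      then have a: "int N < a" using that by (auto simp: lattice_box_def)
      \<comment> \<open>Right of the box \<open>h\<close> is constant along columns, and at height N
        + 1 it is a sum of zeros.\<close>
      have "h (a, b) = h (a, int N + 1)"
        using int_const[of "\<lambda>b. h (a, b)"] ver[of a] g0[of "(a, _)"] a by (auto simp: lattice_box_def)
      also have "\<dots> = 0"
        using g0[of "(_, int N + 1)"] by (simp add: h_def lattice_box_def)
      finally show ?thesis .
    qed
    then show "i \<in> lattice_box N" if "h i \<noteq> 0" for i using that by (cases i) blast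
  qed
qed

text \<open>A union \<open>C\<close> of link components of a cut is again a coboundary modulo 2: a unit square whose
  boundary meets \<open>C\<close> has all its cut edges in \<open>C\<close>, so the gradient of the indicator function
  restricted to \<open>C\<close> stays curl free.\<close>

lemma cut_component_potential:
  fixes I :: "site set"
  assumes "finite I" "C \<subseteq> edge_cut I" and closed: "\<And>e e'. e \<in> C \<Longrightarrow> e' \<in> edge_cut I \<Longrightarrow> linked e e' \<Longrightarrow> e' \<in> C"
  obtains h :: "site \<Rightarrow> int" where "finite {i. h i \<noteq> 0}"
    "\<And>i j. neighbors i j \<Longrightarrow>
       h j - h i = (if (i, j) \<in> C \<or> (j, i) \<in> C then of_bool (j \<in> I) - of_bool (i \<in> I) else 0)"
proof -
  define d :: "site \<Rightarrow> site \<Rightarrow> int" where "d i j = of_bool (j \<in> I) - of_bool (i \<in> I)" for i j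
  define g where "g i j = (if (i, j) \<in> C \<or> (j, i) \<in> C then d i j else 0)" for i j
  have "finite C" using assms(1) finite_subset[OF assms(2) finite_cut] by blast
  then have "finite (fst ` C \<union> snd ` C)" by simp
  then obtain N where N: "fst ` C \<union> snd ` C \<subseteq> lattice_box N" by (rule finite_subset_box)
  obtain h where h: "\<And>i j. neighbors i j \<Longrightarrow> h j - h i = g i j" "\<And>i. h i \<noteq> 0 \<Longrightarrow> i \<in> lattice_box N"
  proof (rule finite_potential[of g N])
    show "g j i = - g i j" for i j by (auto simp: g_def d_def)
    show "i \<in> lattice_box N \<and> j \<in> lattice_box N" if "g i j \<noteq> 0" for i j
      using that N by (force simp: g_def split: if_splits)
    show "g (a, b) (a + 1, b) + g (a + 1, b) (a + 1, b + 1) =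
      g (a, b) (a, b + 1) + g (a, b + 1) (a + 1, b + 1)" for a b
    proof -
      let ?Q = "{(a, b), (a + 1, b), (a, b + 1), (a + 1, b + 1)}"
      have lk: "linked (i, j) (i', j')" if "i \<in> ?Q" "j \<in> ?Q" "i' \<in> ?Q" "j' \<in> ?Q" for i j i' j'
      proof -
        have "a \<le> fst q \<and> fst q \<le> a + 1 \<and> b \<le> snd q \<and> snd q \<le> b + 1" if "q \<in> ?Q" for q
          using that by auto
        from this[OF that(1)] this[OF that(2)] this[OF that(3)] this[OF that(4)]
        show ?thesis unfolding linked_def fst_conv snd_conv by linarith
      qed
      have all: "g i j = d i j"
        if e: "(i', j') \<in> C" "i' \<in> ?Q" "j' \<in> ?Q" and ij: "neighbors i j" "i \<in> ?Q" "j \<in> ?Q" for i' j' i j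
      proof (cases "i \<in> I \<longleftrightarrow> j \<in> I")
        case False
        then have "(i, j) \<in> edge_cut I \<or> (j, i) \<in> edge_cut I" using ij neighbors_sym unfolding edge_cut_def by blast
        then have "(i, j) \<in> C \<or> (j, i) \<in> C" using closed[OF e(1)] lk e ij by blast
        then show ?thesis by (simp add: g_def)
      qed (simp add: g_def d_def)
      have nb: "neighbors (a, b) (a + 1, b)" "neighbors (a + 1, b) (a + 1, b + 1)"
        "neighbors (a, b) (a, b + 1)" "neighbors (a, b + 1) (a + 1, b + 1)" by (auto simp: neighbors_def)
      show ?thesis
      proof (cases "\<exists>i'\<in>?Q. \<exists>j'\<in>?Q. (i', j') \<in> C")
        case True
        then obtain i' j' where e: "(i', j') \<in> C" "i' \<in> ?Q" "j' \<in> ?Q" by blast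
        show ?thesis using all[OF e nb(1)] all[OF e nb(2)] all[OF e nb(3)] all[OF e nb(4)]
          by (simp add: d_def)
      next
        case False
        then show ?thesis by (simp add: g_def)
      qed
    qed
  qed blast
  show thesis
  proof (rule that[of h])
    show "finite {i. h i \<noteq> 0}"
      by (rule finite_subset[OF _ finite_box[of N]]) (use h(2) in blast)
  qed (simp add: h(1) g_def d_def)
qed

text \<open>Among the finite sets around \<open>K\<close> whose cut lies in that of
  \<open>K\<close>, take one with fewest cut edges. If its cut split into unlinked parts, the
  indicator of \<open>I\<close> would be a sum of two integer potentials, one changing only across
  \<open>C\<close>, the other only across the rest. Both are constant on \<open>K\<close> and sum to
  1 there, so one of them is odd on \<open>K\<close>, and the set where it is odd has a smaller
  cut.\<close>

lemma exists_contour: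
  assumes K: "finite K" and conn: "\<And>a b. a \<in> K \<Longrightarrow> b \<in> K \<Longrightarrow> (a, b) \<in> (adjacency K)\<^sup>*"
  obtains I where "contour I" "K \<subseteq> I" "edge_cut I \<subseteq> edge_cut K"
proof -
  define \<I> where "\<I> = {I. finite I \<and> K \<subseteq> I \<and> edge_cut I \<subseteq> edge_cut K}"
  have "K \<in> \<I>" using K by (simp add: \<I>_def)
  then obtain I where I: "I \<in> \<I>" and min: "\<And>J. J \<in> \<I> \<Longrightarrow> card (edge_cut I) \<le> card (edge_cut J)"
    using exists_least_iff[of "\<lambda>n. \<exists>I\<in>\<I>. card (edge_cut I) = n"] by (metis not_le)
  have finI: "finite I" and KI: "K \<subseteq> I" and cutI: "edge_cut I \<subseteq> edge_cut K" using I by (auto simp: \<I>_def)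
  have "(e0, e1) \<in> (link_rel (edge_cut I))\<^sup>*" if e: "e0 \<in> edge_cut I" "e1 \<in> edge_cut I" for e0 e1
  proof (rule ccontr)
    assume no: "(e0, e1) \<notin> (link_rel (edge_cut I))\<^sup>*"
    define C where "C = {e\<in>edge_cut I. (e0, e) \<in> (link_rel (edge_cut I))\<^sup>*}"
    have C: "e0 \<in> C" "e1 \<notin> C" "C \<subseteq> edge_cut I" using e no by (auto simp: C_def)
    have closed: "e' \<in> C" if "e \<in> C" "e' \<in> edge_cut I" "linked e e'" for e e'
    proof -
      have "(e, e') \<in> link_rel (edge_cut I)" using that C(3) by (auto simp: link_rel_def)
      then show ?thesis using that by (auto simp: C_def intro: rtrancl_into_rtrancl)
    qed
    obtain h :: "site \<Rightarrow> int" where fin: "finite {i. h i \<noteq> 0}" and h: "\<And>i j. neighbors i j \<Longrightarrow>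
       h j - h i = (if (i, j) \<in> C \<or> (j, i) \<in> C then of_bool (j \<in> I) - of_bool (i \<in> I) else 0)"
      using cut_component_potential[of I C] finI C(3) closed by metis
    have no_better: False if J: "finite J" "K \<subseteq> J" "D \<subset> edge_cut I"
      "\<And>i j. i \<in> J \<Longrightarrow> j \<notin> J \<Longrightarrow> neighbors i j \<Longrightarrow> (i, j) \<in> D \<or> (j, i) \<in> D" for J D
    proof -
      have "edge_cut J \<subseteq> D"
      proof
        fix e assume "e \<in> edge_cut J"
        then obtain i j where ij: "e = (i, j)" "i \<in> J" "j \<notin> J" "neighbors i j" by (auto simp: edge_cut_def)
        \<comment> \<open>A cut edge of \<open>J\<close> might match \<open>D\<close> only in
          reverse; then \<open>j\<close> would lie in \<open>K\<close> and hence in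
          \<open>J\<close>.\<close>
        have "(j, i) \<notin> D"
        proof
          assume "(j, i) \<in> D"
          then have "(j, i) \<in> edge_cut K" using J(3) cutI by blast
          then show False using ij(3) J(2) by (auto simp: edge_cut_def)
        qed
        then show "e \<in> D" using J(4) ij by blast
      qed
      then have "edge_cut J \<subset> edge_cut I" using J(3) by blast
      then have "card (edge_cut J) < card (edge_cut I)" using finI by (intro psubset_card_mono) auto
      moreover have "J \<in> \<I>" using J \<open>edge_cut J \<subset> edge_cut I\<close> cutI by (auto simp: \<I>_def)
      ultimately show False using min by force
    qed
    have const: "h a = h b" if "a \<in> K" "b \<in> K" for a b
      using conn[OF that]
    proof (induction rule: rtrancl_induct)
      case (step y z)
      then have "y \<in> I" "z \<in> I" "neighbors y z" using KI by (auto simp: adjacency_def)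
      then show ?case using h[of y z] step.IH by (auto split: if_splits)
    qed simp
    have odd_sum: "odd (h i) \<noteq> odd (of_bool (i \<in> I) - h i)" if "i \<in> K" for i
      using that KI by auto
    consider "\<forall>i\<in>K. odd (h i)" | "\<forall>i\<in>K. odd (of_bool (i \<in> I) - h i)"
      using const odd_sum by metis
    then show False
    proof cases
      case 1
      show False
      proof (rule no_better[of "{i. odd (h i)}" C])
        show "finite {i. odd (h i)}" by (rule finite_subset[OF _ fin]) auto
        show "(i, j) \<in> C \<or> (j, i) \<in> C" if "i \<in> {i. odd (h i)}" "j \<notin> {i. odd (h i)}" "neighbors i j" for i j
          using h[OF that(3)] that(1,2) by (auto split: if_splits)
      qed (use 1 C e in auto)
    next
      case 2
      let ?h = "\<lambda>i. of_bool (i \<in> I) - h i"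
      show False
      proof (rule no_better[of "{i. odd (?h i)}" "edge_cut I - C"])
        show "finite {i. odd (?h i)}"
          by (rule finite_subset[of _ "{i. h i \<noteq> 0} \<union> I"]) (use fin finI in auto)
        show "(i, j) \<in> edge_cut I - C \<or> (j, i) \<in> edge_cut I - C"
          if ij: "i \<in> {i. odd (?h i)}" "j \<notin> {i. odd (?h i)}" "neighbors i j" for i j
        proof -
          have "?h i \<noteq> ?h j" using ij(1,2) by (metis (no_types, lifting) mem_Collect_eq)
          then have "(i, j) \<notin> C" "(j, i) \<notin> C" "i \<in> I \<longleftrightarrow> j \<notin> I"
            using h[OF ij(3)] by (auto split: if_splits)
          then show ?thesis using ij(3) neighbors_sym unfolding edge_cut_def by blast
        qed
      qed (use 2 C e in auto)
    qed
  qed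
  then show thesis using that[of I] finI KI cutI by (simp add: contour_def)
qed

section \<open>Size and shape of cuts\<close>

lemma top_edge:
  assumes "finite I" "i \<in> I"
  obtains b where "((fst i, b), (fst i, b + 1)) \<in> edge_cut I" "snd i \<le> b"
proof -
  let ?B = "{b. (fst i, b) \<in> I}"
  have B: "finite ?B" "snd i \<in> ?B"
    using finite_subset[of ?B "snd ` I"] assms by force+
  have "(fst i, Max ?B) \<in> I" using Max_in[OF B(1)] B(2) by blast
  moreover have "(fst i, Max ?B + 1) \<notin> I" using Max_ge[OF B(1), of "Max ?B + 1"] by auto
  ultimately show thesis
    using that[of "Max ?B"] Max_ge[OF B] by (auto simp: edge_cut_def neighbors_def)
qed

lemma right_edge:
  assumes "finite I" "i \<in> I"
  obtains a where "((a, snd i), (a + 1, snd i)) \<in> edge_cut I"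
proof -
  let ?B = "{a. (a, snd i) \<in> I}"
  have B: "finite ?B" "fst i \<in> ?B"
    using finite_subset[of ?B "fst ` I"] assms by force+
  have "(Max ?B, snd i) \<in> I" using Max_in[OF B(1)] B(2) by blast
  moreover have "(Max ?B + 1, snd i) \<notin> I" using Max_ge[OF B(1), of "Max ?B + 1"] by auto
  ultimately show thesis
    using that[of "Max ?B"] by (auto simp: edge_cut_def neighbors_def)
qed

text \<open>The segment from \<open>i\<close> to the edge stays in \<open>I\<close>, so its length
  is bounded by the width of \<open>I\<close>; this locates a starting edge when contours are
  counted.\<close>

lemma left_edge:
  assumes "finite I" "i \<in> I"
  obtains d where "((fst i - int d, snd i), (fst i - int d - 1, snd i)) \<in> edge_cut I"
    "\<And>d'. d' \<le> d \<Longrightarrow> (fst i - int d', snd i) \<in> I"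
proof -
  have inj: "inj (\<lambda>d. (fst i - int d, snd i))" by (auto simp: inj_def)
  have "\<exists>d. (fst i - int d, snd i) \<notin> I"
    using finite_subset[of "range (\<lambda>d. (fst i - int d, snd i))" I] assms(1) range_inj_infinite[OF inj] by blast
  then obtain d where d: "(fst i - int d, snd i) \<notin> I" "\<And>d'. d' < d \<Longrightarrow> (fst i - int d', snd i) \<in> I"
    using exists_least_iff[of "\<lambda>d. (fst i - int d, snd i) \<notin> I"] by blast
  have "d \<noteq> 0" using d(1) assms(2) by (cases "d = 0") auto
  then obtain e where e: "d = Suc e" by (cases d) auto
  show thesis
    using that[of e] d e by (auto simp: edge_cut_def neighbors_def algebra_simps)
qed

text \<open>Each occupied column has its own top edge in the cut.\<close>

lemma card_fst_le_cut: "finite I \<Longrightarrow> card (fst ` I) \<le> card (edge_cut I)"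
proof (rule surj_card_le[of _ _ "\<lambda>e. fst (fst e)"])
  assume I: "finite I"
  show "fst ` I \<subseteq> (\<lambda>e. fst (fst e)) ` edge_cut I"
  proof
    fix a assume "a \<in> fst ` I"
    then obtain i where "i \<in> I" "a = fst i" by blast
    then show "a \<in> (\<lambda>e. fst (fst e)) ` edge_cut I" using top_edge[OF I] by (metis fst_conv imageI)
  qed
qed auto

lemma card_snd_le_cut: "finite I \<Longrightarrow> card (snd ` I) \<le> card (edge_cut I)"
proof (rule surj_card_le[of _ _ "\<lambda>e. snd (fst e)"])
  assume I: "finite I"
  show "snd ` I \<subseteq> (\<lambda>e. snd (fst e)) ` edge_cut I"
  proof
    fix a assume "a \<in> snd ` I"
    then obtain i where "i \<in> I" "a = snd i" by blast
    then show "a \<in> (\<lambda>e. snd (fst e)) ` edge_cut I"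
      using right_edge[OF I] by (metis fst_conv imageI snd_conv)
  qed
qed auto

lemma card_le_cut_square:
  assumes "finite I" shows "card I \<le> card (edge_cut I) * card (edge_cut I)"
proof -
  have "card I \<le> card (fst ` I \<times> snd ` I)"
    using assms by (intro card_mono) (auto intro: rev_image_eqI)
  also have "\<dots> \<le> card (edge_cut I) * card (edge_cut I)"
    using card_fst_le_cut[OF assms] card_snd_le_cut[OF assms] by (simp add: card_cartesian_product mult_le_mono)
  finally show ?thesis .
qed

text \<open>A top edge and a right edge are distinct. The bound 2 is what starts the sum over jumps
  at the square of exp(-2\<beta>).\<close>

lemma card_cut_ge_2:
  assumes "finite I" "i \<in> I" shows "card (edge_cut I) \<ge> 2"
proof -
  obtain b where b: "((fst i, b), (fst i, b + 1)) \<in> edge_cut I" using top_edge[OF assms] by blast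
  obtain a where a: "((a, snd i), (a + 1, snd i)) \<in> edge_cut I" using right_edge[OF assms] by blast
  have "card {((fst i, b), (fst i, b + 1)), ((a, snd i), (a + 1, snd i))} \<le> card (edge_cut I)"
    using a b assms(1) by (intro card_mono) auto
  then show ?thesis by simp
qed

text \<open>At a rightmost site of the symmetric difference, the right neighbour belongs to both
  sets or to neither, so the edge joining them lies, in one orientation, in exactly one of the cuts.
  Contours can thus be counted through their cuts.\<close>

lemma cut_inject:
  assumes "finite I" "finite J" "edge_cut I = edge_cut J" shows "I = J"
proof (rule ccontr)
  let ?D = "(I - J) \<union> (J - I)"
  assume "I \<noteq> J"
  then have D: "finite ?D" "?D \<noteq> {}" using assms by auto
  obtain i where i: "i \<in> ?D" "\<And>j. j \<in> ?D \<Longrightarrow> fst j \<le> fst i"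
  proof -
    have "Max (fst ` ?D) \<in> fst ` ?D" using D by (intro Max_in) auto
    then obtain i where "i \<in> ?D" "Max (fst ` ?D) = fst i" by (rule imageE)
    then show thesis using that[of i] Max_ge[of "fst ` ?D"] D(1) by simp
  qed
  let ?j = "(fst i + 1, snd i)"
  have "?j \<notin> ?D" using i(2)[of ?j] by auto
  moreover have "neighbors i ?j" "neighbors ?j i" by (auto simp: neighbors_def)
  moreover have "(i, ?j) \<in> edge_cut I \<longleftrightarrow> (i, ?j) \<in> edge_cut J" "(?j, i) \<in> edge_cut I \<longleftrightarrow> (?j, i) \<in> edge_cut J"
    using assms(3) by simp_all
  ultimately show False using i(1) unfolding edge_cut_def by blast
qed

section \<open>Counting contours\<close>

definition walks :: "nat \<Rightarrow> site \<times> site \<Rightarrow> (site \<times> site) list set" where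
  "walks m e = {w. length w = Suc m \<and> hd w = e \<and> successively linked w}"

lemma linked_subset:
  "{e'. linked e e'} \<subseteq> ({fst (fst e) - 1..fst (fst e) + 1} \<times> {snd (fst e) - 1..snd (fst e) + 1}) \<times>
    ({fst (snd e) - 1..fst (snd e) + 1} \<times> {snd (snd e) - 1..snd (snd e) + 1})"
  by (auto simp: linked_def)

lemma finite_linked: "finite {e'. linked e e'}"
  by (rule finite_subset[OF linked_subset]) simp

lemma card_linked: "card {e'. linked e e'} \<le> 81"
  using card_mono[OF _ linked_subset[of e]] by simp

lemma walks_Suc: "walks (Suc m) e = (\<Union>e'\<in>{e'. linked e e'}. (#) e ` walks m e')"
proof (intro equalityI subsetI)
  fix w assume w: "w \<in> walks (Suc m) e"
  then obtain w' where w': "w = e # w'" by (cases w) (auto simp: walks_def)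
  moreover obtain e' v where "w' = e' # v" using w w' by (cases w') (auto simp: walks_def)
  ultimately show "w \<in> (\<Union>e'\<in>{e'. linked e e'}. (#) e ` walks m e')"
    using w by (auto simp: walks_def image_iff)
next
  fix w assume "w \<in> (\<Union>e'\<in>{e'. linked e e'}. (#) e ` walks m e')"
  then obtain w' where "w = e # w'" "length w' = Suc m" "linked e (hd w')" "successively linked w'"
    by (auto simp: walks_def)
  then show "w \<in> walks (Suc m) e" by (cases w') (auto simp: walks_def)
qed

lemma card_walks: "finite (walks m e) \<and> card (walks m e) \<le> 81 ^ m"
proof (induction m arbitrary: e)
  case 0
  have "walks 0 e = {[e]}" by (auto simp: walks_def length_Suc_conv)
  then show ?case by simp
next
  case (Suc m)
  have "card (walks (Suc m) e) \<le> (\<Sum>e'\<in>{e'. linked e e'}. card ((#) e ` walks m e'))"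
    unfolding walks_Suc by (rule card_UN_le[OF finite_linked])
  also have "\<dots> \<le> (\<Sum>e'\<in>{e'. linked e e'}. 81 ^ m)"
    using Suc by (intro sum_mono order_trans[OF card_image_le]) auto
  also have "\<dots> \<le> 81 * 81 ^ m" using card_linked[of e] by simp
  finally show ?case using Suc finite_linked by (auto simp: walks_Suc)
qed

text \<open>A connected set is covered by a closed walk traversing a spanning tree: every new element is
  inserted as a detour of length two.\<close>

lemma connected_covering_walk:
  assumes C: "finite C" "e0 \<in> C" and conn: "\<And>e. e \<in> C \<Longrightarrow> (e0, e) \<in> (link_rel C)\<^sup>*"
  shows "\<exists>w\<in>walks (2 * (card C - 1)) e0. set w = C"
proof -
  have "\<exists>w\<in>walks (2 * k) e0. set w \<subseteq> C \<and> card (set w) = Suc k" if "Suc k \<le> card C" for k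
    using that
  proof (induction k)
    case 0
    then show ?case using C(2) by (intro bexI[of _ "[e0]"]) (auto simp: walks_def)
  next
    case (Suc k)
    then obtain w where w: "w \<in> walks (2 * k) e0" "set w \<subseteq> C" "card (set w) = Suc k" by auto
    have e0: "e0 \<in> set w" using w(1) by (cases w) (auto simp: walks_def)
    \<comment> \<open>If no link left the visited set, connectivity from \<open>e0\<close> would
      make it all of \<open>C\<close>, against its cardinality.\<close>
    have "\<exists>s\<in>set w. \<exists>t\<in>C - set w. linked s t"
    proof (rule ccontr)
      assume no: "\<not> (\<exists>s\<in>set w. \<exists>t\<in>C - set w. linked s t)"
      have "e \<in> set w" if "(e0, e) \<in> (link_rel C)\<^sup>*" for e
        using that by (induction rule: rtrancl_induct) (use e0 no in \<open>auto simp: link_rel_def\<close>)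
      then have "set w = C" using conn w(2) by blast
      then show False using w(3) Suc.prems by simp
    qed
    then obtain s t where st: "s \<in> set w" "t \<in> C" "t \<notin> set w" "linked s t" by blast
    obtain u v where uv: "w = u @ s # v" using split_list[OF st(1)] by blast
    let ?w = "u @ s # t # s # v"
    have "?w \<in> walks (2 * Suc k) e0"
      using w(1) st(4) linked_sym[of s t] unfolding uv walks_def
      by (cases u; cases v) (auto simp: successively_append_iff successively_Cons hd_append)
    moreover have "set ?w = insert t (set w)" by (auto simp: uv)
    ultimately show ?case
      using w(2,3) st by (intro bexI[of _ ?w]) (simp_all add: card_insert_if)
  qed
  from this[of "card C - 1"] obtain w where "w \<in> walks (2 * (card C - 1)) e0" "set w \<subseteq> C"
    "card (set w) = card C"
    using C by (metis One_nat_def Suc_pred card_gt_0_iff empty_iff order_refl)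
  then show ?thesis using C(1) card_subset_eq by blast
qed

definition contours_at :: "site \<Rightarrow> nat \<Rightarrow> site set set" where
  "contours_at i n = {I. contour I \<and> i \<in> I \<and> card (edge_cut I) = n}"

text \<open>A contour around \<open>i\<close> has an edge at distance less than \<open>n\<close> to the left of \<open>i\<close>, and is covered by a
  walk of \<open>2(n - 1)\<close> steps with at most 81 choices each; \<open>6561 = 81\<^sup>2\<close>. The constants 13122 and 52488
  below come from absorbing \<open>n\<close> into \<open>2\<^sup>n\<close> and \<open>n\<^sup>3\<close> into \<open>8\<^sup>n\<close>.\<close>

lemma card_contours_at: "finite (contours_at i n) \<and> card (contours_at i n) \<le> n * 6561 ^ n"
proof -
  define e where "e d = ((fst i - int d, snd i), (fst i - int d - 1, snd i))" for d
  let ?W = "\<Union>d\<in>{..<n}. set ` walks (2 * (n - 1)) (e d)"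
  have sub: "edge_cut ` contours_at i n \<subseteq> ?W"
  proof
    fix C assume "C \<in> edge_cut ` contours_at i n"
    then obtain I where I: "C = edge_cut I" "contour I" "i \<in> I" "card (edge_cut I) = n" by (auto simp: contours_at_def)
    have finI: "finite I" using I(2) by (simp add: contour_def)
    obtain d where d: "e d \<in> edge_cut I" "\<And>d'. d' \<le> d \<Longrightarrow> (fst i - int d', snd i) \<in> I"
      using left_edge[OF finI I(3)] unfolding e_def by blast
    have "(\<lambda>d'. fst i - int d') ` {..d} \<subseteq> fst ` I" using d(2) by force
    then have "card ((\<lambda>d'. fst i - int d') ` {..d}) \<le> card (fst ` I)" using finI by (intro card_mono) auto
    \<comment> \<open>The segment occupies d + 1 columns of \<open>I\<close>, and \<open>I\<close>
      has at most n columns.\<close>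
    then have "Suc d \<le> n" using card_fst_le_cut[OF finI] I(4) by (simp add: card_image inj_on_def)
    moreover have "C \<in> set ` walks (2 * (n - 1)) (e d)"
      using connected_covering_walk[of "edge_cut I" "e d"] d(1) I finI by (auto simp: contour_def)
    ultimately show "C \<in> ?W" by auto
  qed
  have finW: "finite ?W" using card_walks by blast
  have inj: "inj_on edge_cut (contours_at i n)"
    by (intro inj_onI cut_inject) (auto simp: contours_at_def contour_def)
  have "card ?W \<le> (\<Sum>d\<in>{..<n}. card (set ` walks (2 * (n - 1)) (e d)))" by (rule card_UN_le) simp
  also have "\<dots> \<le> (\<Sum>d\<in>{..<n}. 81 ^ (2 * (n - 1)))"
    using card_walks by (intro sum_mono order_trans[OF card_image_le]) auto
  also have "\<dots> \<le> n * 6561 ^ n"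
    by (simp add: power_mult power_increasing)
  finally have "card ?W \<le> n * 6561 ^ n" .
  moreover have "card (contours_at i n) = card (edge_cut ` contours_at i n)" using inj by (simp add: card_image)
  moreover have "\<dots> \<le> card ?W" by (rule card_mono[OF finW sub])
  moreover have "finite (contours_at i n)"
    using finite_imageD[OF finite_subset[OF sub finW] inj] .
  ultimately show ?thesis by linarith
qed

text \<open>A discrete intermediate value theorem: along an adjacency path \<open>f\<close> moves by
  at most one per step and skips no integer.\<close>

lemma rtrancl_adjacency_interval:
  fixes f :: "site \<Rightarrow> int"
  assumes "(i, j) \<in> (adjacency K)\<^sup>*" "i \<in> K" and lip: "\<And>a b. neighbors a b \<Longrightarrow> \<bar>f a - f b\<bar> \<le> 1"
  shows "{min (f i) (f j)..max (f i) (f j)} \<subseteq> f ` K"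
  using assms(1)
proof (induction rule: rtrancl_induct)
  case (step y z)
  have "\<bar>f y - f z\<bar> \<le> 1" "z \<in> K" using step.hyps(2) lip by (auto simp: adjacency_def)
  then have "{min (f i) (f z)..max (f i) (f z)} \<subseteq> insert (f z) {min (f i) (f y)..max (f i) (f y)}"
    by (auto simp: min_def max_def split: if_splits)
  then show ?case using step.IH \<open>z \<in> K\<close> by blast
qed (use assms(2) in auto)

lemma connected_diameter:
  fixes f :: "site \<Rightarrow> int"
  assumes "(i, j) \<in> (adjacency K)\<^sup>*" "i \<in> K" "finite K" and lip: "\<And>a b. neighbors a b \<Longrightarrow> \<bar>f a - f b\<bar> \<le> 1"
  shows "\<bar>f i - f j\<bar> < int (card (f ` K))"
proof -
  have "card {min (f i) (f j)..max (f i) (f j)} \<le> card (f ` K)"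
    using rtrancl_adjacency_interval[of i j K f, OF assms(1,2) lip] assms(3) by (intro card_mono) simp_all
  then show ?thesis by (auto simp: min_def max_def split: if_splits)
qed

text \<open>A connected \<open>K\<close> extends in each coordinate by less than its number of
  columns or rows, hence by less than the cut size of any finite \<open>I\<close> around it.\<close>

lemma connected_subset_box:
  assumes conn: "\<And>j. j \<in> K \<Longrightarrow> (i, j) \<in> (adjacency K)\<^sup>*" and "i \<in> K" "K \<subseteq> I" "finite I" "i \<in> lattice_box r"
  shows "K \<subseteq> lattice_box (r + card (edge_cut I))"
proof
  fix j assume j: "j \<in> K"
  have finK: "finite K" using assms finite_subset by blast
  have "card (fst ` K) \<le> card (fst ` I)" "card (snd ` K) \<le> card (snd ` I)"
    using assms(3,4) by (auto intro!: card_mono)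
  then have "int (card (fst ` K)) \<le> card (edge_cut I)" "int (card (snd ` K)) \<le> card (edge_cut I)"
    using card_fst_le_cut[OF assms(4)] card_snd_le_cut[OF assms(4)] by simp_all
  moreover have "\<bar>fst i - fst j\<bar> < int (card (fst ` K))" "\<bar>snd i - snd j\<bar> < int (card (snd ` K))"
    by (rule connected_diameter[OF conn[OF j] assms(2) finK]; simp add: neighbors_def)+
  ultimately show "j \<in> lattice_box (r + card (edge_cut I))"
    using assms(5) by (cases i; cases j) (auto simp: lattice_box_def)
qed

section \<open>The Peierls bound and the plus phase\<close>

definition flip :: "site set \<Rightarrow> config \<Rightarrow> config" where
  "flip I z i = (if i \<in> I then - z i else z i)"

definition disagree :: "site set \<Rightarrow> config \<Rightarrow> bool" where
  "disagree I z \<longleftrightarrow> (\<forall>(i, j)\<in>edge_cut I. z i \<noteq> z j)"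

definition edge_disjoint :: "site set \<Rightarrow> site set \<Rightarrow> bool" where
  "edge_disjoint I J \<longleftrightarrow> (\<forall>(i, j)\<in>edge_cut I. (i, j) \<notin> edge_cut J \<and> (j, i) \<notin> edge_cut J)"

text \<open>Exactly the bonds of the cut change sign, from -1 to +1 by disagreement. Each gains 2,
  counted in both orders and then halved.\<close>

lemma energy_flip:
  assumes "finite \<Lambda>" "I \<subseteq> \<Lambda>" and z: "z \<in> space config_space" and dis: "disagree I z"
  shows "energy \<Lambda> (flip I z) = energy \<Lambda> z + 2 * real (card (edge_cut I))"
proof -
  let ?C = "edge_cut I \<union> prod.swap ` edge_cut I"
  let ?f = "\<lambda>z (i, j). real_of_int (z i * z j)"
  have finC: "finite (edge_cut I)" using finite_subset[OF assms(2,1)] by simp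
  have sub: "?C \<subseteq> incident \<Lambda>"
    using assms(2) neighbors_sym by (auto simp: edge_cut_def incident_def)
  have eq: "?f (flip I z) e = ?f z e + (if e \<in> ?C then 2 else 0)" if "e \<in> incident \<Lambda>" for e
  proof -
    obtain i j where e: "e = (i, j)" by (cases e)
    have nb: "neighbors i j" using that e by (simp add: incident_def)
    have "(i, j) \<in> prod.swap ` edge_cut I \<longleftrightarrow> (j, i) \<in> edge_cut I"
      by (auto intro!: image_eqI[of _ prod.swap "(j, i)"])
    then have mem: "e \<in> ?C \<longleftrightarrow> (i \<in> I) \<noteq> (j \<in> I)"
      using nb neighbors_sym[of i j] by (auto simp: e edge_cut_def)
    show ?thesis
    proof (cases "e \<in> ?C")
      case True
      then have "(i, j) \<in> edge_cut I \<or> (j, i) \<in> edge_cut I" by (auto simp: e)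
      then have "z i \<noteq> z j" using dis by (auto simp: disagree_def)
      then have "z i * z j = -1" using spin_cases[OF z, of i] spin_cases[OF z, of j] by auto
      moreover have "flip I z i * flip I z j = - (z i * z j)" using True mem by (auto simp: flip_def)
      ultimately have "?f z e = -1" "?f (flip I z) e = 1" by (simp_all only: e prod.case)
      then show ?thesis using True by simp
    next
      case False
      then have "flip I z i * flip I z j = z i * z j" using mem by (auto simp: flip_def)
      then show ?thesis using False by (simp only: e prod.case if_False)
    qed
  qed
  have "sum (?f (flip I z)) (incident \<Lambda>) = (\<Sum>e\<in>incident \<Lambda>. ?f z e + (if e \<in> ?C then 2 else 0))"
    by (rule sum.cong[OF refl eq])
  also have "\<dots> = sum (?f z) (incident \<Lambda>) + (\<Sum>e\<in>incident \<Lambda>. if e \<in> ?C then 2 else 0)"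
    by (rule sum.distrib)
  also have "(\<Sum>e\<in>incident \<Lambda>. if e \<in> ?C then 2 else 0 :: real) = (\<Sum>e\<in>?C. 2)"
    using sub assms(1) by (intro sum.mono_neutral_cong_right) auto
  also have "\<dots> = 2 * real (card ?C)" by simp
  also have "card ?C = card (edge_cut I) + card (prod.swap ` edge_cut I)"
    using finC by (intro card_Un_disjoint) (auto simp: edge_cut_def)
  also have "card (prod.swap ` edge_cut I) = card (edge_cut I)"
    by (simp add: card_image)
  finally show ?thesis by (simp add: energy_def)
qed

text \<open>Flipping \<open>I\<close> is a bijection of the configurations in \<Lambda>, namely
  symmetric difference with \<open>I\<close> on plus sets, and every configuration in
  \<open>S\<close> has the same weight ratio to its image.\<close>

lemma kernel_prob_flip:
  assumes "finite \<Lambda>" "I \<subseteq> \<Lambda>" and y: "y \<in> space config_space"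
    and S: "\<And>z. z \<in> S \<Longrightarrow> z \<in> space config_space \<Longrightarrow> disagree I z \<and> flip I z \<in> S'"
  shows "kernel_prob \<beta> \<Lambda> y S \<le> exp (- 2 * \<beta> * card (edge_cut I)) * kernel_prob \<beta> \<Lambda> y S'"
proof -
  let ?g = "\<lambda>A. (A - I) \<union> (I - A)"
  let ?w = "\<lambda>A. weight \<beta> \<Lambda> (conf \<Lambda> y A)"
  have bij: "bij_betw ?g (Pow \<Lambda>) (Pow \<Lambda>)"
    by (rule bij_betwI[where g = ?g]) (use assms(2) in auto)
  have conf: "conf \<Lambda> y (?g A) = flip I (conf \<Lambda> y A)" for A
    using assms(2) by (auto simp: conf_def flip_def pattern_def fun_eq_iff)
  have "(\<Sum>A\<in>Pow \<Lambda>. ?w A * indicator S (conf \<Lambda> y A)) \<le>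
      (\<Sum>A\<in>Pow \<Lambda>. exp (- 2 * \<beta> * card (edge_cut I)) * (?w (?g A) * indicator S' (conf \<Lambda> y (?g A))))"
  proof (rule sum_mono)
    fix A
    show "?w A * indicator S (conf \<Lambda> y A) \<le>
        exp (- 2 * \<beta> * card (edge_cut I)) * (?w (?g A) * indicator S' (conf \<Lambda> y (?g A)))"
    proof (cases "conf \<Lambda> y A \<in> S")
      case True
      then have d: "disagree I (conf \<Lambda> y A)" "flip I (conf \<Lambda> y A) \<in> S'" using S y by auto
      have "?w (?g A) = exp (2 * \<beta> * card (edge_cut I)) * ?w A"
        unfolding conf weight_def energy_flip[OF assms(1,2) conf_space[OF y] d(1)]
        by (simp add: algebra_simps flip: exp_add)
      then show ?thesis using True d(2) by (simp add: conf flip: exp_add)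
    qed simp
  qed
  also have "\<dots> = exp (- 2 * \<beta> * card (edge_cut I)) * (\<Sum>A\<in>Pow \<Lambda>. ?w A * indicator S' (conf \<Lambda> y A))"
    unfolding sum_distrib_left[symmetric]
    by (subst sum.reindex_bij_betw[OF bij, of "\<lambda>A. ?w A * indicator S' (conf \<Lambda> y A)"]) simp
  finally show ?thesis
    unfolding kernel_prob_def times_divide_eq_right
    using partition_function_pos[OF assms(1), of \<beta> y] by (intro divide_right_mono) auto
qed

definition disagree_all :: "site set list \<Rightarrow> config set" where
  "disagree_all Is = {z \<in> space config_space. \<forall>I\<in>set Is. disagree I z}"

text \<open>Flipping \<open>I\<close> alters no relation across a cut that is edge-disjoint from its
  own, so the Peierls estimate iterates along the list. The contours may be nested.\<close>

lemma kernel_prob_disagree_all: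
  assumes "finite \<Lambda>" "y \<in> space config_space" "\<And>I. I \<in> set Is \<Longrightarrow> I \<subseteq> \<Lambda>"
    and "sorted_wrt edge_disjoint Is"
  shows "kernel_prob \<beta> \<Lambda> y (disagree_all Is) \<le> exp (- 2 * \<beta> * (\<Sum>I\<leftarrow>Is. card (edge_cut I)))"
  using assms(3,4)
proof (induction Is)
  case Nil
  have "kernel_prob \<beta> \<Lambda> y (disagree_all []) = 1"
    using assms(2) partition_function_pos[OF assms(1), of \<beta> y] by (simp add: kernel_prob_def disagree_all_def)
  then show ?case by simp
next
  case (Cons I Is)
  have "kernel_prob \<beta> \<Lambda> y (disagree_all (I # Is)) \<le>
      exp (- 2 * \<beta> * card (edge_cut I)) * kernel_prob \<beta> \<Lambda> y (disagree_all Is)"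
  proof (rule kernel_prob_flip[OF assms(1) _ assms(2)])
    show "I \<subseteq> \<Lambda>" using Cons.prems(1) by simp
    fix z assume z: "z \<in> disagree_all (I # Is)" "z \<in> space config_space"
    have "disagree J (flip I z)" if J: "J \<in> set Is" for J
      unfolding disagree_def
    proof (intro ballI, clarify)
      fix i j assume ij: "(i, j) \<in> edge_cut J" and eq: "flip I z i = flip I z j"
      have "edge_disjoint I J" using Cons.prems(2) J by simp
      then have "(i, j) \<notin> edge_cut I" "(j, i) \<notin> edge_cut I" using ij by (auto simp: edge_disjoint_def)
      then have "i \<in> I \<longleftrightarrow> j \<in> I" using ij neighbors_sym unfolding edge_cut_def by blast
      moreover have "z i \<noteq> z j" using z(1) J ij by (auto simp: disagree_all_def disagree_def)
      ultimately show False using eq by (auto simp: flip_def split: if_splits)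
    qed
    moreover have "flip I z \<in> space config_space"
      using spin_cases[OF z(2)] by (fastforce simp: space_config_space flip_def)
    ultimately show "disagree I z \<and> flip I z \<in> disagree_all Is"
      using z by (simp add: disagree_all_def)
  qed
  also have "\<dots> \<le> exp (- 2 * \<beta> * card (edge_cut I)) * exp (- 2 * \<beta> * (\<Sum>I\<leftarrow>Is. card (edge_cut I)))"
    using Cons by (intro mult_left_mono) auto
  finally show ?case by (simp add: algebra_simps flip: exp_add)
qed

lemma local_disagree_all:
  "local_on (\<Union>I\<in>set Is. I \<union> outer_boundary I) (\<lambda>z. \<forall>I\<in>set Is. disagree I z)"
  unfolding local_on_def
proof (intro ballI impI)
  fix x y :: config assume eq: "\<forall>i\<in>\<Union>I\<in>set Is. I \<union> outer_boundary I. x i = y i"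
  have "disagree I x \<longleftrightarrow> disagree I y" if "I \<in> set Is" for I
  proof -
    have "x i = y i \<and> x j = y j" if "(i, j) \<in> edge_cut I" for i j
      using that eq \<open>I \<in> set Is\<close> by (auto simp: edge_cut_def outer_boundary_def)
    then show ?thesis unfolding disagree_def by (metis (mono_tags, lifting) case_prod_conv prod.exhaust)
  qed
  then show "(\<forall>I\<in>set Is. disagree I x) = (\<forall>I\<in>set Is. disagree I y)" by blast
qed

lemma sets_disagree_all:
  "(\<And>I. I \<in> set Is \<Longrightarrow> finite I) \<Longrightarrow> disagree_all Is \<in> sets config_space"
  unfolding disagree_all_def by (rule sets_local[OF _ local_disagree_all]) auto

lemma plus_phase_disagree_all:
  assumes \<mu>: "plus_phase \<beta> \<mu>" and fin: "\<And>I. I \<in> set Is \<Longrightarrow> finite I" and "sorted_wrt edge_disjoint Is"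
  shows "measure \<mu> (disagree_all Is) \<le> exp (- 2 * \<beta> * (\<Sum>I\<leftarrow>Is. card (edge_cut I)))"
proof (rule tendsto_upperbound)
  show "((\<lambda>\<Lambda>. kernel_prob \<beta> \<Lambda> (\<lambda>_. 1) (disagree_all Is)) \<longlongrightarrow> measure \<mu> (disagree_all Is))
      (finite_subsets_at_top UNIV)"
    unfolding disagree_all_def
    by (rule ising_limit_local[OF \<mu> _ _ local_disagree_all]) (use fin in auto)
  have "finite (\<Union>(set Is))" using fin by auto
  then show "\<forall>\<^sub>F \<Lambda> in finite_subsets_at_top UNIV.
      kernel_prob \<beta> \<Lambda> (\<lambda>_. 1) (disagree_all Is) \<le> exp (- 2 * \<beta> * (\<Sum>I\<leftarrow>Is. card (edge_cut I)))"
    by (rule eventually_mono[OF eventually_finite_subsets])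
       (intro kernel_prob_disagree_all assms(3) const_space; auto)
qed auto

lemma kernel_prob_UN_le:
  assumes "finite \<Lambda>" "finite T" and sub: "\<And>A. A \<subseteq> \<Lambda> \<Longrightarrow> conf \<Lambda> y A \<in> S \<Longrightarrow> \<exists>t\<in>T. conf \<Lambda> y A \<in> R t"
  shows "kernel_prob \<beta> \<Lambda> y S \<le> (\<Sum>t\<in>T. kernel_prob \<beta> \<Lambda> y (R t))"
proof -
  let ?w = "\<lambda>A. weight \<beta> \<Lambda> (conf \<Lambda> y A)"
  have "(\<Sum>A\<in>Pow \<Lambda>. ?w A * indicator S (conf \<Lambda> y A)) \<le>
      (\<Sum>A\<in>Pow \<Lambda>. \<Sum>t\<in>T. ?w A * indicator (R t) (conf \<Lambda> y A))"
  proof (rule sum_mono)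
    fix A assume A: "A \<in> Pow \<Lambda>"
    show "?w A * indicator S (conf \<Lambda> y A) \<le> (\<Sum>t\<in>T. ?w A * indicator (R t) (conf \<Lambda> y A))"
    proof (cases "conf \<Lambda> y A \<in> S")
      case True
      then obtain t where t: "t \<in> T" "conf \<Lambda> y A \<in> R t" using sub A by blast
      then have "?w A * indicator (R t) (conf \<Lambda> y A) \<le> (\<Sum>t\<in>T. ?w A * indicator (R t) (conf \<Lambda> y A))"
        using assms(2) by (intro member_le_sum) auto
      then show ?thesis using t True by simp
    qed (auto intro: sum_nonneg)
  qed
  also have "\<dots> = (\<Sum>t\<in>T. \<Sum>A\<in>Pow \<Lambda>. ?w A * indicator (R t) (conf \<Lambda> y A))" by (rule sum.swap)
  finally show ?thesis
    unfolding kernel_prob_def sum_divide_distrib[symmetric]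
    using partition_function_pos[OF assms(1), of \<beta> y] by (intro divide_right_mono) auto
qed

section \<open>Islands of minus spins in the plus phase\<close>

definition minus_sites :: "config \<Rightarrow> site set" where
  "minus_sites x = {i. x i = -1}"

lemma cut_cluster:
  assumes "x \<in> space config_space" "a \<in> minus_sites x" "(i, j) \<in> edge_cut (cluster (minus_sites x) a)"
  shows "i \<in> cluster (minus_sites x) a" "x i = -1" "x j = 1"
proof -
  show i: "i \<in> cluster (minus_sites x) a" using assms(3) by (simp add: edge_cut_def)
  then show "x i = -1" using cluster_subset[OF assms(2)] by (auto simp: minus_sites_def)
  have "j \<notin> minus_sites x" using cluster_step[OF i assms(2)] assms(3) unfolding edge_cut_def by blast
  then show "x j = 1" using spin_cases[OF assms(1), of j] by (simp add: minus_sites_def)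
qed

text \<open>A path of minus sites starting in the enclosing set cannot cross its plus outer
  boundary.\<close>

lemma enclosed_cluster_finite:
  assumes "enclosed i x" "i \<in> minus_sites x" shows "finite (cluster (minus_sites x) i)"
proof -
  obtain L where L: "finite L" "i \<in> L" "\<forall>j\<in>outer_boundary L. x j = 1" using assms(1) by (auto simp: enclosed_def)
  have "j \<in> L" if "(i, j) \<in> (adjacency (minus_sites x))\<^sup>*" for j
    using that
  proof (induction rule: rtrancl_induct)
    case (step y z)
    then have "neighbors y z" "x z = -1" by (auto simp: adjacency_def minus_sites_def)
    then show ?case using step.IH L(3) by (force simp: outer_boundary_def)
  qed (use L in simp)
  then show ?thesis by (intro finite_subset[OF _ L(1)]) (auto simp: cluster_def)
qed

lemma cluster_contour:
  assumes "finite (cluster A i)" "i \<in> A"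
  obtains I where "contour I" "cluster A i \<subseteq> I" "edge_cut I \<subseteq> edge_cut (cluster A i)"
  using exists_contour[OF assms(1)] cluster_connected by metis

lemma contour_disagree:
  assumes "x \<in> space config_space" "a \<in> minus_sites x" "edge_cut I \<subseteq> edge_cut (cluster (minus_sites x) a)"
  shows "disagree I x"
  unfolding disagree_def using cut_cluster[OF assms(1,2)] assms(3) by fastforce

lemma subset_box_of_cut:
  assumes "finite I" "fst ` edge_cut I \<subseteq> lattice_box N" shows "I \<subseteq> lattice_box N"
proof
  fix i assume i: "i \<in> I"
  obtain b where b: "((fst i, b), (fst i, b + 1)) \<in> edge_cut I" using top_edge[OF assms(1) i] by blast
  obtain a where a: "((a, snd i), (a + 1, snd i)) \<in> edge_cut I" using right_edge[OF assms(1) i] by blast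
  have "(fst i, b) \<in> lattice_box N" "(a, snd i) \<in> lattice_box N" using a b assms(2) by force+
  then show "i \<in> lattice_box N" by (cases i) (auto simp: lattice_box_def)
qed

lemma real_card_contours_at:
  "real (card (contours_at i n)) * exp (- 2 * \<beta> * n) \<le> (13122 * exp (- 2 * \<beta>)) ^ n"
proof -
  have "n \<le> 2 ^ n" by (simp add: less_imp_le)
  then have "n * 6561 ^ n \<le> 2 ^ n * 6561 ^ n" by simp
  then have "card (contours_at i n) \<le> 2 ^ n * 6561 ^ n"
    using card_contours_at[of i n] by linarith
  also have "\<dots> = 13122 ^ n" by (simp flip: power_mult_distrib)
  finally have "real (card (contours_at i n)) \<le> 13122 ^ n"
    by (metis of_nat_le_iff of_nat_numeral of_nat_power)
  then have "real (card (contours_at i n)) * exp (- 2 * \<beta> * n) \<le> 13122 ^ n * exp (- 2 * \<beta> * n)"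
    by (intro mult_right_mono) auto
  also have "\<dots> = (13122 * exp (- 2 * \<beta>)) ^ n"
    by (simp add: power_mult_distrib mult_ac flip: exp_of_nat_mult)
  finally show ?thesis .
qed

lemma geometric_tail_le:
  fixes q :: real
  assumes "0 \<le> q" "q < 1" shows "(\<Sum>n\<in>{M..R}. q ^ n) \<le> q ^ M / (1 - q)"
  using assms by (auto simp: sum_gp intro: divide_right_mono)

text \<open>Plus boundary conditions keep the minus cluster of \<open>i\<close> finite. If
  \<open>i\<close> lies outside the hull, the cluster must leave the box of radius r + M, and its
  extent forces the contour around it to have at least \<open>M\<close> edges. The Peierls bound is
  then summed over contour lengths.\<close>

lemma kernel_prob_not_enclosed:
  assumes \<beta>: "13122 * exp (- 2 * \<beta>) < 1" and i: "i \<in> lattice_box r"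
  shows "kernel_prob \<beta> (lattice_box N) (\<lambda>_. 1) {x \<in> space config_space. x i = -1 \<and> i \<notin> plus_hull (lattice_box (r + M)) x}
    \<le> (13122 * exp (- 2 * \<beta>)) ^ M / (1 - 13122 * exp (- 2 * \<beta>))"
proof -
  let ?q = "13122 * exp (- 2 * \<beta>)"
  let ?one = "\<lambda>_::site. 1 :: int"
  define \<I> where "\<I> n = {I\<in>contours_at i n. I \<subseteq> lattice_box N}" for n
  \<comment> \<open>All cut edges are incident to the box, so \<open>R\<close> bounds the contour
    lengths and keeps the union finite.\<close>
  define R where "R = card (incident (lattice_box N))"
  have fin: "finite (\<I> n)" for n using card_contours_at[of i n] by (simp add: \<I>_def)
  have "kernel_prob \<beta> (lattice_box N) ?one {x \<in> space config_space. x i = -1 \<and> i \<notin> plus_hull (lattice_box (r + M)) x} \<le>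
      (\<Sum>I\<in>(\<Union>n\<in>{M..R}. \<I> n). kernel_prob \<beta> (lattice_box N) ?one (disagree_all [I]))"
  proof (rule kernel_prob_UN_le)
    fix A let ?x = "conf (lattice_box N) ?one A"
    assume "?x \<in> {x \<in> space config_space. x i = -1 \<and> i \<notin> plus_hull (lattice_box (r + M)) x}"
    then have x: "?x \<in> space config_space" "?x i = -1" "i \<notin> plus_hull (lattice_box (r + M)) ?x" by auto
    define K where "K = cluster (minus_sites ?x) i"
    have iM: "i \<in> minus_sites ?x" using x by (simp add: minus_sites_def)
    have "minus_sites ?x \<subseteq> lattice_box N" by (auto simp: minus_sites_def conf_def)
    then have KN: "K \<subseteq> lattice_box N" using cluster_subset[OF iM] by (auto simp: K_def)
    then have finK: "finite K" using finite_subset[OF _ finite_box] by blast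
    obtain I where I: "contour I" "K \<subseteq> I" "edge_cut I \<subseteq> edge_cut K"
      using cluster_contour[OF finK[unfolded K_def] iM] unfolding K_def by blast
    have finI: "finite I" using I(1) by (simp add: contour_def)
    have "fst ` edge_cut I \<subseteq> fst ` edge_cut K" using I(3) by (rule image_mono)
    also have "\<dots> \<subseteq> K" by (auto simp: edge_cut_def)
    finally have "fst ` edge_cut I \<subseteq> K" .
    then have IN: "I \<subseteq> lattice_box N" using subset_box_of_cut[OF finI] KN by blast
    have iI: "i \<in> I" using I(2) by (auto simp: K_def)
    have "\<not> K \<subseteq> lattice_box (r + M)"
    proof
      assume "K \<subseteq> lattice_box (r + M)"
      then have "K \<subseteq> plus_hull (lattice_box (r + M)) ?x"
      proof (rule plus_hull_greatest)
        fix j assume "j \<in> outer_boundary K"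
        then obtain k where "(k, j) \<in> edge_cut K" by (auto simp: outer_boundary_def edge_cut_def)
        then show "?x j = 1" using cut_cluster(3)[OF x(1) iM] unfolding K_def by blast
      qed
      then show False using x(3) cluster_self[of i] unfolding K_def by blast
    qed
    moreover have "K \<subseteq> lattice_box (r + card (edge_cut I))"
      using connected_subset_box[OF _ _ I(2) finI i] cluster_connected[of i "minus_sites ?x" i]
      unfolding K_def by simp
    ultimately have "M \<le> card (edge_cut I)" using box_mono[of "r + card (edge_cut I)" "r + M"] by (meson add_le_cancel_left nat_le_linear subset_trans)
    moreover have "card (edge_cut I) \<le> R"
      unfolding R_def using IN by (intro card_mono[OF finite_incident]) (auto simp: edge_cut_def incident_def)
    ultimately have "I \<in> (\<Union>n\<in>{M..R}. \<I> n)" using I(1) IN iI by (auto simp: \<I>_def contours_at_def)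
    moreover have "?x \<in> disagree_all [I]"
      using contour_disagree[OF x(1) iM I(3)[unfolded K_def]] x(1) by (simp add: disagree_all_def)
    ultimately show "\<exists>I\<in>\<Union>n\<in>{M..R}. \<I> n. ?x \<in> disagree_all [I]" by blast
  qed (use fin in auto)
  also have "\<dots> \<le> (\<Sum>I\<in>(\<Union>n\<in>{M..R}. \<I> n). exp (- 2 * \<beta> * card (edge_cut I)))"
  proof (rule sum_mono)
    fix I assume "I \<in> (\<Union>n\<in>{M..R}. \<I> n)"
    then have "I \<subseteq> lattice_box N" by (auto simp: \<I>_def)
    then show "kernel_prob \<beta> (lattice_box N) ?one (disagree_all [I]) \<le> exp (- 2 * \<beta> * card (edge_cut I))"
      using kernel_prob_disagree_all[OF finite_box const_space, of 1 "[I]" N \<beta>] by simp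
  qed
  also have "\<dots> = (\<Sum>n\<in>{M..R}. \<Sum>I\<in>\<I> n. exp (- 2 * \<beta> * card (edge_cut I)))"
    using fin by (intro sum.UNION_disjoint) (auto simp: \<I>_def contours_at_def)
  also have "\<dots> = (\<Sum>n\<in>{M..R}. real (card (\<I> n)) * exp (- 2 * \<beta> * n))"
    by (intro sum.cong) (auto simp: \<I>_def contours_at_def)
  also have "\<dots> \<le> (\<Sum>n\<in>{M..R}. ?q ^ n)"
  proof (rule sum_mono)
    fix n
    have "real (card (\<I> n)) \<le> real (card (contours_at i n))"
      using card_contours_at[of i n] by (intro of_nat_mono card_mono) (auto simp: \<I>_def)
    then have "real (card (\<I> n)) * exp (- 2 * \<beta> * n) \<le> real (card (contours_at i n)) * exp (- 2 * \<beta> * n)"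
      by (intro mult_right_mono) auto
    then show "real (card (\<I> n)) * exp (- 2 * \<beta> * n) \<le> ?q ^ n" using real_card_contours_at[of i n \<beta>] by linarith
  qed
  also have "\<dots> \<le> ?q ^ M / (1 - ?q)"
    using \<beta> by (intro geometric_tail_le) auto
  finally show ?thesis .
qed

lemma filterlim_box: "filterlim lattice_box (finite_subsets_at_top UNIV) sequentially"
proof (rule filterlim_finite_subsets_at_top[THEN iffD2], intro allI impI)
  fix X :: "site set" assume X: "finite X \<and> X \<subseteq> UNIV"
  then obtain n where "X \<subseteq> lattice_box n" using finite_subset_box by blast
  then have "\<forall>m\<ge>n. X \<subseteq> lattice_box m" using box_mono by blast
  then show "\<forall>\<^sub>F m in sequentially. finite (lattice_box m) \<and> X \<subseteq> lattice_box m \<and> lattice_box m \<subseteq> UNIV"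
    by (auto simp: eventually_sequentially)
qed

text \<open>Not being enclosed is not a local event, but it is covered by the local event of lying
  outside a fixed hull. The bound for the latter is uniform in the volume, which grows to the
  lattice before \<open>M\<close> tends to infinity.\<close>

lemma plus_phase_minus_sites_enclosed:
  assumes \<mu>: "plus_phase \<beta> \<mu>" and \<beta>: "13122 * exp (- 2 * \<beta>) < 1"
  shows "emeasure \<mu> {x \<in> space config_space. x i = -1 \<and> \<not> enclosed i x} = 0"
proof -
  interpret prob_space \<mu> using \<mu> by (simp add: ising_limit_def)
  have sets [simp]: "sets \<mu> = sets config_space" using \<mu> by (simp add: ising_limit_def)
  obtain r where r: "i \<in> lattice_box r" using finite_subset_box[of "{i}"] by auto
  let ?q = "13122 * exp (- 2 * \<beta>)"
  let ?E = "\<lambda>M. {x \<in> space config_space. x i = -1 \<and> i \<notin> plus_hull (lattice_box (r + M)) x}"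
  let ?B = "{x \<in> space config_space. x i = -1 \<and> \<not> enclosed i x}"
  have loc: "local_on (insert i (lattice_box (r + M) \<union> outer_boundary (lattice_box (r + M))))
      (\<lambda>x. x i = -1 \<and> i \<notin> plus_hull (lattice_box (r + M)) x)" for M
    using local_plus_hull[of "lattice_box (r + M)"] unfolding local_on_def by (metis UnI2 insert_iff insert_is_Un)
  have "measure \<mu> ?B \<le> ?q ^ M / (1 - ?q)" for M
  proof -
    have "measure \<mu> ?B \<le> measure \<mu> (?E M)"
      using sets_local[OF _ loc, of M] enclosed_iff_plus_hull by (intro finite_measure_mono) auto
    also have "\<dots> \<le> ?q ^ M / (1 - ?q)"
    proof (rule tendsto_upperbound)
      show "(\<lambda>N. kernel_prob \<beta> (lattice_box N) (\<lambda>_. 1) (?E M)) \<longlonglongrightarrow> measure \<mu> (?E M)"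
        by (rule filterlim_compose[OF ising_limit_local[OF \<mu> _ _ loc] filterlim_box]) auto
    qed (use kernel_prob_not_enclosed[OF \<beta> r] in auto)
    finally show ?thesis .
  qed
  moreover have "(\<lambda>M. ?q ^ M / (1 - ?q)) \<longlonglongrightarrow> 0 / (1 - ?q)"
    using \<beta> by (intro tendsto_divide LIMSEQ_power_zero) auto
  ultimately have "measure \<mu> ?B \<le> 0"
    using LIMSEQ_le_const[of "\<lambda>M. ?q ^ M / (1 - ?q)" 0 "measure \<mu> ?B"] by auto
  then show ?thesis by (simp add: emeasure_eq_measure measure_le_0_iff)
qed


section \<open>The noise and the weight of island paths\<close>

lemma prob_space_bernoulli_field:
  assumes "0 < \<epsilon>" "\<epsilon> < 1" shows "prob_space (bernoulli_field \<epsilon>)"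
  unfolding bernoulli_field_def
proof (rule prob_space_PiM, rule prob_spaceI)
  show "emeasure (point_measure spins (\<lambda>a. ennreal (if a = -1 then \<epsilon> else 1 - \<epsilon>)))
      (space (point_measure spins (\<lambda>a. ennreal (if a = -1 then \<epsilon> else 1 - \<epsilon>)))) = 1"
    using assms by (simp add: space_point_measure emeasure_point_measure_finite spins_def flip: ennreal_plus)
qed

lemma sets_bernoulli_field [simp]: "sets (bernoulli_field \<epsilon>) = sets config_space"
  unfolding bernoulli_field_def config_space_def
  by (rule sets_PiM_cong) (simp_all add: sets_point_measure)

lemma space_bernoulli_field [simp]: "space (bernoulli_field \<epsilon>) = space config_space"
  by (rule sets_eq_imp_space_eq) simp

lemma emeasure_bernoulli_minus:
  assumes "0 < \<epsilon>" "\<epsilon> < 1" "finite T"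
  shows "emeasure (bernoulli_field \<epsilon>) {x \<in> space config_space. \<forall>t\<in>T. x t = -1} = ennreal (\<epsilon> ^ card T)"
proof -
  let ?M = "\<lambda>_::site. point_measure spins (\<lambda>a. ennreal (if a = -1 then \<epsilon> else 1 - \<epsilon>))"
  interpret product_prob_space ?M UNIV
    using assms by (intro product_prob_spaceI prob_spaceI)
      (simp add: space_point_measure emeasure_point_measure_finite spins_def flip: ennreal_plus)
  have eq: "{x \<in> space config_space. \<forall>t\<in>T. x t = -1} = prod_emb UNIV ?M T (\<Pi>\<^sub>E t\<in>T. {-1})"
    unfolding prod_emb_def vimage_def restrict_PiE_iff
    by (auto simp: space_PiM config_space_def space_point_measure)
  have "emeasure (bernoulli_field \<epsilon>) {x \<in> space config_space. \<forall>t\<in>T. x t = -1} =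
      (\<Prod>t\<in>T. emeasure (?M t) {-1})"
    unfolding bernoulli_field_def eq using assms(3)
    by (intro emeasure_PiM_emb) (auto simp: sets_point_measure spins_def)
  also have "\<dots> = ennreal (\<epsilon> ^ card T)"
    using assms by (simp add: emeasure_point_measure_finite spins_def ennreal_power)
  finally show ?thesis .
qed

definition min_config :: "config \<times> config \<Rightarrow> config" where
  "min_config \<omega> i = min (fst \<omega> i) (snd \<omega> i)"

lemma noisy_field_eq: "noisy_field \<mu> \<epsilon> = distr (\<mu> \<Otimes>\<^sub>M bernoulli_field \<epsilon>) config_space min_config"
proof -
  have "(\<lambda>(x1, x2) i. min (x1 i) (x2 i)) = min_config"
    by (auto simp: min_config_def fun_eq_iff)
  then show ?thesis by (simp add: noisy_field_def)
qed

lemma measurable_min_config [measurable]: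
  "min_config \<in> measurable (config_space \<Otimes>\<^sub>M config_space) config_space"
proof -
  let ?P = "config_space \<Otimes>\<^sub>M config_space"
  have "(\<lambda>\<omega>. min_config \<omega> i) \<in> measurable ?P (count_space spins)" for i
  proof -
    have eq: "count_space spins \<Otimes>\<^sub>M count_space spins = count_space (spins \<times> spins)"
      by (rule pair_measure_countable) (simp_all add: spins_def)
    have "(\<lambda>\<omega>. (fst \<omega> i, snd \<omega> i)) \<in> measurable ?P (count_space spins \<Otimes>\<^sub>M count_space spins)"
      by (intro measurable_Pair measurable_compose[OF measurable_fst measurable_spin]
          measurable_compose[OF measurable_snd measurable_spin])
    moreover have "(\<lambda>(a, b). min a b) \<in> measurable (count_space spins \<Otimes>\<^sub>M count_space spins) (count_space spins)"
      unfolding eq by (auto simp: spins_def)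
    ultimately have "(\<lambda>(a, b). min a b) \<circ> (\<lambda>\<omega>. (fst \<omega> i, snd \<omega> i)) \<in> measurable ?P (count_space spins)"
      by (rule measurable_comp)
    then show ?thesis by (simp add: comp_def min_config_def)
  qed
  moreover have "min_config \<in> space ?P \<rightarrow> space config_space"
  proof
    fix \<omega> assume "\<omega> \<in> space ?P"
    then have "fst \<omega> \<in> space config_space" "snd \<omega> \<in> space config_space"
      by (auto simp: space_pair_measure)
    then show "min_config \<omega> \<in> space config_space"
      unfolding space_config_space min_config_def min_def by fastforce
  qed
  ultimately show ?thesis
    unfolding config_space_def by (intro measurable_PiM_single') (auto simp: config_space_def space_PiM)
qed

lemma min_config_eq_1:
  assumes "fst \<omega> \<in> space config_space" "snd \<omega> \<in> space config_space"
  shows "min_config \<omega> i = 1 \<longleftrightarrow> fst \<omega> i = 1 \<and> snd \<omega> i = 1"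
  using spin_cases[OF assms(1), of i] spin_cases[OF assms(2), of i] by (auto simp: min_config_def)

text \<open>\<open>island_path k p s Is T\<close> is the event that there is a path of \<open>k\<close> further rounds from \<open>s\<close>,
  coming from \<open>p\<close>. A round moves to a fresh site with \<open>x\<^sup>2 = -1\<close>, either directly or by jumping across
  the interior of a contour of \<open>x\<^sup>1\<close>; \<open>Is\<close> and \<open>T\<close> record the contours and sites used so far.\<close>

definition jumps :: "nat \<Rightarrow> site \<Rightarrow> site set list \<Rightarrow> site set \<Rightarrow> (site \<times> site set \<times> site \<times> site) set" where
  "jumps n s Is T = {(a, I, b, t). neighbors s a \<and> I \<in> contours_at a n \<and> b \<in> I \<and> neighbors b t \<and> t \<notin> T \<and>
     (\<forall>J\<in>set Is. edge_disjoint I J)}"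

fun island_path :: "nat \<Rightarrow> site \<Rightarrow> site \<Rightarrow> site set list \<Rightarrow> site set \<Rightarrow> (config \<times> config) set" where
  "island_path 0 p s Is T = disagree_all Is \<times> {x \<in> space config_space. \<forall>t\<in>T. x t = -1}"
| "island_path (Suc k) p s Is T =
     (\<Union>t\<in>{t. neighbors s t \<and> t \<noteq> p \<and> t \<notin> T}. island_path k s t Is (insert t T)) \<union>
     (\<Union>n. \<Union>(a, I, b, t)\<in>jumps n s Is T. island_path k b t (I # Is) (insert t T))"

text \<open>There are four entrances \<open>a\<close>, at most n * 6561^n contours, at most n^2
  exits \<open>b\<close> and four targets \<open>t\<close>; then n^3 \<le> 8^n and 8 * 6561 =
  52488.\<close>

lemma card_jumps:
  "finite (jumps n s Is T) \<and> card (jumps n s Is T) \<le> 16 * 52488 ^ n"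
proof -
  let ?J = "SIGMA a:{a. neighbors s a}. SIGMA I:contours_at a n. SIGMA b:I. {t. neighbors b t}"
  have sub: "jumps n s Is T \<subseteq> ?J" by (auto simp: jumps_def)
  have finI: "finite I" and cardI: "card I \<le> n * n" if "I \<in> contours_at a n" for I a
    using that card_le_cut_square[of I] by (auto simp: contours_at_def contour_def)
  have fin: "finite ?J" using finI card_contours_at by (intro finite_SigmaI) auto
  have c1: "card (SIGMA b:I. {t. neighbors b t}) \<le> 4 * (n * n)" if "I \<in> contours_at a n" for I a
    using finI[OF that] cardI[OF that] by (simp add: card_SigmaI card_neighbors)
  have c2: "card (SIGMA I:contours_at a n. SIGMA b:I. {t. neighbors b t}) \<le> n * 6561 ^ n * (4 * (n * n))" for a
  proof -
    have "card (SIGMA I:contours_at a n. SIGMA b:I. {t. neighbors b t}) =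
        (\<Sum>I\<in>contours_at a n. card (SIGMA b:I. {t. neighbors b t}))"
      using finI card_contours_at by (intro card_SigmaI) (auto intro!: finite_SigmaI)
    also have "\<dots> \<le> (\<Sum>I\<in>contours_at a n. 4 * (n * n))" using c1 by (intro sum_mono) auto
    also have "\<dots> \<le> n * 6561 ^ n * (4 * (n * n))"
      using card_contours_at[of a n] by (simp del: mult.assoc)
    finally show ?thesis .
  qed
  have "card ?J = (\<Sum>a\<in>{a. neighbors s a}. card (SIGMA I:contours_at a n. SIGMA b:I. {t. neighbors b t}))"
    using finI card_contours_at by (intro card_SigmaI) (auto intro!: finite_SigmaI)
  also have "\<dots> \<le> (\<Sum>a\<in>{a. neighbors s a}. n * 6561 ^ n * (4 * (n * n)))" using c2 by (intro sum_mono)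
  also have "\<dots> = 16 * (n * n * n * 6561 ^ n)" by (simp add: card_neighbors)
  also have "\<dots> \<le> 16 * (2 ^ n * 2 ^ n * 2 ^ n * 6561 ^ n)"
    by (intro mult_le_mono) (auto simp: less_imp_le)
  also have "(2 ^ n * 2 ^ n * 2 ^ n * 6561 ^ n :: nat) = 52488 ^ n" by (simp flip: power_mult_distrib)
  finally show ?thesis using card_mono[OF fin sub] finite_subset[OF sub fin] by linarith
qed

lemma jumps_small: "n < 2 \<Longrightarrow> jumps n s Is T = {}"
  using card_cut_ge_2 by (fastforce simp: jumps_def contours_at_def contour_def)

lemma card_neighbors_other: "neighbors s p \<Longrightarrow> card {t. neighbors s t \<and> t \<noteq> p} = 3"
proof -
  assume "neighbors s p"
  moreover have "{t. neighbors s t \<and> t \<noteq> p} = {t. neighbors s t} - {p}" by auto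
  ultimately show ?thesis using card_neighbors[of s] by simp
qed

definition contour_weight :: "real \<Rightarrow> site set list \<Rightarrow> real" where
  "contour_weight \<beta> Is = exp (- 2 * \<beta> * (\<Sum>I\<leftarrow>Is. card (edge_cut I)))"

lemma contour_weight_Cons: "contour_weight \<beta> (I # Is) = exp (- 2 * \<beta> * card (edge_cut I)) * contour_weight \<beta> Is"
  by (simp add: contour_weight_def algebra_simps flip: exp_add)

lemma contour_weight_nonneg [simp]: "contour_weight \<beta> Is \<ge> 0"
  by (simp add: contour_weight_def)

text \<open>The price of one round: a fresh noise site costs \<epsilon> and is reached by one of
  three non-backtracking steps or by a jump; the jumps form a geometric series starting at n =
  2.\<close>

definition round_rate :: "real \<Rightarrow> real \<Rightarrow> real" where
  "round_rate \<beta> \<epsilon> = \<epsilon> * (3 + 16 * ((52488 * exp (- 2 * \<beta>))\<^sup>2 / (1 - 52488 * exp (- 2 * \<beta>))))"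

lemma geometric_sums_from_2:
  fixes c :: real
  assumes "0 \<le> c" "c < 1"
  shows "(\<lambda>n. if n < 2 then 0 else c ^ n) sums (c\<^sup>2 / (1 - c))"
proof -
  have "(\<lambda>n. c\<^sup>2 * c ^ n) sums (c\<^sup>2 * (1 / (1 - c)))"
    using assms by (intro sums_mult geometric_sums) auto
  then have "(\<lambda>n. if n + 2 < 2 then 0 else c ^ (n + 2)) sums (c\<^sup>2 / (1 - c))"
    by (simp add: power_add mult_ac power2_eq_square)
  then show ?thesis
    using sums_iff_shift[of "\<lambda>n. if n < 2 then 0 else c ^ n" 2 "c\<^sup>2 / (1 - c)"]
    by (simp add: numeral_2_eq_2)
qed

text \<open>Each round adds a site to \<open>T\<close> and possibly a contour to \<open>Is\<close>,
  so the induction runs over arbitrary records. In the base case Ising spins and noise are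
  independent: the contours are priced by the Peierls bound, the sites by powers of
  \<epsilon>.\<close>

lemma emeasure_island_path:
  assumes \<mu>: "plus_phase \<beta> \<mu>" and \<epsilon>: "0 < \<epsilon>" "\<epsilon> < 1" and c: "52488 * exp (- 2 * \<beta>) < 1"
    and "finite T" "\<And>I. I \<in> set Is \<Longrightarrow> finite I" "sorted_wrt edge_disjoint Is" "neighbors s p"
  shows "island_path k p s Is T \<in> sets (config_space \<Otimes>\<^sub>M config_space) \<and>
    emeasure (\<mu> \<Otimes>\<^sub>M bernoulli_field \<epsilon>) (island_path k p s Is T) \<le>
      ennreal (round_rate \<beta> \<epsilon> ^ k * (contour_weight \<beta> Is * \<epsilon> ^ card T))"
  using assms(5-)
proof (induction k arbitrary: p s Is T)
  case 0
  interpret \<mu>: prob_space \<mu> using \<mu> by (simp add: ising_limit_def)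
  interpret \<nu>: prob_space "bernoulli_field \<epsilon>" using prob_space_bernoulli_field[OF \<epsilon>] .
  have sets [simp]: "sets \<mu> = sets config_space" using \<mu> by (simp add: ising_limit_def)
  have s1: "disagree_all Is \<in> sets config_space" using 0 by (intro sets_disagree_all)
  have s2: "{x \<in> space config_space. \<forall>t\<in>T. x t = -1} \<in> sets config_space" using 0(1) by (rule sets_cylinder)
  have "emeasure (\<mu> \<Otimes>\<^sub>M bernoulli_field \<epsilon>) (island_path 0 p s Is T) =
      emeasure \<mu> (disagree_all Is) * ennreal (\<epsilon> ^ card T)"
    using s1 s2 emeasure_bernoulli_minus[OF \<epsilon> 0(1)] by (simp add: \<nu>.emeasure_pair_measure_Times)
  also have "\<dots> \<le> ennreal (contour_weight \<beta> Is) * ennreal (\<epsilon> ^ card T)"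
    using plus_phase_disagree_all[OF \<mu> 0(2,3)]
    by (intro mult_right_mono) (simp_all add: \<mu>.emeasure_eq_measure contour_weight_def ennreal_leI)
  finally show ?case using s1 s2 \<epsilon> by (simp add: ennreal_mult)
next
  case (Suc k)
  define P where "P = \<mu> \<Otimes>\<^sub>M bernoulli_field \<epsilon>"
  let ?c = "52488 * exp (- 2 * \<beta>)"
  let ?r = "round_rate \<beta> \<epsilon>"
  define B where "B = ?r ^ k * (contour_weight \<beta> Is * \<epsilon> ^ card T)"
  have sets_\<mu>: "sets \<mu> = sets config_space" using \<mu> by (simp add: ising_limit_def)
  have sets [simp]: "sets P = sets (config_space \<Otimes>\<^sub>M config_space)"
    unfolding P_def by (rule sets_pair_measure_cong[OF sets_\<mu> sets_bernoulli_field])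
  have r0: "?r \<ge> 0" using \<epsilon> c by (auto simp: round_rate_def)
  have B0: "B \<ge> 0" using r0 \<epsilon> by (simp add: B_def)
  define N where "N = {t. neighbors s t \<and> t \<noteq> p \<and> t \<notin> T}"
  define G1 where "G1 t = island_path k s t Is (insert t T)" for t
  define G2 where "G2 = (\<lambda>(a :: site, I, b, t). island_path k b t (I # Is) (insert t T))"
  \<comment> \<open>The predecessor \<open>p\<close> is itself a neighbour of \<open>s\<close>,
    which leaves at most three of the four directions.\<close>
  have N: "finite N" "card N \<le> 3"
    using card_mono[of "{t. neighbors s t \<and> t \<noteq> p}" N] card_neighbors_other[OF Suc.prems(4)]
      finite_subset[OF _ finite_neighbors[of s], of N]
      finite_subset[OF _ finite_neighbors[of s], of "{t. neighbors s t \<and> t \<noteq> p}"]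
    by (auto simp: N_def)
  have G1: "G1 t \<in> sets P \<and> emeasure P (G1 t) \<le> ennreal (\<epsilon> * B)" if "t \<in> N" for t
    using Suc.IH[of "insert t T" Is t s] Suc.prems that
    unfolding P_def[symmetric] by (simp add: G1_def N_def B_def neighbors_sym mult_ac)
  have G2: "G2 w \<in> sets P \<and> emeasure P (G2 w) \<le> ennreal (exp (- 2 * \<beta> * n) * (\<epsilon> * B))"
    if "w \<in> jumps n s Is T" for n w
  proof -
    obtain a I b t where w: "w = (a, I, b, t)" by (cases w)
    have I: "finite I" "card (edge_cut I) = n" "t \<notin> T" "neighbors t b" "\<forall>J\<in>set Is. edge_disjoint I J"
      using that w by (auto simp: jumps_def contours_at_def contour_def neighbors_sym)
    show ?thesis
      using Suc.IH[of "insert t T" "I # Is" t b] Suc.prems I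
      unfolding P_def[symmetric] by (auto simp: G2_def w B_def contour_weight_Cons mult_ac)
  qed
  define U where "U n = (\<Union>w\<in>jumps n s Is T. G2 w)" for n
  have U_sets: "U n \<in> sets P" for n
    unfolding U_def using card_jumps G2 by (intro sets.finite_UN) auto
  define u where "u n = (if n < 2 then 0 else ?c ^ n)" for n
  have U: "emeasure P (U n) \<le> ennreal (u n * (16 * (\<epsilon> * B)))" for n
  proof (cases "n < 2")
    case True
    then show ?thesis by (simp add: U_def jumps_small)
  next
    case False
    have "emeasure P (U n) \<le> (\<Sum>w\<in>jumps n s Is T. emeasure P (G2 w))"
      unfolding U_def using card_jumps G2 by (intro emeasure_subadditive_finite) auto
    also have "\<dots> \<le> (\<Sum>w\<in>jumps n s Is T. ennreal (exp (- 2 * \<beta> * n) * (\<epsilon> * B)))"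
      using G2 by (intro sum_mono) auto
    also have "\<dots> = ennreal (card (jumps n s Is T) * (exp (- 2 * \<beta> * n) * (\<epsilon> * B)))"
      using B0 \<epsilon> by (simp add: ennreal_mult ennreal_of_nat_eq_real_of_nat)
    also have "\<dots> \<le> ennreal (u n * (16 * (\<epsilon> * B)))"
    proof (rule ennreal_leI)
      have "real (card (jumps n s Is T)) \<le> 16 * 52488 ^ n"
        using card_jumps[of n s Is T] of_nat_mono[of "card (jumps n s Is T)" "16 * 52488 ^ n", where 'a = real]
        by simp
      then have "real (card (jumps n s Is T)) * (exp (- 2 * \<beta> * n) * (\<epsilon> * B)) \<le>
          16 * 52488 ^ n * (exp (- 2 * \<beta> * n) * (\<epsilon> * B))"
        using B0 \<epsilon> by (intro mult_right_mono) auto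
      also have "\<dots> = u n * (16 * (\<epsilon> * B))"
        using False by (simp add: u_def power_mult_distrib mult_ac flip: exp_of_nat_mult)
      finally show "real (card (jumps n s Is T)) * (exp (- 2 * \<beta> * n) * (\<epsilon> * B)) \<le> u n * (16 * (\<epsilon> * B))" .
    qed
    finally show ?thesis .
  qed
  have u_sums: "u sums (?c\<^sup>2 / (1 - ?c))"
    unfolding u_def using c by (intro geometric_sums_from_2) auto
  have u0: "u n \<ge> 0" for n by (simp add: u_def)
  have "emeasure P (\<Union>n. U n) \<le> (\<Sum>n. emeasure P (U n))"
    using U_sets by (intro emeasure_subadditive_countably) auto
  also have "\<dots> \<le> (\<Sum>n. ennreal (u n * (16 * (\<epsilon> * B))))"
    using U by (intro suminf_le) auto
  also have "\<dots> = ennreal (?c\<^sup>2 / (1 - ?c) * (16 * (\<epsilon> * B)))"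
    using u0 B0 \<epsilon> by (intro suminf_ennreal_eq sums_mult2 u_sums) auto
  finally have jump: "emeasure P (\<Union>n. U n) \<le> ennreal (?c\<^sup>2 / (1 - ?c) * (16 * (\<epsilon> * B)))" .
  have "emeasure P (\<Union>t\<in>N. G1 t) \<le> (\<Sum>t\<in>N. emeasure P (G1 t))"
    using N G1 by (intro emeasure_subadditive_finite) auto
  also have "\<dots> \<le> (\<Sum>t\<in>N. ennreal (\<epsilon> * B))" using G1 by (intro sum_mono) auto
  also have "\<dots> = ennreal (card N * (\<epsilon> * B))"
    using B0 \<epsilon> by (simp add: ennreal_mult ennreal_of_nat_eq_real_of_nat)
  also have "\<dots> \<le> ennreal (3 * (\<epsilon> * B))"
    using N(2) B0 \<epsilon> by (intro ennreal_leI mult_right_mono) auto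
  finally have step: "emeasure P (\<Union>t\<in>N. G1 t) \<le> ennreal (3 * (\<epsilon> * B))" .
  have eq: "island_path (Suc k) p s Is T = (\<Union>t\<in>N. G1 t) \<union> (\<Union>n. U n)"
    by (simp add: N_def G1_def U_def G2_def)
  have meas: "(\<Union>t\<in>N. G1 t) \<in> sets P" "(\<Union>n. U n) \<in> sets P"
    using N G1 U_sets by (auto intro!: sets.finite_UN)
  have "emeasure P (island_path (Suc k) p s Is T) \<le>
      ennreal (3 * (\<epsilon> * B)) + ennreal (?c\<^sup>2 / (1 - ?c) * (16 * (\<epsilon> * B)))"
    unfolding eq by (rule order_trans[OF emeasure_subadditive[OF meas] add_mono[OF step jump]])
  also have "\<dots> = ennreal (?r * B)"
    using B0 \<epsilon> c by (subst ennreal_plus[symmetric]) (auto simp: round_rate_def algebra_simps)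
  finally show ?case using meas unfolding eq B_def P_def[symmetric] by (simp add: mult_ac)
qed


section \<open>Long island paths in infinite clusters\<close>

text \<open>Sites where only the noise makes the minimum negative; together with the Ising minus
  sites they exhaust the minus sites of the minimum.\<close>

definition free_sites :: "config \<times> config \<Rightarrow> site set" where
  "free_sites \<omega> = {t. fst \<omega> t = 1 \<and> snd \<omega> t = -1}"

text \<open>Crossing an island counts as one step, so that a shortest path never crosses the same
  island twice.\<close>

definition round_rel :: "config \<times> config \<Rightarrow> (site \<times> site) set" where
  "round_rel \<omega> = {(s, t). s \<in> free_sites \<omega> \<and> t \<in> free_sites \<omega> \<and>
     (neighbors s t \<or> (\<exists>a\<in>minus_sites (fst \<omega>). \<exists>b\<in>cluster (minus_sites (fst \<omega>)) a. neighbors s a \<and> neighbors b t))}"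

lemma finite_round_rel_Image:
  assumes fin: "\<And>a. a \<in> minus_sites (fst \<omega>) \<Longrightarrow> finite (cluster (minus_sites (fst \<omega>)) a)"
  shows "finite (round_rel \<omega> `` {s})"
proof (rule finite_subset)
  let ?N = "{a. neighbors s a} \<inter> minus_sites (fst \<omega>)"
  show "round_rel \<omega> `` {s} \<subseteq> {t. neighbors s t} \<union>
      (\<Union>a\<in>?N. \<Union>b\<in>cluster (minus_sites (fst \<omega>)) a. {t. neighbors b t})"
    by (auto simp: round_rel_def)
  show "finite ({t. neighbors s t} \<union>
      (\<Union>a\<in>?N. \<Union>b\<in>cluster (minus_sites (fst \<omega>)) a. {t. neighbors b t}))"
    using fin by auto
qed

lemma finite_relpow_Image:
  fixes R :: "('a \<times> 'a) set"
  assumes "\<And>s. finite (R `` {s})" shows "finite ((R ^^ m) `` {s})"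
proof (induction m)
  case (Suc m)
  have "(R ^^ Suc m) `` {s} = (\<Union>t\<in>(R ^^ m) `` {s}. R `` {t})" by auto
  then show ?case using Suc assms by simp
qed simp

text \<open>Finite degrees leave only finitely many sites reachable in fewer than \<open>k\<close>
  rounds, so some site needs at least \<open>k\<close>, and a shortest path to it is translated into
  \<open>island_path\<close>. Its lack of forward chords makes the crossed islands distinct and
  their contours edge-disjoint.\<close>

lemma island_path_of_infinite:
  assumes \<omega>: "fst \<omega> \<in> space config_space" "snd \<omega> \<in> space config_space"
    and fin: "\<And>a. a \<in> minus_sites (fst \<omega>) \<Longrightarrow> finite (cluster (minus_sites (fst \<omega>)) a)"
    and s: "s \<in> free_sites \<omega>" and inf: "infinite ((round_rel \<omega>)\<^sup>* `` {s})"
  shows "\<exists>p. neighbors s p \<and> \<omega> \<in> island_path k p s [] {s}"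
proof -
  let ?R = "round_rel \<omega>"
  let ?M = "minus_sites (fst \<omega>)"
  have "\<exists>t\<in>?R\<^sup>* `` {s}. \<forall>m<k. (s, t) \<notin> ?R ^^ m"
  proof (rule ccontr)
    assume "\<not> ?thesis"
    then have "?R\<^sup>* `` {s} \<subseteq> (\<Union>m<k. (?R ^^ m) `` {s})" by blast
    moreover have "finite (\<Union>m<k. (?R ^^ m) `` {s})"
      using finite_relpow_Image[OF finite_round_rel_Image[OF fin]] by blast
    ultimately show False using inf finite_subset by blast
  qed
  then obtain t where t: "(s, t) \<in> ?R\<^sup>*" "\<And>m. m < k \<Longrightarrow> (s, t) \<notin> ?R ^^ m" by blast
  obtain n f where f: "f 0 = s" "f n = t" "\<And>i. i < n \<Longrightarrow> (f i, f (Suc i)) \<in> ?R"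
    "\<And>i j. i \<le> n \<Longrightarrow> j \<le> n \<Longrightarrow> (f i, f j) \<in> ?R \<Longrightarrow> j \<le> Suc i" "inj_on f {..n}"
    "\<And>m. (s, t) \<in> ?R ^^ m \<Longrightarrow> n \<le> m"
    using shortest_path[OF t(1)] by metis
  have "(s, t) \<in> ?R ^^ n" using f(1-3) by (auto simp: relpow_fun_conv)
  then have kn: "k \<le> n" using t(2) by (meson not_le)
  have free: "f i \<in> free_sites \<omega>" if "i \<le> n" for i
    using that f(1) f(3)[of "i - 1"] s by (cases i) (auto simp: round_rel_def)
  \<comment> \<open>The invariant: \<open>p\<close> is not visited later, and every recorded contour
    comes from an island adjacent to a path site of index below \<open>j\<close>.\<close>
  have path: "\<omega> \<in> island_path k' p (f j) Is (f ` {..j})"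
    if "j + k' \<le> n" "\<And>i. j < i \<Longrightarrow> i \<le> n \<Longrightarrow> p \<noteq> f i"
      "\<And>I. I \<in> set Is \<Longrightarrow> \<exists>i<j. \<exists>a\<in>?M. neighbors (f i) a \<and> edge_cut I \<subseteq> edge_cut (cluster ?M a)"
    for k' j p Is
    using that
  proof (induction k' arbitrary: j p Is)
    case 0
    have "fst \<omega> \<in> disagree_all Is"
      unfolding disagree_all_def using 0(3) contour_disagree[OF \<omega>(1)] \<omega>(1) by blast
    moreover have "\<forall>t\<in>f ` {..j}. snd \<omega> t = -1" using free 0(1) by (auto simp: free_sites_def)
    ultimately show ?case using \<omega>(2) by (simp add: mem_Times_iff)
  next
    case (Suc k')
    have j: "j < n" using Suc.prems(1) by simp
    have rel: "(f j, f (Suc j)) \<in> ?R" using f(3)[OF j] .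
    have fresh: "f (Suc j) \<notin> f ` {..j}"
      using inj_on_image_mem_iff[OF f(5), of "Suc j" "{..j}"] j by auto
    have T: "insert (f (Suc j)) (f ` {..j}) = f ` {..Suc j}" by (simp add: atMost_Suc)
    from rel consider "neighbors (f j) (f (Suc j))"
      | a b where "a \<in> ?M" "b \<in> cluster ?M a" "neighbors (f j) a" "neighbors b (f (Suc j))"
      by (auto simp: round_rel_def)
    then show ?case
    proof cases
      case 1
      have "\<omega> \<in> island_path k' (f j) (f (Suc j)) Is (f ` {..Suc j})"
      proof (rule Suc.IH)
        show "f j \<noteq> f i" if "Suc j < i" "i \<le> n" for i
          using inj_onD[OF f(5), of j i] that by auto
        show "\<exists>i<Suc j. \<exists>a\<in>?M. neighbors (f i) a \<and> edge_cut I \<subseteq> edge_cut (cluster ?M a)" if "I \<in> set Is" for I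
          using Suc.prems(3)[OF that] less_SucI by blast
      qed (use Suc.prems(1) in simp)
      moreover have "f (Suc j) \<noteq> p" using Suc.prems(2)[of "Suc j"] j by auto
      ultimately show ?thesis using 1 fresh unfolding island_path.simps T[symmetric] by blast
    next
      case 2
      obtain I where I: "contour I" "cluster ?M a \<subseteq> I" "edge_cut I \<subseteq> edge_cut (cluster ?M a)"
        using cluster_contour[OF fin[OF 2(1)] 2(1)] by blast
      have disj: "edge_disjoint I J" if J: "J \<in> set Is" for J
      proof -
        obtain i a' where i: "i < j" "a' \<in> ?M" "neighbors (f i) a'" "edge_cut J \<subseteq> edge_cut (cluster ?M a')"
          using Suc.prems(3)[OF J] by blast
        \<comment> \<open>A common site would merge the two islands, and \<open>f i\<close> could
          jump straight to \<open>f (Suc j)\<close>, a forward chord.\<close>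
        have no: False if "u \<in> cluster ?M a" "u \<in> cluster ?M a'" for u
        proof -
          have "b \<in> cluster ?M a'" using that 2(2) cluster_eq by metis
          then have "(f i, f (Suc j)) \<in> ?R"
            using i 2 free[of i] free[of "Suc j"] j unfolding round_rel_def by auto
          then show False using f(4)[of i "Suc j"] i(1) j by simp
        qed
        have "(u, v) \<notin> edge_cut J \<and> (v, u) \<notin> edge_cut J" if uv: "(u, v) \<in> edge_cut I" for u v
        proof -
          have u: "u \<in> cluster ?M a" "fst \<omega> v = 1"
            using cut_cluster[OF \<omega>(1) 2(1)] I(3) uv by blast+
          \<comment> \<open>A shared edge in the same orientation would give a common site; in
            reverse, \<open>v\<close> would carry both spins.\<close>
          show ?thesis using cut_cluster[OF \<omega>(1) i(2)] i(4) u no by fastforce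
        qed
        then show ?thesis unfolding edge_disjoint_def by blast
      qed
      have aI: "a \<in> I" "b \<in> I" using I(2) 2(2) cluster_self[of a] by blast+
      have jump: "(a, I, b, f (Suc j)) \<in> jumps (card (edge_cut I)) (f j) Is (f ` {..j})"
        using 2 aI I(1) fresh disj by (auto simp: jumps_def contours_at_def)
      have b: "fst \<omega> b = -1" using cluster_subset[OF 2(1)] 2(2) by (auto simp: minus_sites_def)
      have "\<omega> \<in> island_path k' b (f (Suc j)) (I # Is) (f ` {..Suc j})"
      proof (rule Suc.IH)
        \<comment> \<open>After a jump the predecessor \<open>b\<close> is an Ising minus site,
          whereas all path sites are free.\<close>
        show "b \<noteq> f i" if "Suc j < i" "i \<le> n" for i
          using b free[OF that(2)] by (auto simp: free_sites_def)
        show "\<exists>i<Suc j. \<exists>a\<in>?M. neighbors (f i) a \<and> edge_cut J \<subseteq> edge_cut (cluster ?M a)" if "J \<in> set (I # Is)" for J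
        proof (cases "J = I")
          case True
          then show ?thesis using 2 I(3) by blast
        next
          case False
          then have "J \<in> set Is" using that by simp
          then show ?thesis using Suc.prems(3) less_SucI by blast
        qed
      qed (use Suc.prems(1) in simp)
      then show ?thesis using jump unfolding island_path.simps T[symmetric] by blast
    qed
  qed
  \<comment> \<open>A fictitious predecessor for the start: a neighbour of \<open>s\<close> other
    than \<open>f 1\<close> cannot occur later, as it would give a forward chord from
    \<open>s\<close>.\<close>
  have "\<not> {p. neighbors s p} \<subseteq> {f 1}"
    using card_mono[of "{f 1}" "{p. neighbors s p}"] card_neighbors[of s] by auto
  then obtain p where p: "neighbors s p" "p \<noteq> f 1" by blast
  have "p \<noteq> f i" if i: "0 < i" "i \<le> n" for i
  proof
    assume "p = f i"
    then have "(f 0, f i) \<in> ?R" using p(1) free[of 0] free[OF i(2)] f(1) by (auto simp: round_rel_def)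
    then have "i = 1" using f(4)[of 0 i] i by simp
    then show False using p(2) \<open>p = f i\<close> by simp
  qed
  then have "\<omega> \<in> island_path k p (f 0) [] (f ` {..0})" using path[of 0 k p "[]"] kn by simp
  then show ?thesis using p(1) f(1) by auto
qed

text \<open>The finitely many boundary points that are not plus have a common finite enclosing set,
  and its union with \<open>S\<close> has a plus outer boundary.\<close>

lemma enclosed_extend:
  assumes S: "finite S" "i \<in> S" and bd: "\<And>j. j \<in> outer_boundary S \<Longrightarrow> x j = 1 \<or> enclosed j x"
  shows "enclosed i x"
proof -
  let ?B = "{j\<in>outer_boundary S. x j \<noteq> 1}"
  obtain L where L: "finite L" "?B \<subseteq> L" "\<And>j. j \<in> outer_boundary L \<Longrightarrow> x j = 1"
    using enclosedE_finite[of ?B x] bd S(1) by auto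
  have "x j = 1" if "j \<in> outer_boundary (S \<union> L)" for j
  proof -
    have "j \<notin> L" "j \<in> outer_boundary S \<or> j \<in> outer_boundary L" using that by (auto simp: outer_boundary_def)
    then show ?thesis using L(2,3) by blast
  qed
  then show ?thesis unfolding enclosed_def using S L(1) by (intro exI[of _ "S \<union> L"]) auto
qed

text \<open>A free site is enclosed by all sites reachable from it together with the islands they
  touch: a minus site on the outer boundary would belong to one of these islands or be reachable
  itself. An island of Ising minus sites then borders only on plus sites and enclosed free
  sites.\<close>

lemma all_enclosed_min_config:
  assumes \<omega>: "fst \<omega> \<in> space config_space" "snd \<omega> \<in> space config_space"
    and fin: "\<And>a. a \<in> minus_sites (fst \<omega>) \<Longrightarrow> finite (cluster (minus_sites (fst \<omega>)) a)"
    and reach: "\<And>s. s \<in> free_sites \<omega> \<Longrightarrow> finite ((round_rel \<omega>)\<^sup>* `` {s})"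
  shows "enclosed i (min_config \<omega>)"
proof -
  let ?R = "round_rel \<omega>"
  let ?M = "minus_sites (fst \<omega>)"
  have types: "min_config \<omega> j = 1 \<or> j \<in> ?M \<or> j \<in> free_sites \<omega>" for j
    using spin_cases[OF \<omega>(1), of j] spin_cases[OF \<omega>(2), of j] min_config_eq_1[OF \<omega>, of j]
    by (auto simp: minus_sites_def free_sites_def)
  have free: "enclosed s (min_config \<omega>)" if s: "s \<in> free_sites \<omega>" for s
  proof -
    define Q where "Q = ?R\<^sup>* `` {s}"
    define D where "D = Q \<union> (\<Union>q\<in>Q. \<Union>a\<in>{a. neighbors q a} \<inter> ?M. cluster ?M a)"
    have Q: "finite Q" "s \<in> Q" using reach[OF s] by (auto simp: Q_def)
    have Q_free: "q \<in> free_sites \<omega>" if "q \<in> Q" for q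
    proof -
      have "(s, q) \<in> ?R\<^sup>*" using that by (simp add: Q_def)
      then show ?thesis by (induction rule: rtrancl_induct) (use s in \<open>auto simp: round_rel_def\<close>)
    qed
    have Q_step: "t \<in> Q" if "q \<in> Q" "(q, t) \<in> ?R" for q t
      using that unfolding Q_def by (auto intro: rtrancl_into_rtrancl)
    have "finite D" using Q(1) fin by (auto simp: D_def)
    moreover have "min_config \<omega> j = 1" if j: "j \<in> outer_boundary D" for j
    proof (rule ccontr)
      assume "min_config \<omega> j \<noteq> 1"
      then have type: "j \<in> ?M \<or> j \<in> free_sites \<omega>" using types by blast
      obtain d where d: "j \<notin> D" "d \<in> D" "neighbors d j" using j unfolding outer_boundary_def by blast
      consider "d \<in> Q" | q a where "q \<in> Q" "neighbors q a" "a \<in> ?M" "d \<in> cluster ?M a"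
        using d(2) unfolding D_def by blast
      then show False
      proof cases
        case 1
        then have "j \<notin> ?M" using d(1,3) cluster_self[of j ?M] unfolding D_def by blast
        then have "j \<in> free_sites \<omega>" using type by blast
        then have "(d, j) \<in> ?R" using Q_free[OF 1] d(3) by (auto simp: round_rel_def)
        then show False using Q_step[OF 1] d(1) by (simp add: D_def)
      next
        case 2
        have "j \<notin> ?M" using cluster_step[OF 2(4,3) d(3)] 2 d(1) unfolding D_def by blast
        then have "j \<in> free_sites \<omega>" using type by blast
        then have "(q, j) \<in> ?R" using Q_free[OF 2(1)] 2 d(3) unfolding round_rel_def by blast
        then show False using Q_step[OF 2(1)] d(1) by (simp add: D_def)
      qed
    qed
    moreover have "s \<in> D" using Q(2) by (simp add: D_def)
    ultimately show ?thesis unfolding enclosed_def by blast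
  qed
  have minus: "enclosed a (min_config \<omega>)" if a: "a \<in> ?M" for a
  proof (rule enclosed_extend[OF fin[OF a]])
    fix j assume "j \<in> outer_boundary (cluster ?M a)"
    then have "j \<notin> ?M" using cluster_step[OF _ a] unfolding outer_boundary_def by blast
    then show "min_config \<omega> j = 1 \<or> enclosed j (min_config \<omega>)" using types free by blast
  qed simp
  show ?thesis
    by (rule enclosed_extend[of "{i}"]) (use types free minus in blast)+
qed

section \<open>The almost sure statements for both phases\<close>

lemma noisy_plus_phase_all_enclosed:
  assumes \<mu>: "plus_phase \<beta> \<mu>" and \<epsilon>: "0 < \<epsilon>" "\<epsilon> < 1"
    and c: "52488 * exp (- 2 * \<beta>) < 1" and rate: "round_rate \<beta> \<epsilon> < 1"
  shows "AE \<omega> in \<mu> \<Otimes>\<^sub>M bernoulli_field \<epsilon>. min_config \<omega> \<in> all_enclosed"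
proof -
  define P where "P = \<mu> \<Otimes>\<^sub>M bernoulli_field \<epsilon>"
  interpret \<mu>: prob_space \<mu> using \<mu> by (simp add: ising_limit_def)
  interpret \<nu>: prob_space "bernoulli_field \<epsilon>" using prob_space_bernoulli_field[OF \<epsilon>] .
  have sets_\<mu> [simp]: "sets \<mu> = sets config_space" using \<mu> by (simp add: ising_limit_def)
  have sets_P: "sets P = sets (config_space \<Otimes>\<^sub>M config_space)"
    unfolding P_def by (rule sets_pair_measure_cong[OF sets_\<mu> sets_bernoulli_field])
  have space_P: "space P = space config_space \<times> space config_space"
    using sets_eq_imp_space_eq[OF sets_P] by (simp add: space_pair_measure)
  let ?B = "\<lambda>i. {x \<in> space config_space. x i = -1 \<and> \<not> enclosed i x}"
  have B: "?B i \<in> sets config_space" for i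
    using sets_spin_event[of i "-1"] sets_enclosed[of i]
    by (intro sets.sets_Collect sets.sets_Collect_neg) auto
  have null1: "?B i \<times> space config_space \<in> null_sets P" for i
  proof (rule null_setsI)
    have "emeasure \<mu> (?B i) = 0" using c by (intro plus_phase_minus_sites_enclosed[OF \<mu>]) auto
    then show "emeasure P (?B i \<times> space config_space) = 0"
      unfolding P_def using B by (subst \<nu>.emeasure_pair_measure_Times) auto
    show "?B i \<times> space config_space \<in> sets P"
      unfolding sets_P using B by (intro pair_measureI) auto
  qed
  define W where "W s k = (\<Union>p\<in>{p. neighbors s p}. island_path k p s [] {s})" for s k
  have path: "island_path k p s [] {s} \<in> sets P \<and> emeasure P (island_path k p s [] {s}) \<le> ennreal (round_rate \<beta> \<epsilon> ^ k)"
    if "neighbors s p" for k p s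
  proof -
    have r0: "0 \<le> round_rate \<beta> \<epsilon>" using \<epsilon> c by (auto simp: round_rate_def)
    have "round_rate \<beta> \<epsilon> ^ k * \<epsilon> \<le> round_rate \<beta> \<epsilon> ^ k" using \<epsilon> r0 by (simp add: mult_left_le)
    then show ?thesis
      using emeasure_island_path[OF \<mu> \<epsilon> c, of "{s}" "[]" s p k] that
      unfolding P_def[symmetric] sets_P[symmetric]
      by (auto simp: contour_weight_def intro: order_trans ennreal_leI)
  qed
  have W_sets: "W s k \<in> sets P" for s k
    unfolding W_def by (rule sets.finite_UN[OF finite_neighbors]) (use path in blast)
  have W_le: "emeasure P (W s k) \<le> ennreal (4 * round_rate \<beta> \<epsilon> ^ k)" for s k
  proof -
    have "emeasure P (W s k) \<le> (\<Sum>p\<in>{p. neighbors s p}. emeasure P (island_path k p s [] {s}))"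
      unfolding W_def by (rule emeasure_subadditive_finite[OF finite_neighbors]) (use path in blast)
    also have "\<dots> \<le> (\<Sum>p\<in>{p. neighbors s p}. ennreal (round_rate \<beta> \<epsilon> ^ k))"
      using path by (intro sum_mono) auto
    also have "\<dots> = ennreal (4 * round_rate \<beta> \<epsilon> ^ k)"
      using \<epsilon> c by (simp add: card_neighbors ennreal_mult round_rate_def)
    finally show ?thesis .
  qed
  have null2: "(\<Inter>k. W s k) \<in> null_sets P" for s
  proof (rule null_setsI)
    have "(\<lambda>k. ennreal (4 * round_rate \<beta> \<epsilon> ^ k)) \<longlonglongrightarrow> ennreal (4 * 0)"
      using rate \<epsilon> c by (intro tendsto_ennrealI tendsto_mult_left LIMSEQ_power_zero) (auto simp: round_rate_def)
    moreover have "emeasure P (\<Inter>k. W s k) \<le> ennreal (4 * round_rate \<beta> \<epsilon> ^ k)" for k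
      using W_sets by (intro order_trans[OF emeasure_mono W_le[of s k]]) auto
    ultimately have "emeasure P (\<Inter>k. W s k) \<le> ennreal (4 * 0)"
      by (intro LIMSEQ_le_const) auto
    then show "emeasure P (\<Inter>k. W s k) = 0" by simp
    show "(\<Inter>k. W s k) \<in> sets P" using W_sets by (intro sets.countable_INT) (simp_all add: image_subset_iff)
  qed
  have "AE \<omega> in P. \<forall>i. \<omega> \<notin> ?B i \<times> space config_space"
    using null1 AE_not_in by (subst AE_all_countable) blast
  moreover have "AE \<omega> in P. \<forall>s. \<omega> \<notin> (\<Inter>k. W s k)"
    using null2 AE_not_in by (subst AE_all_countable) blast
  moreover have "AE \<omega> in P. \<omega> \<in> space P" by (rule AE_space)
  ultimately have "AE \<omega> in P. min_config \<omega> \<in> all_enclosed"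
  proof eventually_elim
    case (elim \<omega>)
    have \<omega>: "fst \<omega> \<in> space config_space" "snd \<omega> \<in> space config_space"
      using elim(3) by (auto simp: space_P)
    have fin: "finite (cluster (minus_sites (fst \<omega>)) a)" if "a \<in> minus_sites (fst \<omega>)" for a
    proof (rule enclosed_cluster_finite[OF _ that])
      show "enclosed a (fst \<omega>)"
        using elim(1) \<omega> that by (force simp: mem_Times_iff minus_sites_def)
    qed
    have reach: "finite ((round_rel \<omega>)\<^sup>* `` {s})" if s: "s \<in> free_sites \<omega>" for s
    proof (rule ccontr)
      assume inf: "infinite ((round_rel \<omega>)\<^sup>* `` {s})"
      have "\<omega> \<in> W s k" for k
        unfolding W_def using island_path_of_infinite[OF \<omega> fin s inf, of k] by blast
      then show False using elim(2) by blast
    qed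
    have "min_config \<omega> \<in> space config_space"
      using measurable_space[OF measurable_min_config, of \<omega>] \<omega> by (simp add: space_pair_measure mem_Times_iff)
    then show ?case using all_enclosed_min_config[OF \<omega> fin reach] by (simp add: all_enclosed_def)
  qed
  then show ?thesis by (simp only: P_def)
qed

lemma noisy_minus_phase_not_all_enclosed:
  assumes \<beta>: "ereal \<beta> > critical_beta" and \<epsilon>: "0 < \<epsilon>" "\<epsilon> < 1" and \<mu>: "minus_phase \<beta> \<mu>"
  shows "AE \<omega> in \<mu> \<Otimes>\<^sub>M bernoulli_field \<epsilon>. min_config \<omega> \<notin> all_enclosed"
proof -
  define P where "P = \<mu> \<Otimes>\<^sub>M bernoulli_field \<epsilon>"
  interpret \<nu>: prob_space "bernoulli_field \<epsilon>" using prob_space_bernoulli_field[OF \<epsilon>] .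
  have sets_\<mu> [simp]: "sets \<mu> = sets config_space" using \<mu> by (simp add: ising_limit_def)
  have sets_P: "sets P = sets (config_space \<Otimes>\<^sub>M config_space)"
    unfolding P_def by (rule sets_pair_measure_cong[OF sets_\<mu> sets_bernoulli_field])
  have space_P: "space P = space config_space \<times> space config_space"
    using sets_eq_imp_space_eq[OF sets_P] by (simp add: space_pair_measure)
  have "all_enclosed \<times> space config_space \<in> null_sets P"
  proof (rule null_setsI)
    show "emeasure P (all_enclosed \<times> space config_space) = 0"
      unfolding P_def using minus_phase_all_enclosed[OF \<beta> \<mu>] sets_all_enclosed
      by (subst \<nu>.emeasure_pair_measure_Times) auto
    show "all_enclosed \<times> space config_space \<in> sets P"
      unfolding sets_P using sets_all_enclosed by (intro pair_measureI) auto
  qed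
  then have "AE \<omega> in P. \<omega> \<notin> all_enclosed \<times> space config_space" by (rule AE_not_in)
  moreover have "AE \<omega> in P. \<omega> \<in> space P" by (rule AE_space)
  ultimately have "AE \<omega> in P. min_config \<omega> \<notin> all_enclosed"
  proof eventually_elim
    case (elim \<omega>)
    have \<omega>: "fst \<omega> \<in> space config_space" "snd \<omega> \<in> space config_space"
      using elim(2) by (auto simp: space_P)
    show ?case
    proof
      assume "min_config \<omega> \<in> all_enclosed"
      then have "\<forall>i. enclosed i (fst \<omega>)"
        using min_config_eq_1[OF \<omega>] unfolding all_enclosed_def enclosed_def by blast
      then show False using elim(1) \<omega> by (auto simp: all_enclosed_def mem_Times_iff)
    qed
  qed
  then show ?thesis by (simp only: P_def)
qed

lemma measure_noisy_field_eq_1: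
  assumes "prob_space \<mu>" "sets \<mu> = sets config_space" and \<epsilon>: "0 < \<epsilon>" "\<epsilon> < 1"
    and S: "S \<in> sets config_space" and ae: "AE \<omega> in \<mu> \<Otimes>\<^sub>M bernoulli_field \<epsilon>. min_config \<omega> \<in> S"
  shows "measure (noisy_field \<mu> \<epsilon>) S = 1"
proof -
  interpret \<mu>: prob_space \<mu> by fact
  interpret \<nu>: prob_space "bernoulli_field \<epsilon>" using prob_space_bernoulli_field[OF \<epsilon>] .
  interpret pair_prob_space \<mu> "bernoulli_field \<epsilon>" ..
  have meas: "min_config \<in> measurable (\<mu> \<Otimes>\<^sub>M bernoulli_field \<epsilon>) config_space"
    using measurable_min_config sets_pair_measure_cong[OF assms(2) sets_bernoulli_field[of \<epsilon>]]
    by (simp cong: measurable_cong_sets)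
  have "prob_space (noisy_field \<mu> \<epsilon>)"
    unfolding noisy_field_eq by (rule P.prob_space_distr[OF meas])
  moreover have "AE x in noisy_field \<mu> \<epsilon>. x \<in> S"
    unfolding noisy_field_eq using S ae by (subst AE_distr_iff[OF meas]) auto
  moreover have "S \<in> sets (noisy_field \<mu> \<epsilon>)" using S by (simp add: noisy_field_def)
  ultimately show ?thesis using prob_space.prob_eq_1 by blast
qed

text \<open>Write e for exp(-2\<beta>) and B for 52488. The threshold says 32 B^2 e < 1. Then Be <
  1/2, so the denominator costs at most a factor 2 and the jump term is at most 32 B^2 e^2 \<le> e.
  What remains is (1/3 - e)(3 + e) = 1 - 8e/3 - e^2 < 1.\<close>

lemma round_rate_less_1:
  assumes "\<beta> > ln (32 * 52488\<^sup>2) / 2" "0 < \<epsilon>" "\<epsilon> < 1 / 3 - exp (- 2 * \<beta>)"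
  shows "52488 * exp (- 2 * \<beta>) < 1" "round_rate \<beta> \<epsilon> < 1"
proof -
  define B e where "B = (52488 :: real)" and "e = exp (- 2 * \<beta>)"
  have e0: "e > 0" by (simp add: e_def)
  have "- 2 * \<beta> < - ln (32 * B\<^sup>2)" using assms(1) by (simp add: B_def)
  then have "e < exp (- ln (32 * B\<^sup>2))" unfolding e_def by (subst exp_less_cancel_iff)
  also have "\<dots> = 1 / (32 * B\<^sup>2)" by (simp add: exp_minus B_def inverse_eq_divide)
  finally have e: "32 * B\<^sup>2 * e < 1" by (simp add: B_def field_simps)
  have "2 * B \<le> 32 * B\<^sup>2" by (simp add: B_def)
  then have "2 * B * e \<le> 32 * B\<^sup>2 * e" using e0 by (intro mult_right_mono) auto
  then have Be: "B * e < 1 / 2" using e by linarith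
  then show "52488 * exp (- 2 * \<beta>) < 1" by (simp add: B_def e_def)
  have "(B * e)\<^sup>2 / (1 - B * e) \<le> (B * e)\<^sup>2 / (1 / 2)"
    using Be by (intro divide_left_mono) auto
  then have "16 * ((B * e)\<^sup>2 / (1 - B * e)) \<le> 32 * (B * e)\<^sup>2" by simp
  also have "\<dots> = 32 * B\<^sup>2 * e * e" by (simp add: power2_eq_square)
  also have "\<dots> \<le> e" using mult_right_mono[of "32 * B\<^sup>2 * e" 1 e] e e0 by simp
  finally have "round_rate \<beta> \<epsilon> \<le> \<epsilon> * (3 + e)"
    unfolding round_rate_def B_def[symmetric] e_def[symmetric] using assms(2) by (intro mult_left_mono) auto
  also have "\<dots> \<le> (1 / 3 - e) * (3 + e)"
    using assms(3) e0 by (intro mult_right_mono) (auto simp: e_def)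
  also have "\<dots> < 1" using e0 by (simp add: algebra_simps add_pos_pos)
  finally show "round_rate \<beta> \<epsilon> < 1" .
qed

theorem theorem3:
  "(\<exists>\<beta>\<^sub>0::real. \<beta>\<^sub>0 \<ge> ln 3 / 2 \<and>
      (\<forall>\<beta> \<epsilon> :: real. \<forall>\<mu> :: config measure.
         \<beta> > \<beta>\<^sub>0 \<longrightarrow> 0 < \<epsilon> \<longrightarrow> \<epsilon> < 1 \<longrightarrow> \<epsilon> < 1 / 3 - exp (- 2 * \<beta>) \<longrightarrow> plus_phase \<beta> \<mu> \<longrightarrow>
         measure (noisy_field \<mu> \<epsilon>)
           (\<Inter>i. {x \<in> space config_space. finite (context_support i x)}) = 1))
   \<and>
   (\<forall>\<beta> \<epsilon> :: real. \<forall>\<mu> :: config measure.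
      ereal \<beta> > critical_beta \<longrightarrow> 0 < \<epsilon> \<longrightarrow> \<epsilon> < 1 \<longrightarrow> minus_phase \<beta> \<mu> \<longrightarrow>
      measure (noisy_field \<mu> \<epsilon>)
        (\<Union>i. {x \<in> space config_space. infinite (context_support i x)}) = 1)"
\<comment> \<open>The witness is the value of \<beta> at which 32 * 52488^2 * exp(-2\<beta>) equals
  1, as used in \<open>round_rate_less_1\<close>.\<close>
proof (intro conjI exI[of _ "ln (32 * 52488\<^sup>2) / 2"] allI impI)
  have fin: "(\<Inter>i. {x \<in> space config_space. finite (context_support i x)}) = all_enclosed"
    by (auto simp: all_enclosed_def finite_context_support_iff)
  have inf: "(\<Union>i. {x \<in> space config_space. infinite (context_support i x)}) = space config_space - all_enclosed"
    by (auto simp: all_enclosed_def finite_context_support_iff)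
  show "ln (32 * 52488\<^sup>2) / 2 \<ge> (ln 3 / 2 :: real)" by simp
  fix \<beta> \<epsilon> :: real and \<mu> :: "config measure"
  assume \<epsilon>: "0 < \<epsilon>" "\<epsilon> < 1"
  {
    assume \<beta>: "\<beta> > ln (32 * 52488\<^sup>2) / 2" "\<epsilon> < 1 / 3 - exp (- 2 * \<beta>)" and \<mu>: "plus_phase \<beta> \<mu>"
    show "measure (noisy_field \<mu> \<epsilon>) (\<Inter>i. {x \<in> space config_space. finite (context_support i x)}) = 1"
      unfolding fin
      using \<mu> noisy_plus_phase_all_enclosed[OF \<mu> \<epsilon> round_rate_less_1[OF \<beta>(1) \<epsilon>(1) \<beta>(2)]]
      by (intro measure_noisy_field_eq_1 \<epsilon> sets_all_enclosed) (auto simp: ising_limit_def)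
  next
    assume \<beta>: "ereal \<beta> > critical_beta" and \<mu>: "minus_phase \<beta> \<mu>"
    have "AE \<omega> in \<mu> \<Otimes>\<^sub>M bernoulli_field \<epsilon>. min_config \<omega> \<in> space config_space - all_enclosed"
      using noisy_minus_phase_not_all_enclosed[OF \<beta> \<epsilon> \<mu>] AE_space
    proof eventually_elim
      case (elim \<omega>)
      have "sets \<mu> = sets config_space" using \<mu> by (simp add: ising_limit_def)
      then have "\<omega> \<in> space (config_space \<Otimes>\<^sub>M config_space)"
        using elim(2) sets_eq_imp_space_eq[of \<mu> config_space] by (simp add: space_pair_measure)
      then show ?case using elim(1) measurable_space[OF measurable_min_config] by blast
    qed
    then show "measure (noisy_field \<mu> \<epsilon>) (\<Union>i. {x \<in> space config_space. infinite (context_support i x)}) = 1"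
      unfolding inf using \<mu>
      by (intro measure_noisy_field_eq_1 \<epsilon>) (auto simp: ising_limit_def)
  }
qed

end
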